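(* Let $M\ge 1/2$ and consider, on $(-\pi/2,\pi/2)$, solutions $\Phi=(\Phi^{(1)},\Phi^{(2)})^T$ of $\mathbb{D}\Phi=\omega\Phi$, where $\mathbb{D}=\begin{pmatrix}0&-\frac{d}{d\rho}+M\sec\rho\\ \frac{d}{d\rho}+M\sec\rho&0\end{pmatrix}$ and $\omega\in\mathbb{R}$. Put $\omega_n=\frac12+M+n$ for $n\in\mathbb{N}\cup\{0\}$. Then: (a) A solution $\Phi$ is square-integrable on $(-\pi/2,\pi/2)$ if and only if it satisfies the Dirichlet type I condition $\widetilde{\Phi^{(2)}}(\pi/2)=0=\widetilde{\Phi^{(1)}}(-\pi/2)$ (limits as $\rho\to\pm\pi/2$). (b) Non-zero square-integrable solutions exist exactly for $\omega\in\{\pm\omega_n:n\ge0\}$; for $\omega=\pm\omega_n$ they are spanned by a single normalized spinor, which, with its time dependence, is $$\Psi^{\pm}_{n}(t,\rho)=N_n(\cos\rho)^M\begin{pmatrix}(1+\sin\rho)^{1/2}P_n^{(-\frac12+M,\frac12+M)}(\sin\rho)\\ \pm(1-\sin\rho)^{1/2}P_n^{(\frac12+M,-\frac12+M)}(\sin\rho)\end{pmatrix}e^{\mp i\omega_nt},\qquad N_n=\frac{\sqrt{n!\,\Gamma(n+2M+1)}}{2^{M+1/2}\Gamma(\frac12+M+n)}.$$ (c) The linear span of $\{\Psi_n^+\}_{n\ge0}$ and the linear span of $\{\Psi_n^-\}_{n\ge0}$ are each invariant under $L_0,L_+,L_-$, and they form the discrete series representations $\mathscr{D}^{+}_{1/2+M}$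 and $\mathscr{D}^{-}_{1/2+M}$, respectively.
   Context: $\sigma(\rho)=\left(\frac{1-\sin\rho}{1+\sin\rho}\right)^{1/2}$; $\widetilde{\Phi^{(1)}}=\sigma^{-M}\Phi^{(1)}$, $\widetilde{\Phi^{(2)}}=\sigma^{M}\Phi^{(2)}$. $P_n^{(a,b)}$ are Jacobi polynomials. The inner product is $\langle\Psi_1,\Psi_2\rangle=\int_{-\pi/2}^{\pi/2}\Psi_1(t,\rho)^\dagger\Psi_2(t,\rho)\,d\rho$, which is independent of $t$ for the solutions considered. The infinitesimal action of $\widetilde{\mathrm{SL}}(2,\mathbb{R})$ on spinors $\Psi(t,\rho)$ is given by $L_0=i\partial_t$ and $$L_\pm=e^{\mp it}\Big(\pm i\cos\rho\,\partial_\rho\mp\tfrac{i}{2}\sin\rho+\sin\rho\,\partial_t+\cos\rho\,\Sigma^{01}\Big),\qquad \Sigma^{01}=\tfrac12\begin{pmatrix}0&i\\-i&0\end{pmatrix},$$ which satisfy $[L_0,L_\pm]=\pm L_\pm$ and $[L_+,L_-]=2L_0$. The Casimir operator is $Q=L_0^2+\frac12(L_+L_-+L_-L_+)$. A space of modes forms a unitary representation (at the Lie algebra level) when it has an orthonormal basis of $L_0$-eigenvectors and $L_\pm^\dagger=-L_\mp$ on it. For $\lambda>0$, the representation $\mathscr{D}^{\pm}_{\lambda}$ is the irreducible unitary one whose $L_0$-eigenvalues are $\pm(\lambda+n)$, $n\in\mathbb{N}\cup\{0\}$, each of multiplicity one, with $Q=\lambda(\lambda-1)$ (lowest-weight vector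 annihilated by $L_-$ for $+$, highest-weight vector annihilated by $L_+$ for $-$). *)

theory Defs
  imports "HOL-Analysis.Analysis" "HOL-Library.Function_Algebras"
begin

section \<open>Jacobi polynomials\<close>

text \<open>
  The classical explicit formula (Szego, eq. (4.3.2); equivalently Rodrigues' formula expanded by
  the Leibniz rule), which makes sense for all real parameters.
\<close>

definition jacobi_poly :: "nat \<Rightarrow> real \<Rightarrow> real \<Rightarrow> real \<Rightarrow> real" where
  "jacobi_poly n a b x =
     (\<Sum>k\<le>n. ((real n + a) gchoose k) * ((real n + b) gchoose (n - k)) *
        (x - 1) ^ (n - k) * (x + 1) ^ k) / 2 ^ n"


section \<open>The spatial problem\<close>

definition rho_interval :: "real set" where
  "rho_interval = {- pi / 2 <..< pi / 2}"

definition sigma :: "real \<Rightarrow> real" where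
  "sigma \<rho> = ((1 - sin \<rho>) / (1 + sin \<rho>)) powr (1 / 2)"

definition dirac_op :: "real \<Rightarrow> (real \<Rightarrow> complex^2) \<Rightarrow> real \<Rightarrow> complex^2" where
  "dirac_op M \<Phi> \<rho> = vector
     [- vector_derivative (\<lambda>r. \<Phi> r $ 2) (at \<rho>) + complex_of_real (M / cos \<rho>) * \<Phi> \<rho> $ 2,
        vector_derivative (\<lambda>r. \<Phi> r $ 1) (at \<rho>) + complex_of_real (M / cos \<rho>) * \<Phi> \<rho> $ 1]"

definition dirac_solution :: "real \<Rightarrow> real \<Rightarrow> (real \<Rightarrow> complex^2) \<Rightarrow> bool" where
  "dirac_solution M \<omega> \<Phi> \<longleftrightarrow>
     (\<forall>\<rho>\<in>rho_interval. \<Phi> differentiable (at \<rho>) \<and>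
        dirac_op M \<Phi> \<rho> = complex_of_real \<omega> *s \<Phi> \<rho>)"

definition square_integrable :: "(real \<Rightarrow> complex^2) \<Rightarrow> bool" where
  "square_integrable \<Phi> \<longleftrightarrow>
     set_borel_measurable lborel rho_interval \<Phi> \<and>
     set_integrable lborel rho_interval (\<lambda>\<rho>. (norm (\<Phi> \<rho>))\<^sup>2)"

definition tilde1 :: "real \<Rightarrow> (real \<Rightarrow> complex^2) \<Rightarrow> real \<Rightarrow> complex" where
  "tilde1 M \<Phi> \<rho> = complex_of_real (sigma \<rho> powr (- M)) * \<Phi> \<rho> $ 1"

definition tilde2 :: "real \<Rightarrow> (real \<Rightarrow> complex^2) \<Rightarrow> real \<Rightarrow> complex" where
  "tilde2 M \<Phi> \<rho> = complex_of_real (sigma \<rho> powr M) * \<Phi> \<rho> $ 2"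

definition dirichlet_I :: "real \<Rightarrow> (real \<Rightarrow> complex^2) \<Rightarrow> bool" where
  "dirichlet_I M \<Phi> \<longleftrightarrow>
     (tilde2 M \<Phi> \<longlongrightarrow> 0) (at_left (pi / 2)) \<and>
     (tilde1 M \<Phi> \<longlongrightarrow> 0) (at_right (- pi / 2))"


section \<open>Spinors on the strip\<close>

text \<open>
  A spinor on the strip (all \<open>t\<close>, and \<open>\<rho>\<close> in the open interval) is encoded as a total function
  that vanishes outside the strip, so that equality of functions is equality on the strip.
  The operators below return functions of this kind; as the interval is open, the partial
  derivatives at its points do not see the extension by zero.
\<close>

type_synonym spinor = "real \<Rightarrow> real \<Rightarrow> complex^2"

definition on_strip :: "spinor \<Rightarrow> spinor" where
  "on_strip \<Psi> = (\<lambda>t \<rho>. if \<rho> \<in> rho_interval then \<Psi> t \<rho> else 0)"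

definition spinor_scale :: "complex \<Rightarrow> spinor \<Rightarrow> spinor" where
  "spinor_scale c \<Psi> = (\<lambda>t \<rho>. c *s \<Psi> t \<rho>)"

definition spinor_inner :: "real \<Rightarrow> spinor \<Rightarrow> spinor \<Rightarrow> complex" where
  "spinor_inner t \<Psi>\<^sub>1 \<Psi>\<^sub>2 =
     (LINT \<rho>:rho_interval|lborel. (\<Sum>i\<in>UNIV. cnj (\<Psi>\<^sub>1 t \<rho> $ i) * \<Psi>\<^sub>2 t \<rho> $ i))"

definition with_time :: "real \<Rightarrow> (real \<Rightarrow> complex^2) \<Rightarrow> spinor" where
  "with_time \<omega> \<Phi> = on_strip (\<lambda>t \<rho>. exp (- \<i> * complex_of_real (\<omega> * t)) *s \<Phi> \<rho>)"

definition omega :: "real \<Rightarrow> nat \<Rightarrow> real" where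
  "omega M n = 1 / 2 + M + real n"

definition norm_const :: "real \<Rightarrow> nat \<Rightarrow> real" where
  "norm_const M n =
     sqrt (fact n * Gamma (real n + 2 * M + 1)) /
       (2 powr (M + 1 / 2) * Gamma (1 / 2 + M + real n))"

text \<open>The argument \<open>s\<close> is the sign: \<open>Psi 1 M n\<close> is \<open>\<Psi>\<^sub>n\<^sup>+\<close> and \<open>Psi (-1) M n\<close> is \<open>\<Psi>\<^sub>n\<^sup>-\<close>.\<close>

definition Psi :: "real \<Rightarrow> real \<Rightarrow> nat \<Rightarrow> spinor" where
  "Psi s M n = with_time (s * omega M n) (\<lambda>\<rho>.
     complex_of_real (norm_const M n * cos \<rho> powr M) *s
       vector
         [complex_of_real
            (sqrt (1 + sin \<rho>) * jacobi_poly n (- 1 / 2 + M) (1 / 2 + M) (sin \<rho>)),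
          complex_of_real
            (s * sqrt (1 - sin \<rho>) * jacobi_poly n (1 / 2 + M) (- 1 / 2 + M) (sin \<rho>))])"


section \<open>The infinitesimal action\<close>

definition d_t :: "spinor \<Rightarrow> spinor" where
  "d_t \<Psi> = (\<lambda>t \<rho>. vector_derivative (\<lambda>u. \<Psi> u \<rho>) (at t))"

definition d_rho :: "spinor \<Rightarrow> spinor" where
  "d_rho \<Psi> = (\<lambda>t \<rho>. vector_derivative (\<lambda>r. \<Psi> t r) (at \<rho>))"

definition Sigma01 :: "complex^2^2" where
  "Sigma01 = (1 / 2) *\<^sub>R vector [vector [0, \<i>], vector [- \<i>, 0]]"

definition L_zero :: "spinor \<Rightarrow> spinor" where
  "L_zero \<Psi> = on_strip (\<lambda>t \<rho>. \<i> *s d_t \<Psi> t \<rho>)"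

definition L_plus :: "spinor \<Rightarrow> spinor" where
  "L_plus \<Psi> = on_strip (\<lambda>t \<rho>. exp (- \<i> * complex_of_real t) *s
     ((\<i> * complex_of_real (cos \<rho>)) *s d_rho \<Psi> t \<rho>
      - (\<i> / 2 * complex_of_real (sin \<rho>)) *s \<Psi> t \<rho>
      + complex_of_real (sin \<rho>) *s d_t \<Psi> t \<rho>
      + complex_of_real (cos \<rho>) *s (Sigma01 *v \<Psi> t \<rho>)))"

definition L_minus :: "spinor \<Rightarrow> spinor" where
  "L_minus \<Psi> = on_strip (\<lambda>t \<rho>. exp (\<i> * complex_of_real t) *s
     (- ((\<i> * complex_of_real (cos \<rho>)) *s d_rho \<Psi> t \<rho>)
      + (\<i> / 2 * complex_of_real (sin \<rho>)) *s \<Psi> t \<rho>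
      + complex_of_real (sin \<rho>) *s d_t \<Psi> t \<rho>
      + complex_of_real (cos \<rho>) *s (Sigma01 *v \<Psi> t \<rho>)))"


section \<open>Unitary representations and the discrete series\<close>

locale complex_vector_space = vector_space scale
  for scale :: "complex \<Rightarrow> 'b::ab_group_add \<Rightarrow> 'b" (infixr \<open>*c\<close> 75)
begin

definition invariant_under :: "('b \<Rightarrow> 'b) \<Rightarrow> 'b set \<Rightarrow> bool" where
  "invariant_under T V \<longleftrightarrow> (\<forall>v\<in>V. T v \<in> V)"

definition linear_op_on :: "'b set \<Rightarrow> ('b \<Rightarrow> 'b) \<Rightarrow> bool" where
  "linear_op_on V T \<longleftrightarrow>
     (\<forall>u\<in>V. \<forall>v\<in>V. T (u + v) = T u + T v) \<and> (\<forall>c. \<forall>v\<in>V. T (c *c v) = c *c T v)"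

definition inner_product_on :: "'b set \<Rightarrow> ('b \<Rightarrow> 'b \<Rightarrow> complex) \<Rightarrow> bool" where
  "inner_product_on V ip \<longleftrightarrow>
     (\<forall>u\<in>V. \<forall>v\<in>V. \<forall>w\<in>V. ip u (v + w) = ip u v + ip u w) \<and>
     (\<forall>c. \<forall>u\<in>V. \<forall>v\<in>V. ip u (c *c v) = c * ip u v) \<and>
     (\<forall>u\<in>V. \<forall>v\<in>V. ip v u = cnj (ip u v)) \<and>
     (\<forall>v\<in>V. v \<noteq> 0 \<longrightarrow> Im (ip v v) = 0 \<and> Re (ip v v) > 0)"

text \<open>
  A representation of the Lie algebra on the subspace \<open>V\<close>, by the restrictions to \<open>V\<close> of
  operators \<open>L0\<close>, \<open>Lp\<close>, \<open>Lm\<close> satisfying \<open>[L\<^sub>0, L\<^sub>\<plusminus>] = \<plusminus>L\<^sub>\<plusminus>\<close> and \<open>[L\<^sub>+, L\<^sub>-] = 2L\<^sub>0\<close>.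
\<close>

definition sl2_rep ::
    "'b set \<Rightarrow> ('b \<Rightarrow> 'b) \<Rightarrow> ('b \<Rightarrow> 'b) \<Rightarrow> ('b \<Rightarrow> 'b) \<Rightarrow> bool" where
  "sl2_rep V L0 Lp Lm \<longleftrightarrow>
     subspace V \<and>
     (\<forall>T\<in>{L0, Lp, Lm}. invariant_under T V \<and> linear_op_on V T) \<and>
     (\<forall>v\<in>V. L0 (Lp v) - Lp (L0 v) = Lp v) \<and>
     (\<forall>v\<in>V. L0 (Lm v) - Lm (L0 v) = - Lm v) \<and>
     (\<forall>v\<in>V. Lp (Lm v) - Lm (Lp v) = 2 *c L0 v)"

text \<open>Bases are algebraic ones, as \<open>V\<close> is the space of finite combinations of modes.\<close>

definition unitary_sl2_rep ::
    "('b \<Rightarrow> 'b \<Rightarrow> complex) \<Rightarrow> 'b set \<Rightarrow> ('b \<Rightarrow> 'b) \<Rightarrow> ('b \<Rightarrow> 'b) \<Rightarrow> ('b \<Rightarrow> 'b) \<Rightarrow> bool" where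
  "unitary_sl2_rep ip V L0 Lp Lm \<longleftrightarrow>
     sl2_rep V L0 Lp Lm \<and>
     inner_product_on V ip \<and>
     (\<exists>B. independent B \<and> span B = V \<and>
        (\<forall>b\<in>B. \<exists>\<mu>. L0 b = \<mu> *c b) \<and>
        (\<forall>b\<in>B. \<forall>b'\<in>B. ip b b' = (if b = b' then 1 else 0))) \<and>
     (\<forall>u\<in>V. \<forall>v\<in>V. ip (Lp u) v = ip u (- Lm v)) \<and>
     (\<forall>u\<in>V. \<forall>v\<in>V. ip (Lm u) v = ip u (- Lp v))"

definition irreducible_sl2_rep ::
    "'b set \<Rightarrow> ('b \<Rightarrow> 'b) \<Rightarrow> ('b \<Rightarrow> 'b) \<Rightarrow> ('b \<Rightarrow> 'b) \<Rightarrow> bool" where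
  "irreducible_sl2_rep V L0 Lp Lm \<longleftrightarrow>
     sl2_rep V L0 Lp Lm \<and> V \<noteq> {0} \<and>
     (\<forall>W. subspace W \<and> W \<subseteq> V \<and> (\<forall>T\<in>{L0, Lp, Lm}. invariant_under T W)
        \<longrightarrow> W = {0} \<or> W = V)"

definition casimir :: "('b \<Rightarrow> 'b) \<Rightarrow> ('b \<Rightarrow> 'b) \<Rightarrow> ('b \<Rightarrow> 'b) \<Rightarrow> 'b \<Rightarrow> 'b" where
  "casimir L0 Lp Lm v = L0 (L0 v) + (1 / 2) *c (Lp (Lm v) + Lm (Lp v))"

definition eigenspace_in :: "'b set \<Rightarrow> ('b \<Rightarrow> 'b) \<Rightarrow> complex \<Rightarrow> 'b set" where
  "eigenspace_in V T \<mu> = {v \<in> V. T v = \<mu> *c v}"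

definition discrete_series_plus ::
    "real \<Rightarrow> ('b \<Rightarrow> 'b \<Rightarrow> complex) \<Rightarrow> 'b set \<Rightarrow> ('b \<Rightarrow> 'b) \<Rightarrow> ('b \<Rightarrow> 'b) \<Rightarrow> ('b \<Rightarrow> 'b) \<Rightarrow> bool" where
  "discrete_series_plus l ip V L0 Lp Lm \<longleftrightarrow>
     l > 0 \<and>
     unitary_sl2_rep ip V L0 Lp Lm \<and>
     irreducible_sl2_rep V L0 Lp Lm \<and>
     {\<mu>. eigenspace_in V L0 \<mu> \<noteq> {0}} = {complex_of_real (l + real n) | n. True} \<and>
     (\<forall>n. dim (eigenspace_in V L0 (complex_of_real (l + real n))) = 1) \<and>
     (\<forall>v\<in>V. casimir L0 Lp Lm v = complex_of_real (l * (l - 1)) *c v) \<and>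
     (\<forall>v\<in>eigenspace_in V L0 (complex_of_real l). Lm v = 0)"

definition discrete_series_minus ::
    "real \<Rightarrow> ('b \<Rightarrow> 'b \<Rightarrow> complex) \<Rightarrow> 'b set \<Rightarrow> ('b \<Rightarrow> 'b) \<Rightarrow> ('b \<Rightarrow> 'b) \<Rightarrow> ('b \<Rightarrow> 'b) \<Rightarrow> bool" where
  "discrete_series_minus l ip V L0 Lp Lm \<longleftrightarrow>
     l > 0 \<and>
     unitary_sl2_rep ip V L0 Lp Lm \<and>
     irreducible_sl2_rep V L0 Lp Lm \<and>
     {\<mu>. eigenspace_in V L0 \<mu> \<noteq> {0}} = {complex_of_real (- (l + real n)) | n. True} \<and>
     (\<forall>n. dim (eigenspace_in V L0 (complex_of_real (- (l + real n)))) = 1) \<and>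
     (\<forall>v\<in>V. casimir L0 Lp Lm v = complex_of_real (l * (l - 1)) *c v) \<and>
     (\<forall>v\<in>eigenspace_in V L0 (complex_of_real (- l)). Lp v = 0)"

end

interpretation spinors: complex_vector_space spinor_scale
  by unfold_locales
    (simp_all add: spinor_scale_def fun_eq_iff vec_eq_iff algebra_simps)

end

theory Submission
  imports Defs
begin

text \<open>
  The Dirac system is real, so it suffices to study real pairs \<open>(f, g)\<close>. Near \<open>\<rho> = \<pi>/2\<close> the
  quantities \<open>E = f\<^sup>2 + g\<^sup>2\<close> and \<open>G = g\<^sup>2 - f\<^sup>2\<close> satisfy \<open>E' = 2 M sec \<rho> G\<close> and
  \<open>G' \<ge> (2 M sec \<rho> - 2 \<bar>\<omega>\<bar>) E\<close>. If \<open>G\<close> is positive once, it grows like \<open>\<sigma>\<close> to the power \<open>-2M\<close>, and the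
  solution is neither square-integrable nor Dirichlet; otherwise \<open>E\<close> decreases, to \<open>0\<close>. With the
  reflection \<open>\<rho> \<mapsto> -\<rho>\<close> this shows that both conditions mean decay at both ends, and
  two decaying solutions have vanishing Wronskian, hence are proportional.

  On a solution, the lowering operator acts by a matrix with bounded trigonometric entries and
  determinant \<open>(\<omega> - 1/2)\<^sup>2 - M\<^sup>2\<close>, so it preserves decay, and integration by parts gives
  \<open>\<parallel>A\<Phi>\<parallel>\<^sup>2 = ((\<omega> - 1/2)\<^sup>2 - M\<^sup>2) \<parallel>\<Phi>\<parallel>\<^sup>2\<close>. Lowering an eigenvalue off the spectrum makes the right-hand side
  negative, which gives the quantisation; on the spectrum, uniqueness forces \<open>A\<close> to map each mode to a
  multiple of the previous one, and the multiple is read off at \<open>\<rho> = \<pi>/2\<close>. The norms then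
  follow by induction from a Beta integral, and the representations from the ladder relations.
\<close>

section \<open>The real radial system\<close>

text \<open>Both ends of the interval are singular points of the system. At the right end
  \<open>f\<close> tends to behave like \<open>sigma\<close> to the power \<open>M\<close> and
  \<open>g\<close> like \<open>sigma\<close> to the power \<open>- M\<close>; the sign of
  \<open>G\<close> tells the two behaviours apart without any series or hypergeometric solutions.
  Powers of \<open>sigma\<close> are the natural integrating factors, because
  \<open>ln (sigma \<rho>)\<close> has derivative \<open>- 1 / cos \<rho>\<close>. Growth
  contradicts the Dirichlet condition because it keeps \<open>sigma powr M * g\<close> away from
  \<open>0\<close>, and it contradicts integrability because \<open>2 * M \<ge> 1\<close> puts
  \<open>sigma powr (- 2 * M)\<close> above the secant, whose integral diverges.

  With \<open>k = \<omega> - 1 / 2\<close>, the number \<open>k\<^sup>2 - M\<^sup>2\<close> is both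
  the determinant of the lowering matrix and the factor in the norm identity. It is negative for
  \<open>\<bar>k\<bar> < M\<close>, so no solution survives there. In the base strip
  \<open>0 \<le> \<omega> < M + 1 / 2\<close> it fails to be negative at one point only,
  \<open>\<omega> = 0\<close> with \<open>M = 1 / 2\<close>, where it is \<open>0\<close> and a
  separate argument is required. Negative frequencies come from positive ones by changing the sign
  of \<open>g\<close>.\<close>

lemma cos_pos_rho: "\<rho> \<in> rho_interval \<Longrightarrow> cos \<rho> > 0"
  unfolding rho_interval_def by (auto intro: cos_gt_zero_pi)

lemma rho_interval_open [simp]: "open rho_interval"
  by (simp add: rho_interval_def)

lemma zero_in_rho [simp]: "0 \<in> rho_interval"
  by (simp add: rho_interval_def)

lemma uminus_in_rho [simp]: "- \<rho> \<in> rho_interval \<longleftrightarrow> \<rho> \<in> rho_interval"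
  by (auto simp: rho_interval_def)

lemma abs_sin_less_1: "\<rho> \<in> rho_interval \<Longrightarrow> \<bar>sin \<rho>\<bar> < 1"
  using cos_pos_rho[of \<rho>] by (simp flip: abs_square_less_1 add: sin_squared_eq)

section \<open>The function \<open>sigma\<close>: closed forms, derivatives, limits\<close>

lemma sigma_eq:
  assumes "\<rho> \<in> rho_interval"
  shows "sigma \<rho> = (1 - sin \<rho>) / cos \<rho>" "sigma \<rho> = cos \<rho> / (1 + sin \<rho>)"
proof -
  have c: "cos \<rho> > 0" and s: "1 - sin \<rho> > 0" "1 + sin \<rho> > 0"
    using cos_pos_rho[OF assms] abs_sin_less_1[OF assms] by auto
  have cc: "cos \<rho> * cos \<rho> = (1 - sin \<rho>) * (1 + sin \<rho>)"
    using sin_cos_squared_add[of \<rho>] by (simp add: power2_eq_square algebra_simps)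
  have eq: "(1 - sin \<rho>) / (1 + sin \<rho>) = ((1 - sin \<rho>) / cos \<rho>)\<^sup>2"
    using c s cc by (simp add: power2_eq_square divide_simps)
  show 1: "sigma \<rho> = (1 - sin \<rho>) / cos \<rho>"
    unfolding sigma_def using c s by (simp add: powr_half_sqrt eq)
  show "sigma \<rho> = cos \<rho> / (1 + sin \<rho>)"
    unfolding 1 using c s cc by (simp add: divide_simps)
qed

lemma sigma_pos: "\<rho> \<in> rho_interval \<Longrightarrow> sigma \<rho> > 0"
  using sigma_eq(1) cos_pos_rho abs_sin_less_1[of \<rho>] by auto

lemma sigma_minus: "\<rho> \<in> rho_interval \<Longrightarrow> sigma (- \<rho>) = inverse (sigma \<rho>)"
  using sigma_eq(1)[of "-\<rho>"] sigma_eq(2)[of \<rho>] by simp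

lemma sigma_has_derivative:
  assumes "\<rho> \<in> rho_interval"
  shows "(sigma has_real_derivative (- sigma \<rho> / cos \<rho>)) (at \<rho>)"
proof -
  have c: "cos \<rho> > 0" and s: "1 - sin \<rho> > 0"
    using cos_pos_rho[OF assms] abs_sin_less_1[OF assms] by auto
  have "((\<lambda>r. (1 - sin r) / cos r) has_real_derivative (- sigma \<rho> / cos \<rho>)) (at \<rho>)"
    using c sin_cos_squared_add[of \<rho>]
    by (auto intro!: derivative_eq_intros simp: sigma_eq(1)[OF assms] field_simps power2_eq_square)
  then show ?thesis
    by (rule has_field_derivative_transform_within_open[OF _ rho_interval_open assms])
      (simp add: sigma_eq(1))
qed

text \<open>Makes powers of \<open>sigma\<close> integrating factors: multiplication by
  \<open>sigma powr p\<close> subtracts \<open>p / cos \<rho>\<close> from the logarithmic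
  derivative, so suitable exponents cancel the singular terms \<open>M / cos \<rho>\<close>.\<close>

lemma sigma_powr_has_derivative:
  assumes "\<rho> \<in> rho_interval"
  shows "((\<lambda>r. sigma r powr p) has_real_derivative (- (p / cos \<rho>) * sigma \<rho> powr p)) (at \<rho>)"
  using sigma_pos[OF assms]
  by (auto intro!: derivative_eq_intros sigma_has_derivative[OF assms] simp: powr_diff)

lemma ln_sigma_has_derivative:
  assumes "\<rho> \<in> rho_interval"
  shows "((\<lambda>r. ln (sigma r)) has_real_derivative (- 1 / cos \<rho>)) (at \<rho>)"
  using sigma_pos[OF assms]
  by (auto intro!: derivative_eq_intros sigma_has_derivative[OF assms])

lemma eventually_in_rho_left: "\<forall>\<^sub>F \<rho> in at_left (pi / 2). \<rho> \<in> rho_interval"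
  using eventually_at_left_real[of "- pi / 2" "pi / 2"] by (simp add: rho_interval_def)

lemma eventually_in_rho_right: "\<forall>\<^sub>F \<rho> in at_right (- pi / 2). \<rho> \<in> rho_interval"
  using eventually_at_right_real[of "- pi / 2" "pi / 2"] by (simp add: rho_interval_def)

lemma sigma_tendsto_0: "(sigma \<longlongrightarrow> 0) (at_left (pi / 2))"
proof -
  have "((\<lambda>\<rho>. cos \<rho> / (1 + sin \<rho>)) \<longlongrightarrow> cos (pi / 2) / (1 + sin (pi / 2))) (at_left (pi / 2))"
    by (intro tendsto_intros) auto
  then have "((\<lambda>\<rho>. cos \<rho> / (1 + sin \<rho>)) \<longlongrightarrow> 0) (at_left (pi / 2))" by simp
  then show ?thesis
    by (rule Lim_transform_eventually)
      (use eventually_in_rho_left in \<open>eventually_elim, simp add: sigma_eq(2)\<close>)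
qed

text \<open>Since \<open>- ln (sigma \<rho>)\<close> is a primitive of the secant, this is the
  divergence of the integral of the secant at \<open>\<pi>/2\<close>.\<close>

lemma ln_sigma_at_bot: "filterlim (\<lambda>\<rho>. ln (sigma \<rho>)) at_bot (at_left (pi / 2))"
proof (rule filterlim_compose[OF ln_at_0])
  show "filterlim sigma (at_right 0) (at_left (pi / 2))"
    unfolding filterlim_at
    using sigma_tendsto_0 eventually_in_rho_left by (auto elim!: eventually_mono dest: sigma_pos)
qed

section \<open>Real solutions: symmetries, linearity, dependence on the value at
  \<open>0\<close>\<close>

definition radial_system :: "real \<Rightarrow> real \<Rightarrow> (real \<Rightarrow> real) \<Rightarrow> (real \<Rightarrow> real) \<Rightarrow> bool" where
  "radial_system M \<omega> f g \<longleftrightarrow> (\<forall>\<rho>\<in>rho_interval.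
     (f has_real_derivative (\<omega> * g \<rho> - M / cos \<rho> * f \<rho>)) (at \<rho>) \<and>
     (g has_real_derivative (M / cos \<rho> * g \<rho> - \<omega> * f \<rho>)) (at \<rho>))"

text \<open>Both limits are packed into the sum of squares, because this is the quantity whose
  monotonicity near an end is controlled.\<close>

definition vanish_at :: "real filter \<Rightarrow> (real \<Rightarrow> real) \<Rightarrow> (real \<Rightarrow> real) \<Rightarrow> bool" where
  "vanish_at F f g \<longleftrightarrow> ((\<lambda>\<rho>. (f \<rho>)\<^sup>2 + (g \<rho>)\<^sup>2) \<longlongrightarrow> 0) F"

text \<open>Changing the sign of the second component anticommutes with the Dirac operator, so it
  reverses the frequency.\<close>

lemma radial_system_uminus: "radial_system M \<omega> f g \<Longrightarrow> radial_system M (- \<omega>) f (\<lambda>\<rho>. - g \<rho>)"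
  unfolding radial_system_def by (auto intro!: derivative_eq_intros)

text \<open>The secant is even and the derivative changes sign under reflection; exchanging the two
  components compensates for this. Every statement about the right end thereby yields one about the
  left end.\<close>

lemma radial_system_reflect:
  assumes "radial_system M \<omega> f g"
  shows "radial_system M \<omega> (\<lambda>\<rho>. g (- \<rho>)) (\<lambda>\<rho>. f (- \<rho>))"
  unfolding radial_system_def
proof (intro ballI conjI)
  fix \<rho> assume r: "\<rho> \<in> rho_interval"
  then have r': "- \<rho> \<in> rho_interval" by simp
  have f: "(f has_real_derivative (\<omega> * g (- \<rho>) - M / cos (- \<rho>) * f (- \<rho>))) (at (- \<rho>))"
    and g: "(g has_real_derivative (M / cos (- \<rho>) * g (- \<rho>) - \<omega> * f (- \<rho>))) (at (- \<rho>))"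
    using assms r' unfolding radial_system_def by blast+
  show "((\<lambda>\<rho>. g (- \<rho>)) has_real_derivative \<omega> * f (- \<rho>) - M / cos \<rho> * g (- \<rho>)) (at \<rho>)"
    by (rule DERIV_cong[OF DERIV_chain2[where g = uminus, OF g DERIV_minus[OF DERIV_ident]]]) simp
  show "((\<lambda>\<rho>. f (- \<rho>)) has_real_derivative M / cos \<rho> * f (- \<rho>) - \<omega> * g (- \<rho>)) (at \<rho>)"
    by (rule DERIV_cong[OF DERIV_chain2[where g = uminus, OF f DERIV_minus[OF DERIV_ident]]]) simp
qed

lemma radial_system_lincomb:
  assumes "radial_system M \<omega> f g" "radial_system M \<omega> u v"
  shows "radial_system M \<omega> (\<lambda>\<rho>. a * f \<rho> + b * u \<rho>) (\<lambda>\<rho>. a * g \<rho> + b * v \<rho>)"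
  unfolding radial_system_def
proof (intro ballI conjI)
  fix \<rho> assume r: "\<rho> \<in> rho_interval"
  have d: "(f has_real_derivative (\<omega> * g \<rho> - M / cos \<rho> * f \<rho>)) (at \<rho>)"
     "(g has_real_derivative (M / cos \<rho> * g \<rho> - \<omega> * f \<rho>)) (at \<rho>)"
     "(u has_real_derivative (\<omega> * v \<rho> - M / cos \<rho> * u \<rho>)) (at \<rho>)"
     "(v has_real_derivative (M / cos \<rho> * v \<rho> - \<omega> * u \<rho>)) (at \<rho>)"
    using assms r unfolding radial_system_def by blast+
  show "((\<lambda>\<rho>. a * f \<rho> + b * u \<rho>) has_real_derivative
      \<omega> * (a * g \<rho> + b * v \<rho>) - M / cos \<rho> * (a * f \<rho> + b * u \<rho>)) (at \<rho>)"
    by (rule DERIV_cong[OF DERIV_add[OF DERIV_cmult[OF d(1)] DERIV_cmult[OF d(3)]]])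
      (simp only: ring_distribs mult_ac)
  show "((\<lambda>\<rho>. a * g \<rho> + b * v \<rho>) has_real_derivative
      M / cos \<rho> * (a * g \<rho> + b * v \<rho>) - \<omega> * (a * f \<rho> + b * u \<rho>)) (at \<rho>)"
    by (rule DERIV_cong[OF DERIV_add[OF DERIV_cmult[OF d(2)] DERIV_cmult[OF d(4)]]])
      (simp only: ring_distribs mult_ac)
qed

lemma radial_system_continuous:
  assumes "radial_system M \<omega> f g"
  shows "continuous_on rho_interval f" "continuous_on rho_interval g"
  using assms unfolding radial_system_def
  by (auto intro!: continuous_at_imp_continuous_on DERIV_isCont)

lemma DERIV_nonneg_imp_le:
  fixes h :: "real \<Rightarrow> real"
  assumes "a \<le> b" and "\<And>x. a \<le> x \<Longrightarrow> x \<le> b \<Longrightarrow> (h has_real_derivative h' x) (at x)"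
    and "\<And>x. a \<le> x \<Longrightarrow> x \<le> b \<Longrightarrow> h' x \<ge> 0"
  shows "h a \<le> h b"
proof (rule DERIV_nonneg_imp_nondecreasing[OF assms(1)])
  fix x assume "a \<le> x" "x \<le> b"
  then show "\<exists>y. (h has_real_derivative y) (at x) \<and> 0 \<le> y"
    using assms(2,3) by (intro exI[of _ "h' x"]) simp
qed

text \<open>The frequency acts on \<open>(f, g)\<close> as an infinitesimal rotation, so it drops
  out of the derivative of the sum of squares and leaves only a cross term, bounded by that sum, in
  the derivative of the difference.\<close>

lemma
  assumes "radial_system M \<omega> f g" and r: "\<rho> \<in> rho_interval"
  shows sum_squares_deriv:
      "((\<lambda>\<rho>. (f \<rho>)\<^sup>2 + (g \<rho>)\<^sup>2) has_real_derivative 2 * M / cos \<rho> * ((g \<rho>)\<^sup>2 - (f \<rho>)\<^sup>2)) (at \<rho>)"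
    and diff_squares_deriv:
      "((\<lambda>\<rho>. (g \<rho>)\<^sup>2 - (f \<rho>)\<^sup>2) has_real_derivative
          2 * M / cos \<rho> * ((f \<rho>)\<^sup>2 + (g \<rho>)\<^sup>2) - 4 * \<omega> * (f \<rho> * g \<rho>)) (at \<rho>)"
proof -
  have c: "cos \<rho> > 0" using cos_pos_rho[OF r] .
  have d: "(f has_real_derivative (\<omega> * g \<rho> - M / cos \<rho> * f \<rho>)) (at \<rho>)"
     "(g has_real_derivative (M / cos \<rho> * g \<rho> - \<omega> * f \<rho>)) (at \<rho>)"
    using assms unfolding radial_system_def by auto
  show "((\<lambda>\<rho>. (f \<rho>)\<^sup>2 + (g \<rho>)\<^sup>2) has_real_derivative 2 * M / cos \<rho> * ((g \<rho>)\<^sup>2 - (f \<rho>)\<^sup>2)) (at \<rho>)"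
    "((\<lambda>\<rho>. (g \<rho>)\<^sup>2 - (f \<rho>)\<^sup>2) has_real_derivative
          2 * M / cos \<rho> * ((f \<rho>)\<^sup>2 + (g \<rho>)\<^sup>2) - 4 * \<omega> * (f \<rho> * g \<rho>)) (at \<rho>)"
    by (auto intro!: derivative_eq_intros d
        simp: algebra_simps power2_eq_square add_divide_distrib diff_divide_distrib)
qed

text \<open>Uniqueness for the initial value at \<open>0\<close> by an integrating factor: the
  derivative of \<open>E * sigma powr (2 * M)\<close> is a non-positive multiple of
  \<open>f\<^sup>2\<close>, that of \<open>E * sigma powr (- 2 * M)\<close> a non-negative multiple
  of \<open>g\<^sup>2\<close>. To the right of \<open>0\<close> the former, to the left the latter
  is bounded by its value at \<open>0\<close>, which is \<open>0\<close>.\<close>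

lemma radial_system_zero:
  assumes sys: "radial_system M \<omega> f g" and M: "M \<ge> 0"
    and z: "f 0 = 0" "g 0 = 0" and r: "\<rho> \<in> rho_interval"
  shows "f \<rho> = 0" "g \<rho> = 0"
proof -
  define E where "E = (\<lambda>\<rho>. (f \<rho>)\<^sup>2 + (g \<rho>)\<^sup>2)"
  have E': "(E has_real_derivative 2 * M / cos x * ((g x)\<^sup>2 - (f x)\<^sup>2)) (at x)" if "x \<in> rho_interval" for x
    unfolding E_def by (rule sum_squares_deriv[OF sys that])
  have "E \<rho> = 0"
  proof (cases "\<rho> \<ge> 0")
    case True
    have "- E 0 * sigma 0 powr (2 * M) \<le> - E \<rho> * sigma \<rho> powr (2 * M)"
    proof (rule DERIV_nonneg_imp_le[OF True, where h = "\<lambda>x. - E x * sigma x powr (2 * M)"])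
      fix x assume "0 \<le> x" "x \<le> \<rho>"
      then have x: "x \<in> rho_interval" using r by (auto simp: rho_interval_def)
      show "((\<lambda>x. - E x * sigma x powr (2 * M)) has_real_derivative
         sigma x powr (2 * M) * (4 * M / cos x * (f x)\<^sup>2)) (at x)"
        by (rule DERIV_cong[OF DERIV_mult[OF DERIV_minus[OF E'[OF x]] sigma_powr_has_derivative[OF x]]])
          (simp add: E_def algebra_simps add_divide_distrib diff_divide_distrib)
      show "0 \<le> sigma x powr (2 * M) * (4 * M / cos x * (f x)\<^sup>2)"
        using cos_pos_rho[OF x] M by auto
    qed
    then have "E \<rho> \<le> 0" using z sigma_pos[OF r] by (simp add: E_def mult_le_0_iff zero_le_mult_iff)
    moreover have "E \<rho> \<ge> 0" by (simp add: E_def)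
    ultimately show ?thesis by simp
  next
    case False
    have "E \<rho> * sigma \<rho> powr (- 2 * M) \<le> E 0 * sigma 0 powr (- 2 * M)"
    proof (rule DERIV_nonneg_imp_le[where h = "\<lambda>x. E x * sigma x powr (- 2 * M)"])
      show "\<rho> \<le> 0" using False by simp
      fix x assume "\<rho> \<le> x" "x \<le> 0"
      then have x: "x \<in> rho_interval" using r by (auto simp: rho_interval_def)
      show "((\<lambda>x. E x * sigma x powr (- 2 * M)) has_real_derivative
         sigma x powr (- 2 * M) * (4 * M / cos x * (g x)\<^sup>2)) (at x)"
        by (rule DERIV_cong[OF DERIV_mult[OF E'[OF x] sigma_powr_has_derivative[OF x]]])
          (simp add: E_def algebra_simps add_divide_distrib diff_divide_distrib)
      show "0 \<le> sigma x powr (- 2 * M) * (4 * M / cos x * (g x)\<^sup>2)"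
        using cos_pos_rho[OF x] M by auto
    qed
    then have "E \<rho> \<le> 0" using z sigma_pos[OF r] by (simp add: E_def mult_le_0_iff zero_le_mult_iff)
    moreover have "E \<rho> \<ge> 0" by (simp add: E_def)
    ultimately show ?thesis by simp
  qed
  then show "f \<rho> = 0" "g \<rho> = 0" by (auto simp: E_def sum_power2_eq_zero_iff)
qed


lemma DERIV_nonneg_mono_rho:
  fixes h :: "real \<Rightarrow> real"
  assumes "a \<in> rho_interval" "b \<in> rho_interval" "a \<le> b"
    and "\<And>x. x \<in> rho_interval \<Longrightarrow> (h has_real_derivative h' x) (at x)"
    and "\<And>x. x \<in> rho_interval \<Longrightarrow> a \<le> x \<Longrightarrow> h' x \<ge> 0"
  shows "h a \<le> h b"
proof (rule DERIV_nonneg_imp_le[OF assms(3), of h h'])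
  fix x assume x: "a \<le> x" "x \<le> b"
  then have "x \<in> rho_interval" using assms(1,2) by (auto simp: rho_interval_def)
  then show "(h has_real_derivative h' x) (at x)" "h' x \<ge> 0" using assms(4,5) x by auto
qed

lemma two_mult_le_sum_squares: "2 * \<bar>x * y\<bar> \<le> x\<^sup>2 + (y::real)\<^sup>2"
  using sum_squares_bound[of "\<bar>x\<bar>" "\<bar>y\<bar>"] by (simp add: abs_mult)

lemma cos_eventually_small:
  assumes "c > 0"
  obtains \<rho>0 where "\<rho>0 \<in> rho_interval" "\<rho>0 \<ge> 0"
    "\<And>\<rho>. \<rho> \<in> rho_interval \<Longrightarrow> \<rho> \<ge> \<rho>0 \<Longrightarrow> cos \<rho> \<le> c"
proof -
  have "((\<lambda>\<rho>. cos \<rho>) \<longlongrightarrow> cos (pi / 2)) (at_left (pi / 2))" by (intro tendsto_intros)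
  then have "((\<lambda>\<rho>. cos \<rho>) \<longlongrightarrow> 0) (at_left (pi / 2))" by simp
  then have "\<forall>\<^sub>F \<rho> in at_left (pi / 2). cos \<rho> < c" using assms order_tendstoD(2) by blast
  then obtain b where b: "b < pi / 2" "\<And>\<rho>. b < \<rho> \<Longrightarrow> \<rho> < pi / 2 \<Longrightarrow> cos \<rho> < c"
    unfolding eventually_at_left_field by auto
  have "(max b 0 + pi / 2) / 2 \<in> rho_interval" "(max b 0 + pi / 2) / 2 \<ge> 0"
    "(max b 0 + pi / 2) / 2 > b"
    using b(1) pi_gt_zero by (auto simp: rho_interval_def max_def field_simps)
  then show ?thesis using b(2)
    by (intro that[of "(max b 0 + pi / 2) / 2"]) (auto simp: rho_interval_def intro: less_imp_le)
qed

section \<open>Behaviour at the ends of the interval\<close>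

text \<open>The growing alternative is phrased as a lower bound on \<open>g\<^sup>2\<close> alone:
  in that case \<open>G > 0\<close>, so \<open>g\<close> dominates, and it is \<open>g\<close> that
  the Dirichlet condition constrains at this end.\<close>

lemma right_end_dichotomy:
  assumes sys: "radial_system M \<omega> f g" and M: "M > 0"
  shows "(\<exists>\<rho>1\<in>rho_interval. \<rho>1 \<ge> 0 \<and> (\<exists>c>0. \<forall>\<rho>\<in>rho_interval. \<rho> \<ge> \<rho>1 \<longrightarrow>
            (g \<rho>)\<^sup>2 \<ge> c * sigma \<rho> powr (- 2 * M))) \<or> vanish_at (at_left (pi / 2)) f g"
proof -
  define E where "E = (\<lambda>\<rho>. (f \<rho>)\<^sup>2 + (g \<rho>)\<^sup>2)"
  define G where "G = (\<lambda>\<rho>. (g \<rho>)\<^sup>2 - (f \<rho>)\<^sup>2)"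
  have E': "(E has_real_derivative 2 * M / cos x * G x) (at x)" if "x \<in> rho_interval" for x
    unfolding E_def G_def by (rule sum_squares_deriv[OF sys that])
  have G': "(G has_real_derivative 2 * M / cos x * E x - 4 * \<omega> * (f x * g x)) (at x)"
    if "x \<in> rho_interval" for x
    unfolding E_def G_def by (rule diff_squares_deriv[OF sys that])
  have E0: "E x \<ge> 0" and GE: "G x \<le> E x" for x by (auto simp: E_def G_def)
  have fg: "2 * \<omega> * (f x * g x) \<le> \<bar>\<omega>\<bar> * E x" for x
  proof -
    have "2 * \<omega> * (f x * g x) \<le> \<bar>\<omega>\<bar> * (2 * \<bar>f x * g x\<bar>)"
      using abs_ge_self[of "2 * \<omega> * (f x * g x)"] by (simp add: abs_mult)
    also have "\<dots> \<le> \<bar>\<omega>\<bar> * E x" unfolding E_def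
      by (intro mult_left_mono two_mult_le_sum_squares) auto
    finally show ?thesis .
  qed
  \<comment> \<open>Beyond \<open>\<rho>0\<close> the singular coefficient satisfies
    \<open>M / cos \<rho> \<ge> 2 * \<bar>\<omega>\<bar>\<close>, which dominates the cross term in
    both cases below. The \<open>+ 1\<close> keeps the bound meaningful for
    \<open>\<omega> = 0\<close>.\<close>
  obtain \<rho>0 where \<rho>0: "\<rho>0 \<in> rho_interval" "\<rho>0 \<ge> 0"
    and cs: "\<And>\<rho>. \<rho> \<in> rho_interval \<Longrightarrow> \<rho> \<ge> \<rho>0 \<Longrightarrow> cos \<rho> \<le> M / (2 * \<bar>\<omega>\<bar> + 1)"
    using cos_eventually_small[of "M / (2 * \<bar>\<omega>\<bar> + 1)"] M by auto
  have sec: "M / cos \<rho> \<ge> 2 * \<bar>\<omega>\<bar>" if "\<rho> \<in> rho_interval" "\<rho> \<ge> \<rho>0" for \<rho>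
  proof -
    have "(2 * \<bar>\<omega>\<bar> + 1) * cos \<rho> \<le> M" using cs[OF that] by (simp add: field_simps)
    then show ?thesis using cos_pos_rho[OF that(1)] by (simp add: field_simps)
  qed
  show ?thesis
  proof (cases "\<exists>\<rho>1\<in>rho_interval. \<rho>1 \<ge> \<rho>0 \<and> G \<rho>1 > 0")
    case True
    then obtain \<rho>1 where \<rho>1: "\<rho>1 \<in> rho_interval" "\<rho>1 \<ge> \<rho>0" "G \<rho>1 > 0" by blast
    \<comment> \<open>\<open>h\<close> increases because \<open>G' \<ge> (2 M sec \<rho> - 2 \<bar>\<omega>\<bar>) G\<close>\<close>
    define h where "h = (\<lambda>\<rho>. G \<rho> * sigma \<rho> powr (2 * M) * exp (2 * \<bar>\<omega>\<bar> * \<rho>))"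
    have h: "h \<rho>1 \<le> h \<rho>" if "\<rho> \<in> rho_interval" "\<rho> \<ge> \<rho>1" for \<rho>
    proof (rule DERIV_nonneg_mono_rho[OF \<rho>1(1) that(1,2)])
      fix x assume x: "x \<in> rho_interval"
      show "(h has_real_derivative sigma x powr (2 * M) * exp (2 * \<bar>\<omega>\<bar> * x) *
          (2 * (M / cos x) * (E x - G x) + 2 * \<bar>\<omega>\<bar> * G x - 4 * \<omega> * (f x * g x))) (at x)"
        unfolding h_def
        by (rule DERIV_cong, (rule derivative_intros G' sigma_powr_has_derivative x)+)
          (simp add: algebra_simps diff_divide_distrib)
      assume "\<rho>1 \<le> x"
      \<comment> \<open>Together with the bound on the cross term, the bracket is at least
        \<open>2 * \<bar>\<omega>\<bar> * (E x - G x)\<close>, which is non-negative.\<close>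
      then have "2 * (2 * \<bar>\<omega>\<bar>) * (E x - G x) \<le> 2 * (M / cos x) * (E x - G x)"
        using sec[OF x] \<rho>1(2) GE[of x] by (intro mult_right_mono) auto
      moreover have "\<bar>\<omega>\<bar> * (2 * (E x - G x)) \<ge> 0" using GE[of x] by simp
      ultimately have "0 \<le> 2 * (M / cos x) * (E x - G x) + 2 * \<bar>\<omega>\<bar> * G x - 4 * \<omega> * (f x * g x)"
        using fg[of x] by (simp add: algebra_simps)
      then show "0 \<le> sigma x powr (2 * M) * exp (2 * \<bar>\<omega>\<bar> * x) *
          (2 * (M / cos x) * (E x - G x) + 2 * \<bar>\<omega>\<bar> * G x - 4 * \<omega> * (f x * g x))" by simp
    qed
    \<comment> \<open>As \<open>2 * \<rho> \<le> pi\<close> on the interval, the factor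
      \<open>exp (- \<bar>\<omega>\<bar> * pi)\<close> absorbs the exponential in \<open>h\<close>
      and makes the constant independent of \<open>\<rho>\<close>.\<close>
    define c where "c = h \<rho>1 * exp (- \<bar>\<omega>\<bar> * pi)"
    have "h \<rho>1 > 0" using \<rho>1 sigma_pos[OF \<rho>1(1)] by (simp add: h_def)
    then have "c > 0" by (simp add: c_def)
    moreover have "(g \<rho>)\<^sup>2 \<ge> c * sigma \<rho> powr (- 2 * M)" if r: "\<rho> \<in> rho_interval" "\<rho> \<ge> \<rho>1" for \<rho>
    proof -
      have "2 * \<rho> \<le> pi" using r by (auto simp: rho_interval_def)
      then have "\<bar>\<omega>\<bar> * (2 * \<rho>) \<le> \<bar>\<omega>\<bar> * pi" by (intro mult_left_mono) auto
      then have "exp (- \<bar>\<omega>\<bar> * pi) \<le> exp (- 2 * \<bar>\<omega>\<bar> * \<rho>)" by (simp add: algebra_simps)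
      then have "c \<le> h \<rho>1 * exp (- 2 * \<bar>\<omega>\<bar> * \<rho>)"
        using \<open>h \<rho>1 > 0\<close> by (simp add: c_def)
      also have "\<dots> \<le> h \<rho> * exp (- 2 * \<bar>\<omega>\<bar> * \<rho>)" using h[OF r] by (intro mult_right_mono) auto
      also have "\<dots> = G \<rho> * sigma \<rho> powr (2 * M)" by (simp add: h_def exp_minus)
      finally have "c * sigma \<rho> powr (- 2 * M) \<le> G \<rho> * sigma \<rho> powr (2 * M) * sigma \<rho> powr (- 2 * M)"
        by (intro mult_right_mono) auto
      also have "\<dots> = G \<rho>" using sigma_pos[OF r(1)] by (simp add: powr_minus)
      also have "\<dots> \<le> (g \<rho>)\<^sup>2" by (simp add: G_def)
      finally show ?thesis .
    qed
    ultimately show ?thesis using \<rho>1 \<rho>0 by (intro disjI1 bexI[of _ \<rho>1]) auto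
  next
    case False
    then have G0: "G \<rho> \<le> 0" if "\<rho> \<in> rho_interval" "\<rho> \<ge> \<rho>0" for \<rho>
      using that by (meson linorder_not_le)
    have anti: "E y \<le> E x" if "x \<in> rho_interval" "y \<in> rho_interval" "\<rho>0 \<le> x" "x \<le> y" for x y
    proof -
      have "- E x \<le> - E y"
      proof (rule DERIV_nonneg_mono_rho[OF that(1,2,4), where h' = "\<lambda>x. - (2 * M / cos x * G x)"])
        fix z assume z: "z \<in> rho_interval"
        show "((\<lambda>x. - E x) has_real_derivative - (2 * M / cos z * G z)) (at z)"
          by (intro derivative_intros E' z)
        assume "x \<le> z"
        then have "2 * M / cos z * G z \<le> 0"
          using G0[OF z] that M cos_pos_rho[OF z] by (intro mult_nonneg_nonpos) auto
        then show "0 \<le> - (2 * M / cos z * G z)" by simp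
      qed
      then show ?thesis by simp
    qed
    have small: "\<exists>x\<in>rho_interval. x \<ge> \<rho>0 \<and> E x < e" if e: "e > 0" for e
    proof (rule ccontr)
      assume "\<not> ?thesis"
      then have Ee: "E x \<ge> e" if "x \<in> rho_interval" "x \<ge> \<rho>0" for x
        using that by (meson linorder_not_le)
      \<comment> \<open>\<open>E \<ge> e\<close> would force \<open>G\<close> to grow like \<open>- M e ln \<sigma>\<close>, although \<open>G \<le> 0\<close>\<close>
      have inc: "G \<rho>0 + M * e * ln (sigma \<rho>0) \<le> G \<rho> + M * e * ln (sigma \<rho>)"
        if "\<rho> \<in> rho_interval" "\<rho> \<ge> \<rho>0" for \<rho>
      proof (rule DERIV_nonneg_mono_rho[OF \<rho>0(1) that])
        fix x assume x: "x \<in> rho_interval"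
        show "((\<lambda>\<rho>. G \<rho> + M * e * ln (sigma \<rho>)) has_real_derivative
            2 * M / cos x * E x - 4 * \<omega> * (f x * g x) - M / cos x * e) (at x)"
          by (rule DERIV_cong, (rule derivative_intros G' ln_sigma_has_derivative x)+) simp
        assume a: "\<rho>0 \<le> x"
        have "M / cos x * e \<le> M / cos x * E x"
          using Ee[OF x a] cos_pos_rho[OF x] M by (intro mult_left_mono) auto
        moreover have "2 * \<bar>\<omega>\<bar> * E x \<le> M / cos x * E x"
          using sec[OF x a] E0 by (intro mult_right_mono) auto
        ultimately show "0 \<le> 2 * M / cos x * E x - 4 * \<omega> * (f x * g x) - M / cos x * e"
          using fg[of x] by simp
      qed
      have "\<forall>\<^sub>F \<rho> in at_left (pi / 2). ln (sigma \<rho>) < (G \<rho>0 + M * e * ln (sigma \<rho>0)) / (M * e)"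
        using ln_sigma_at_bot by (auto simp: filterlim_at_bot_dense)
      moreover have "\<forall>\<^sub>F \<rho> in at_left (pi / 2). \<rho> > \<rho>0"
        using \<rho>0 eventually_at_left_real[of \<rho>0 "pi / 2"]
        by (auto simp: rho_interval_def elim!: eventually_mono)
      ultimately have "\<forall>\<^sub>F \<rho> in at_left (pi / 2). False"
        using eventually_in_rho_left
      proof eventually_elim
        case (elim \<rho>)
        then have "ln (sigma \<rho>) * (M * e) < G \<rho>0 + M * e * ln (sigma \<rho>0)"
          using M e by (simp only: pos_less_divide_eq mult_pos_pos)
        also have "\<dots> \<le> G \<rho> + M * e * ln (sigma \<rho>)" using inc elim by auto
        also have "\<dots> \<le> M * e * ln (sigma \<rho>)" using G0 elim by auto
        finally show False by (simp add: mult.commute)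
      qed
      then show False by (simp add: trivial_limit_at_left_real)
    qed
    have "(E \<longlongrightarrow> 0) (at_left (pi / 2))"
    proof (rule order_tendstoI)
      show "\<forall>\<^sub>F x in at_left (pi / 2). a < E x" if "a < 0" for a
        using that E0 by (auto intro!: always_eventually intro: less_le_trans)
      fix e :: real assume "0 < e"
      then obtain x where x: "x \<in> rho_interval" "x \<ge> \<rho>0" "E x < e" using small by blast
      have "\<forall>\<^sub>F \<rho> in at_left (pi / 2). \<rho> > x"
        using x eventually_at_left_real[of x "pi / 2"]
        by (auto simp: rho_interval_def elim!: eventually_mono)
      then show "\<forall>\<^sub>F \<rho> in at_left (pi / 2). E \<rho> < e"
        using eventually_in_rho_left
        by eventually_elim (use anti[OF x(1) _ x(2)] x(3) in \<open>meson le_less_trans less_imp_le\<close>)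
    qed
    then show ?thesis by (simp add: vanish_at_def E_def)
  qed
qed

lemma vanish_atD:
  assumes "vanish_at F f g"
  shows "(f \<longlongrightarrow> 0) F" "(g \<longlongrightarrow> 0) F"
proof -
  have s: "((\<lambda>\<rho>. sqrt ((f \<rho>)\<^sup>2 + (g \<rho>)\<^sup>2)) \<longlongrightarrow> 0) F"
    using tendsto_real_sqrt[OF assms[unfolded vanish_at_def]] by simp
  show "(f \<longlongrightarrow> 0) F" "(g \<longlongrightarrow> 0) F"
    by (rule Lim_null_comparison[OF _ s], simp)+
qed

lemma vanish_atI: "(f \<longlongrightarrow> 0) F \<Longrightarrow> (g \<longlongrightarrow> 0) F \<Longrightarrow> vanish_at F f g"
  unfolding vanish_at_def by (auto intro!: tendsto_eq_intros)

lemma sigma_le_1: "\<rho> \<in> rho_interval \<Longrightarrow> \<rho> \<ge> 0 \<Longrightarrow> sigma \<rho> \<le> 1"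
proof -
  assume r: "\<rho> \<in> rho_interval" "\<rho> \<ge> 0"
  then have "sin \<rho> \<ge> 0" by (auto simp: rho_interval_def intro: sin_ge_zero)
  moreover from this have "cos \<rho> \<le> 1 + sin \<rho>" using cos_le_one[of \<rho>] by linarith
  ultimately show ?thesis using sigma_eq(2)[OF r(1)] by (simp add: divide_le_eq_1)
qed

text \<open>The growing alternative says exactly that
  \<open>(sigma \<rho> powr M * g \<rho>)\<^sup>2\<close> stays above a positive constant near the
  end, which the Dirichlet limit excludes. Conversely the weight itself tends to \<open>0\<close>,
  so a decaying \<open>g\<close> causes no difficulty.\<close>

lemma right_end_dirichlet:
  assumes sys: "radial_system M \<omega> f g" and M: "M > 0"
  shows "((\<lambda>\<rho>. sigma \<rho> powr M * g \<rho>) \<longlongrightarrow> 0) (at_left (pi / 2)) \<longleftrightarrow> vanish_at (at_left (pi / 2)) f g"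
proof
  assume "vanish_at (at_left (pi / 2)) f g"
  then have g: "(g \<longlongrightarrow> 0) (at_left (pi / 2))" by (rule vanish_atD)
  have "((\<lambda>\<rho>. sigma \<rho> powr M) \<longlongrightarrow> 0 powr M) (at_left (pi / 2))"
    using M eventually_in_rho_left
    by (intro tendsto_powr' sigma_tendsto_0 tendsto_const)
      (auto elim!: eventually_mono dest: sigma_pos)
  from tendsto_mult[OF this g] show "((\<lambda>\<rho>. sigma \<rho> powr M * g \<rho>) \<longlongrightarrow> 0) (at_left (pi / 2))" by simp
next
  assume l: "((\<lambda>\<rho>. sigma \<rho> powr M * g \<rho>) \<longlongrightarrow> 0) (at_left (pi / 2))"
  have "\<not> (\<exists>\<rho>1\<in>rho_interval. \<rho>1 \<ge> 0 \<and> (\<exists>c>0. \<forall>\<rho>\<in>rho_interval. \<rho> \<ge> \<rho>1 \<longrightarrow>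
            (g \<rho>)\<^sup>2 \<ge> c * sigma \<rho> powr (- 2 * M)))"
  proof
    assume "\<exists>\<rho>1\<in>rho_interval. \<rho>1 \<ge> 0 \<and> (\<exists>c>0. \<forall>\<rho>\<in>rho_interval. \<rho> \<ge> \<rho>1 \<longrightarrow>
            (g \<rho>)\<^sup>2 \<ge> c * sigma \<rho> powr (- 2 * M))"
    then obtain \<rho>1 c where \<rho>1: "\<rho>1 \<in> rho_interval" and c: "c > 0"
      and gc: "\<And>\<rho>. \<rho> \<in> rho_interval \<Longrightarrow> \<rho> \<ge> \<rho>1 \<Longrightarrow> (g \<rho>)\<^sup>2 \<ge> c * sigma \<rho> powr (- 2 * M)" by blast
    have "((\<lambda>\<rho>. (sigma \<rho> powr M * g \<rho>)\<^sup>2) \<longlongrightarrow> 0) (at_left (pi / 2))"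
      using tendsto_power[OF l, of 2] by simp
    then have "\<forall>\<^sub>F \<rho> in at_left (pi / 2). (sigma \<rho> powr M * g \<rho>)\<^sup>2 < c"
      using c order_tendstoD(2) by blast
    moreover have "\<forall>\<^sub>F \<rho> in at_left (pi / 2). \<rho> > \<rho>1"
      using \<rho>1 eventually_at_left_real[of \<rho>1 "pi / 2"]
      by (auto simp: rho_interval_def elim!: eventually_mono)
    ultimately have "\<forall>\<^sub>F \<rho> in at_left (pi / 2). False"
      using eventually_in_rho_left
    proof eventually_elim
      case (elim \<rho>)
      have sq: "(sigma \<rho> powr M)\<^sup>2 = sigma \<rho> powr (2 * M)"
        by (simp add: power2_eq_square flip: powr_add)
      have "c = sigma \<rho> powr (2 * M) * (c * sigma \<rho> powr (- 2 * M))"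
        using sigma_pos[OF elim(3)] by (simp add: powr_minus)
      also have "\<dots> \<le> sigma \<rho> powr (2 * M) * (g \<rho>)\<^sup>2"
        using gc[of \<rho>] elim by (intro mult_left_mono) auto
      also have "\<dots> < c" using elim(1) by (simp add: power_mult_distrib sq)
      finally show False by simp
    qed
    then show False by (simp add: trivial_limit_at_left_real)
  qed
  then show "vanish_at (at_left (pi / 2)) f g" using right_end_dichotomy[OF sys M] by blast
qed

text \<open>Here \<open>2 * M \<ge> 1\<close> enters: to the right of \<open>0\<close>,
  \<open>sigma \<le> 1\<close> gives
  \<open>sigma powr (- 2 * M) \<ge> inverse (sigma \<rho>)\<close>, and \<open>inverse (sigma
  \<rho>) = (1 + sin \<rho>) / cos \<rho> \<ge> 1 / cos \<rho>\<close>. In the growing alternative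
  the integral of \<open>E\<close> would therefore exceed every multiple of
  \<open>- ln (sigma \<rho>)\<close> up to a constant \<open>c\<close>, hence be infinite.\<close>

lemma right_end_integrable:
  assumes sys: "radial_system M \<omega> f g" and M: "M \<ge> 1 / 2"
    and int: "set_integrable lborel rho_interval (\<lambda>\<rho>. (f \<rho>)\<^sup>2 + (g \<rho>)\<^sup>2)"
  shows "vanish_at (at_left (pi / 2)) f g"
proof (rule ccontr)
  assume "\<not> ?thesis"
  then obtain \<rho>1 c where \<rho>1: "\<rho>1 \<in> rho_interval" "\<rho>1 \<ge> 0" and c: "c > 0"
    and gc: "\<And>\<rho>. \<rho> \<in> rho_interval \<Longrightarrow> \<rho> \<ge> \<rho>1 \<Longrightarrow> (g \<rho>)\<^sup>2 \<ge> c * sigma \<rho> powr (- 2 * M)"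
    using right_end_dichotomy[OF sys] M by force
  define E where "E = (\<lambda>\<rho>. (f \<rho>)\<^sup>2 + (g \<rho>)\<^sup>2)"
  have Eint: "E integrable_on rho_interval"
    using set_borel_integral_eq_integral(1)[OF int] by (simp add: E_def)
  have Ec: "E x \<ge> c / cos x" if x: "x \<in> rho_interval" "x \<ge> \<rho>1" for x
  proof -
    have s: "sigma x > 0" "sigma x \<le> 1" "cos x > 0" and sn: "sin x \<ge> 0"
      using sigma_pos sigma_le_1 x \<rho>1 cos_pos_rho sin_ge_zero[of x] by (auto simp: rho_interval_def)
    have "1 / cos x \<le> inverse (sigma x)"
      using s sn by (simp add: sigma_eq(2)[OF x(1)] divide_right_mono)
    also have "\<dots> = sigma x powr (- 1)" using s by (simp add: powr_minus)
    also have "\<dots> \<le> sigma x powr (- 2 * M)" using s M by (intro powr_mono') auto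
    finally have "c * (1 / cos x) \<le> c * sigma x powr (- 2 * M)" using c by (intro mult_left_mono) auto
    also have "\<dots> \<le> E x" using gc[OF x] unfolding E_def by (rule order_trans) simp
    finally show ?thesis by simp
  qed
  have bound: "c * (ln (sigma \<rho>1) - ln (sigma \<rho>)) \<le> integral rho_interval E"
    if r: "\<rho> \<in> rho_interval" "\<rho> > \<rho>1" for \<rho>
  proof -
    have sub: "{\<rho>1..\<rho>} \<subseteq> rho_interval" using r \<rho>1 by (auto simp: rho_interval_def)
    have "((\<lambda>x. c / cos x) has_integral (- c * ln (sigma \<rho>) - - c * ln (sigma \<rho>1))) {\<rho>1..\<rho>}"
    proof (rule fundamental_theorem_of_calculus)
      show "\<rho>1 \<le> \<rho>" using r by simp
      fix x assume "x \<in> {\<rho>1..\<rho>}"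
      then have x: "x \<in> rho_interval" using sub by blast
      have "((\<lambda>x. - c * ln (sigma x)) has_real_derivative c / cos x) (at x)"
        by (rule DERIV_cong, (rule derivative_intros ln_sigma_has_derivative x)+) simp
      then show "((\<lambda>x. - c * ln (sigma x)) has_vector_derivative c / cos x) (at x within {\<rho>1..\<rho>})"
        by (simp add: has_real_derivative_iff_has_vector_derivative has_vector_derivative_at_within)
    qed
    then have hi: "((\<lambda>x. c / cos x) has_integral c * (ln (sigma \<rho>1) - ln (sigma \<rho>))) {\<rho>1..\<rho>}"
      by (simp add: algebra_simps)
    have Ei: "E integrable_on {\<rho>1..\<rho>}"
      using set_borel_integral_eq_integral(1)[OF set_integrable_subset[OF int _ sub]]
      by (simp add: E_def)
    have "c * (ln (sigma \<rho>1) - ln (sigma \<rho>)) \<le> integral {\<rho>1..\<rho>} E"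
      by (rule has_integral_le[OF hi integrable_integral[OF Ei]]) (use Ec sub in auto)
    also have "\<dots> \<le> integral rho_interval E"
      by (rule integral_subset_le[OF sub Ei Eint]) (simp add: E_def)
    finally show ?thesis .
  qed
  have "\<forall>\<^sub>F \<rho> in at_left (pi / 2). ln (sigma \<rho>) < ln (sigma \<rho>1) - (integral rho_interval E + 1) / c"
    using ln_sigma_at_bot by (auto simp: filterlim_at_bot_dense)
  moreover have "\<forall>\<^sub>F \<rho> in at_left (pi / 2). \<rho> > \<rho>1"
    using \<rho>1 eventually_at_left_real[of \<rho>1 "pi / 2"]
    by (auto simp: rho_interval_def elim!: eventually_mono)
  ultimately have "\<forall>\<^sub>F \<rho> in at_left (pi / 2). False"
    using eventually_in_rho_left
  proof eventually_elim
    case (elim \<rho>)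
    then have "(integral rho_interval E + 1) / c < ln (sigma \<rho>1) - ln (sigma \<rho>)" by simp
    then have "integral rho_interval E + 1 < c * (ln (sigma \<rho>1) - ln (sigma \<rho>))"
      using c by (simp add: pos_divide_less_eq mult.commute)
    then show False using bound[of \<rho>] elim by simp
  qed
  then show False by (simp add: trivial_limit_at_left_real)
qed

section \<open>Decay at both ends, and integrals of decaying functions\<close>

definition vanishing :: "(real \<Rightarrow> real) \<Rightarrow> (real \<Rightarrow> real) \<Rightarrow> bool" where
  "vanishing f g \<longleftrightarrow> vanish_at (at_left (pi / 2)) f g \<and> vanish_at (at_right (- pi / 2)) f g"

lemma at_right_reflect: "(h \<longlongrightarrow> l) (at_right (- pi / 2)) \<longleftrightarrow> ((\<lambda>\<rho>. h (- \<rho>)) \<longlongrightarrow> l) (at_left (pi / 2))"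
  unfolding at_right_minus[of "- pi / 2"] by (simp add: filterlim_filtermap)

lemma vanish_at_reflect:
  "vanish_at (at_right (- pi / 2)) f g \<longleftrightarrow> vanish_at (at_left (pi / 2)) (\<lambda>\<rho>. g (- \<rho>)) (\<lambda>\<rho>. f (- \<rho>))"
  unfolding vanish_at_def at_right_reflect by (simp add: add.commute)

text \<open>As \<open>sigma (- \<rho>)\<close> is the inverse of \<open>sigma \<rho>\<close>, the
  condition on \<open>f\<close> at the left end becomes, after reflection, the right-end condition
  on the second component of the reflected solution.\<close>

lemma radial_dirichlet_iff_vanishing:
  assumes sys: "radial_system M \<omega> f g" and M: "M > 0"
  shows "((\<lambda>\<rho>. sigma \<rho> powr M * g \<rho>) \<longlongrightarrow> 0) (at_left (pi / 2)) \<and>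
      ((\<lambda>\<rho>. sigma \<rho> powr (- M) * f \<rho>) \<longlongrightarrow> 0) (at_right (- pi / 2)) \<longleftrightarrow> vanishing f g"
proof -
  have "((\<lambda>\<rho>. sigma \<rho> powr (- M) * f \<rho>) \<longlongrightarrow> 0) (at_right (- pi / 2)) \<longleftrightarrow>
      ((\<lambda>\<rho>. sigma \<rho> powr M * f (- \<rho>)) \<longlongrightarrow> 0) (at_left (pi / 2))"
    unfolding at_right_reflect
    by (rule tendsto_cong, use eventually_in_rho_left in eventually_elim)
      (auto simp: sigma_minus powr_minus inverse_powr dest: sigma_pos)
  then show ?thesis
    using right_end_dirichlet[OF sys M] right_end_dirichlet[OF radial_system_reflect[OF sys] M]
    by (simp add: vanishing_def vanish_at_reflect[simplified])
qed

text \<open>Brings decaying functions to the compact interval, where continuity gives integrability,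
  the fundamental theorem has no boundary terms, and a vanishing integral of a non-negative function
  forces the function to vanish.\<close>

lemma continuous_on_rho_extend:
  fixes F :: "real \<Rightarrow> 'a::real_normed_vector"
  assumes "continuous_on rho_interval F"
    and "(F \<longlongrightarrow> 0) (at_left (pi / 2))" "(F \<longlongrightarrow> 0) (at_right (- pi / 2))"
  shows "continuous_on {- pi / 2..pi / 2} (\<lambda>\<rho>. if \<rho> \<in> rho_interval then F \<rho> else 0)"
proof -
  let ?F = "\<lambda>\<rho>. if \<rho> \<in> rho_interval then F \<rho> else 0"
  have "(?F \<longlongrightarrow> 0) (at_left (pi / 2))"
    by (rule Lim_transform_eventually[OF assms(2)], use eventually_in_rho_left in eventually_elim) simp
  moreover have "(?F \<longlongrightarrow> 0) (at_right (- pi / 2))"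
    by (rule Lim_transform_eventually[OF assms(3)], use eventually_in_rho_right in eventually_elim) simp
  moreover have "continuous_on rho_interval ?F"
    using assms(1) by (simp cong: continuous_on_cong)
  then have "isCont ?F x" if "x \<in> rho_interval" for x
    using that continuous_on_eq_continuous_at[OF rho_interval_open, of ?F] by blast
  ultimately show ?thesis
    using pi_gt_zero
    by (intro continuous_on_IccI) (auto simp: rho_interval_def isCont_def)
qed

lemma set_integrable_rho:
  fixes F :: "real \<Rightarrow> 'a::euclidean_space"
  assumes "continuous_on rho_interval F"
    and "(F \<longlongrightarrow> 0) (at_left (pi / 2))" "(F \<longlongrightarrow> 0) (at_right (- pi / 2))"
  shows "set_integrable lborel rho_interval F"
proof -
  have "set_integrable lborel {- pi / 2..pi / 2} (\<lambda>\<rho>. if \<rho> \<in> rho_interval then F \<rho> else 0)"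
    by (rule borel_integrable_atLeastAtMost') (rule continuous_on_rho_extend[OF assms])
  then have "set_integrable lborel rho_interval (\<lambda>\<rho>. if \<rho> \<in> rho_interval then F \<rho> else 0)"
    by (rule set_integrable_subset) (auto simp: rho_interval_def)
  then show ?thesis 
    by (rule set_integrable_cong[THEN iffD1, rotated -1]) auto
qed

text \<open>Integration by parts with the boundary terms already removed by decay. The derivative
  may be wild at the ends, so its integrability is assumed in order to pass from the gauge integral
  to the Lebesgue integral.\<close>

lemma integral_derivative_rho:
  fixes F :: "real \<Rightarrow> real"
  assumes F: "\<And>x. x \<in> rho_interval \<Longrightarrow> (F has_real_derivative F' x) (at x)"
    and lim: "(F \<longlongrightarrow> 0) (at_left (pi / 2))" "(F \<longlongrightarrow> 0) (at_right (- pi / 2))"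
    and int: "set_integrable lborel rho_interval F'"
  shows "(LINT \<rho>:rho_interval|lborel. F' \<rho>) = 0"
proof -
  let ?F = "\<lambda>\<rho>. if \<rho> \<in> rho_interval then F \<rho> else 0"
  have cont: "continuous_on rho_interval F"
    using F by (auto intro!: continuous_at_imp_continuous_on DERIV_isCont)
  have "(F' has_integral (?F (pi / 2) - ?F (- pi / 2))) {- pi / 2..pi / 2}"
  proof (rule fundamental_theorem_of_calculus_interior)
    show "- pi / 2 \<le> pi / 2" using pi_gt_zero by simp
    show "continuous_on {- pi / 2..pi / 2} ?F" by (rule continuous_on_rho_extend[OF cont lim])
    fix x assume "x \<in> {- pi / 2<..<pi / 2}"
    then have x: "x \<in> rho_interval" by (simp add: rho_interval_def)
    have "(?F has_real_derivative F' x) (at x)"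
      by (rule has_field_derivative_transform_within_open[OF F[OF x] rho_interval_open x]) simp
    then show "(?F has_vector_derivative F' x) (at x)"
      by (simp add: has_real_derivative_iff_has_vector_derivative)
  qed
  then have "(F' has_integral 0) {- pi / 2..pi / 2}" by (simp add: rho_interval_def)
  then have "(F' has_integral 0) rho_interval"
    unfolding rho_interval_def using has_integral_Icc_iff_Ioo by blast
  then show ?thesis using set_borel_integral_eq_integral(2)[OF int] by (simp add: integral_unique)
qed

lemma radial_integrable_iff_vanishing:
  assumes sys: "radial_system M \<omega> f g" and M: "M \<ge> 1 / 2"
  shows "set_integrable lborel rho_interval (\<lambda>\<rho>. (f \<rho>)\<^sup>2 + (g \<rho>)\<^sup>2) \<longleftrightarrow> vanishing f g"
proof
  assume int: "set_integrable lborel rho_interval (\<lambda>\<rho>. (f \<rho>)\<^sup>2 + (g \<rho>)\<^sup>2)"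
  \<comment> \<open>The substitution \<open>\<rho> \<mapsto> -\<rho>\<close> transfers integrability
    to the reflected solution, so the right-end criterion also covers the left end.\<close>
  have "integrable lborel (\<lambda>x. indicator rho_interval (- x) *\<^sub>R ((f (- x))\<^sup>2 + (g (- x))\<^sup>2))"
    using lborel_integrable_real_affine[OF int[unfolded set_integrable_def], of "-1" 0] by simp
  then have "set_integrable lborel rho_interval (\<lambda>\<rho>. (g (- \<rho>))\<^sup>2 + (f (- \<rho>))\<^sup>2)"
    by (simp add: set_integrable_def indicator_def add.commute)
  then show "vanishing f g"
    using right_end_integrable[OF sys M int] right_end_integrable[OF radial_system_reflect[OF sys] M]
    by (simp add: vanishing_def vanish_at_reflect[simplified])
next
  assume "vanishing f g"
  then show "set_integrable lborel rho_interval (\<lambda>\<rho>. (f \<rho>)\<^sup>2 + (g \<rho>)\<^sup>2)"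
    unfolding vanishing_def vanish_at_def
    by (intro set_integrable_rho continuous_intros radial_system_continuous[OF sys]) auto
qed


section \<open>Lowering and the quantisation of the frequency\<close>

text \<open>
  The spatial part of \<open>\<i> L\<^sub>-\<close> on a solution of frequency \<open>\<omega>\<close>, with the derivatives eliminated by
  the Dirac equation.
\<close>

definition lower1 :: "real \<Rightarrow> real \<Rightarrow> (real \<Rightarrow> real) \<Rightarrow> (real \<Rightarrow> real) \<Rightarrow> real \<Rightarrow> real" where
  "lower1 M \<omega> f g \<rho> = ((\<omega> - 1 / 2) * sin \<rho> - M) * f \<rho> + (\<omega> - 1 / 2) * cos \<rho> * g \<rho>"

definition lower2 :: "real \<Rightarrow> real \<Rightarrow> (real \<Rightarrow> real) \<Rightarrow> (real \<Rightarrow> real) \<Rightarrow> real \<Rightarrow> real" where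
  "lower2 M \<omega> f g \<rho> = ((\<omega> - 1 / 2) * sin \<rho> + M) * g \<rho> - (\<omega> - 1 / 2) * cos \<rho> * f \<rho>"

text \<open>The group acts by symmetries of the Dirac equation, and
  \<open>[L\<^sub>0, L\<^sub>-] = - L\<^sub>-\<close> predicts a drop of the frequency by one. In
  the direct check the shift \<open>k = \<omega> - 1 / 2\<close> is what makes the leftover multiple
  of \<open>M\<close> cancel, by \<open>2 * k = 2 * \<omega> - 1\<close>.\<close>

lemma radial_system_lower:
  assumes sys: "radial_system M \<omega> f g"
  shows "radial_system M (\<omega> - 1) (lower1 M \<omega> f g) (lower2 M \<omega> f g)"
  unfolding radial_system_def
proof (intro ballI conjI)
  fix \<rho> assume r: "\<rho> \<in> rho_interval"
  \<comment> \<open>Replacing \<open>M\<close> by \<open>d * cos \<rho>\<close> throughout removes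
    all divisions and leaves a polynomial identity.\<close>
  define d where "d = M / cos \<rho>"
  have dc: "d * cos \<rho> = M" using cos_pos_rho[OF r] by (simp add: d_def)
  have d: "(f has_real_derivative (\<omega> * g \<rho> - d * f \<rho>)) (at \<rho>)"
     "(g has_real_derivative (d * g \<rho> - \<omega> * f \<rho>)) (at \<rho>)"
    using sys r unfolding radial_system_def d_def by blast+
  define k where "k = \<omega> - 1 / 2"
  have k: "\<omega> = k + 1 / 2" by (simp add: k_def)
  show "(lower1 M \<omega> f g has_real_derivative
      (\<omega> - 1) * lower2 M \<omega> f g \<rho> - M / cos \<rho> * lower1 M \<omega> f g \<rho>) (at \<rho>)"
    unfolding lower1_def[abs_def] lower2_def[abs_def] d_def[symmetric] k_def[symmetric]
    by (rule DERIV_cong, (rule derivative_intros d DERIV_sin DERIV_cos)+) (simp add: k algebra_simps flip: dc)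
  show "(lower2 M \<omega> f g has_real_derivative
      M / cos \<rho> * lower2 M \<omega> f g \<rho> - (\<omega> - 1) * lower1 M \<omega> f g \<rho>) (at \<rho>)"
    unfolding lower1_def[abs_def] lower2_def[abs_def] d_def[symmetric] k_def[symmetric]
    by (rule DERIV_cong, (rule derivative_intros d DERIV_sin DERIV_cos)+) (simp add: k algebra_simps flip: dc)
qed

lemma vanishingD:
  assumes "vanishing f g"
  shows "(f \<longlongrightarrow> 0) (at_left (pi / 2))" "(g \<longlongrightarrow> 0) (at_left (pi / 2))"
    "(f \<longlongrightarrow> 0) (at_right (- pi / 2))" "(g \<longlongrightarrow> 0) (at_right (- pi / 2))"
  using assms unfolding vanishing_def by (auto dest: vanish_atD)

lemma vanishingI:
  assumes "(f \<longlongrightarrow> 0) (at_left (pi / 2))" "(g \<longlongrightarrow> 0) (at_left (pi / 2))"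
    "(f \<longlongrightarrow> 0) (at_right (- pi / 2))" "(g \<longlongrightarrow> 0) (at_right (- pi / 2))"
  shows "vanishing f g"
  using assms unfolding vanishing_def by (auto intro: vanish_atI)

lemma vanishing_uminus: "vanishing f g \<Longrightarrow> vanishing f (\<lambda>\<rho>. - g \<rho>)"
  by (simp add: vanishing_def vanish_at_def)

lemma vanishing_lincomb:
  assumes "vanishing f g" "vanishing u v"
  shows "vanishing (\<lambda>\<rho>. a * f \<rho> + b * u \<rho>) (\<lambda>\<rho>. a * g \<rho> + b * v \<rho>)"
  by (rule vanishingI) (rule tendsto_eq_intros vanishingD[OF assms(1)] vanishingD[OF assms(2)] refl | simp)+

lemma vanishing_lower:
  assumes "vanishing f g"
  shows "vanishing (lower1 M \<omega> f g) (lower2 M \<omega> f g)"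
  unfolding lower1_def[abs_def] lower2_def[abs_def]
  by (rule vanishingI) (rule tendsto_eq_intros vanishingD[OF assms] refl | simp)+

lemma set_integrable_sum_squares:
  assumes "continuous_on rho_interval f" "continuous_on rho_interval g" "vanishing f g"
  shows "set_integrable lborel rho_interval (\<lambda>\<rho>. (f \<rho>)\<^sup>2 + (g \<rho>)\<^sup>2)"
  using assms(3) unfolding vanishing_def vanish_at_def
  by (intro set_integrable_rho continuous_intros assms) auto

text \<open>The hypothesis on the integral is an inequality because that is what a product with a
  negative factor delivers below the spectrum.\<close>

lemma sum_squares_integral_zero:
  assumes c: "continuous_on rho_interval f" "continuous_on rho_interval g" and v: "vanishing f g"
    and z: "(LINT \<rho>:rho_interval|lborel. (f \<rho>)\<^sup>2 + (g \<rho>)\<^sup>2) \<le> 0" and r: "\<rho> \<in> rho_interval"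
  shows "f \<rho> = 0" "g \<rho> = 0"
proof -
  define E where "E = (\<lambda>\<rho>. if \<rho> \<in> rho_interval then (f \<rho>)\<^sup>2 + (g \<rho>)\<^sup>2 else 0)"
  have int: "set_integrable lborel rho_interval (\<lambda>\<rho>. (f \<rho>)\<^sup>2 + (g \<rho>)\<^sup>2)"
    by (rule set_integrable_sum_squares[OF c v])
  have cont: "continuous_on {- pi / 2..pi / 2} E"
    unfolding E_def using v unfolding vanishing_def vanish_at_def
    by (intro continuous_on_rho_extend continuous_intros c) auto
  have hi: "((\<lambda>\<rho>. (f \<rho>)\<^sup>2 + (g \<rho>)\<^sup>2) has_integral
      (LINT \<rho>:rho_interval|lborel. (f \<rho>)\<^sup>2 + (g \<rho>)\<^sup>2)) rho_interval"
    using set_borel_integral_eq_integral[OF int] by (simp add: has_integral_integral)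
  have "(LINT \<rho>:rho_interval|lborel. (f \<rho>)\<^sup>2 + (g \<rho>)\<^sup>2) \<ge> 0"
    by (rule has_integral_nonneg[OF hi]) simp
  with z have "(LINT \<rho>:rho_interval|lborel. (f \<rho>)\<^sup>2 + (g \<rho>)\<^sup>2) = 0" by linarith
  with hi have "((\<lambda>\<rho>. (f \<rho>)\<^sup>2 + (g \<rho>)\<^sup>2) has_integral 0) rho_interval" by (simp only:)
  then have "(E has_integral 0) rho_interval"
    by (rule has_integral_eq[rotated]) (simp add: E_def)
  then have "(E has_integral 0) {- pi / 2..pi / 2}"
    unfolding rho_interval_def using has_integral_Icc_iff_Ioo by blast
  then have "E \<rho> = 0"
    using has_integral_0_cbox_imp_0[of "- pi / 2" "pi / 2" E \<rho>] cont r pi_gt_zero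
    by (auto simp: E_def rho_interval_def)
  then show "f \<rho> = 0" "g \<rho> = 0" using r by (auto simp: E_def sum_power2_eq_zero_iff)
qed

text \<open>Expanding the squares, the integrands differ by \<open>2 * M\<^sup>2 * E + 2 * k * M *
  sin \<rho> * G - 4 * k * M * cos \<rho> * (f \<rho> * g \<rho>)\<close> with \<open>E\<close>,
  \<open>G\<close> the sum and difference of squares. The system makes this an exact derivative of a
  function that decays at both ends.\<close>

lemma lower_norm:
  assumes sys: "radial_system M \<omega> f g" and v: "vanishing f g"
  shows "(LINT \<rho>:rho_interval|lborel. (lower1 M \<omega> f g \<rho>)\<^sup>2 + (lower2 M \<omega> f g \<rho>)\<^sup>2)
       = ((\<omega> - 1 / 2)\<^sup>2 - M\<^sup>2) * (LINT \<rho>:rho_interval|lborel. (f \<rho>)\<^sup>2 + (g \<rho>)\<^sup>2)"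
proof -
  let ?u = "lower1 M \<omega> f g" and ?v = "lower2 M \<omega> f g"
  \<comment> \<open>\<open>B\<close> is a primitive of the difference of the two integrands\<close>
  define B where "B = (\<lambda>\<rho>. M * cos \<rho> * ((g \<rho>)\<^sup>2 - (f \<rho>)\<^sup>2) + 2 * M * sin \<rho> * (f \<rho> * g \<rho>))"
  have i1: "set_integrable lborel rho_interval (\<lambda>\<rho>. (?u \<rho>)\<^sup>2 + (?v \<rho>)\<^sup>2)"
    by (rule set_integrable_sum_squares[OF radial_system_continuous[OF radial_system_lower[OF sys]]
        vanishing_lower[OF v]])
  have i2: "set_integrable lborel rho_interval (\<lambda>\<rho>. ((\<omega> - 1 / 2)\<^sup>2 - M\<^sup>2) * ((f \<rho>)\<^sup>2 + (g \<rho>)\<^sup>2))"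
    using set_integrable_sum_squares[OF radial_system_continuous[OF sys] v] by simp
  have "(LINT \<rho>:rho_interval|lborel.
      ((?u \<rho>)\<^sup>2 + (?v \<rho>)\<^sup>2) - ((\<omega> - 1 / 2)\<^sup>2 - M\<^sup>2) * ((f \<rho>)\<^sup>2 + (g \<rho>)\<^sup>2)) = 0"
  proof (rule integral_derivative_rho[where F = B])
    show "(B \<longlongrightarrow> 0) (at_left (pi / 2))" "(B \<longlongrightarrow> 0) (at_right (- pi / 2))"
      unfolding B_def by (rule tendsto_eq_intros vanishingD[OF v] refl | simp)+
    show "set_integrable lborel rho_interval (\<lambda>\<rho>.
      ((?u \<rho>)\<^sup>2 + (?v \<rho>)\<^sup>2) - ((\<omega> - 1 / 2)\<^sup>2 - M\<^sup>2) * ((f \<rho>)\<^sup>2 + (g \<rho>)\<^sup>2))"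
      by (rule set_integral_diff(1)[OF i1 i2])
    fix \<rho> assume r: "\<rho> \<in> rho_interval"
    define d where "d = M / cos \<rho>"
    have dc: "d * cos \<rho> = M" using cos_pos_rho[OF r] by (simp add: d_def)
    have d: "(f has_real_derivative (\<omega> * g \<rho> - d * f \<rho>)) (at \<rho>)"
       "(g has_real_derivative (d * g \<rho> - \<omega> * f \<rho>)) (at \<rho>)"
      using sys r unfolding radial_system_def d_def by blast+
    define k where "k = \<omega> - 1 / 2"
    have k: "\<omega> = k + 1 / 2" by (simp add: k_def)
    \<comment> \<open>The identity \<open>(sin \<rho>)\<^sup>2 + (cos \<rho>)\<^sup>2 = 1\<close>,
      multiplied by \<open>k * k\<close> and written in the nested monomials that normalisation
      produces, so that linear arithmetic can use it.\<close>
    have sc: "k * (k * x) = k * (k * (cos \<rho> * (cos \<rho> * x))) + k * (k * (sin \<rho> * (sin \<rho> * x)))" for x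
    proof -
      have "x = ((cos \<rho>)\<^sup>2 + (sin \<rho>)\<^sup>2) * x" by simp
      also have "\<dots> = cos \<rho> * (cos \<rho> * x) + sin \<rho> * (sin \<rho> * x)"
        by (simp only: power2_eq_square distrib_right mult.assoc)
      finally show ?thesis by (metis distrib_left)
    qed
    show "(B has_real_derivative
        ((?u \<rho>)\<^sup>2 + (?v \<rho>)\<^sup>2) - ((\<omega> - 1 / 2)\<^sup>2 - M\<^sup>2) * ((f \<rho>)\<^sup>2 + (g \<rho>)\<^sup>2)) (at \<rho>)"
      unfolding B_def lower1_def lower2_def k_def[symmetric] power2_eq_square
      by (rule DERIV_cong, (rule derivative_intros d DERIV_sin DERIV_cos)+) (simp add: k algebra_simps flip: dc, use sc[of "f \<rho> * f \<rho>"] sc[of "g \<rho> * g \<rho>"] in linarith)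
  qed
  then show ?thesis using set_integral_diff(2)[OF i1 i2] by simp
qed

text \<open>In this range \<open>\<bar>\<omega> - 1 / 2\<bar> < M\<close>, so the norm identity
  equates a non-negative number with a negative multiple of the norm. The exception is
  \<open>\<omega> = 0\<close> with \<open>M = 1 / 2\<close>, where the factor is
  \<open>0\<close>.\<close>

lemma vanishing_below_spectrum:
  assumes sys: "radial_system M \<omega> f g" and v: "vanishing f g" and M: "M \<ge> 1 / 2"
    and w: "0 \<le> \<omega>" "\<omega> < M + 1 / 2" and r: "\<rho> \<in> rho_interval"
  shows "f \<rho> = 0 \<and> g \<rho> = 0"
proof (cases "\<omega> = 0 \<and> M = 1 / 2")
  case True
  \<comment> \<open>With factor \<open>0\<close> the norm identity still says that the lowered
    solution vanishes. Frequency \<open>0\<close> is its own negative, so this applies to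
    \<open>(f, g)\<close> and to \<open>(f, - g)\<close>; the two resulting linear equations at the
    point \<open>0\<close> force \<open>f 0 = g 0 = 0\<close>.\<close>
  have low: "lower1 M 0 f h 0 = 0" if h: "radial_system M 0 f h" "vanishing f h" for h
  proof (rule sum_squares_integral_zero(1)[where f = "lower1 M 0 f h" and g = "lower2 M 0 f h"])
    show "continuous_on rho_interval (lower1 M 0 f h)" "continuous_on rho_interval (lower2 M 0 f h)"
      by (rule radial_system_continuous[OF radial_system_lower[OF h(1)]])+
    show "vanishing (lower1 M 0 f h) (lower2 M 0 f h)" by (rule vanishing_lower[OF h(2)])
    have M2: "M = 1 / 2" using True by simp
    have "(0 - 1 / 2)\<^sup>2 - M\<^sup>2 = 0" unfolding M2 by simp
    then show "(LINT \<rho>:rho_interval|lborel. (lower1 M 0 f h \<rho>)\<^sup>2 + (lower2 M 0 f h \<rho>)\<^sup>2) \<le> 0"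
      unfolding lower_norm[OF h] by simp
  qed simp
  have "lower1 M 0 f g 0 = 0" using low sys v True by blast
  moreover have "lower1 M 0 f (\<lambda>\<rho>. - g \<rho>) 0 = 0"
  proof (rule low[OF _ vanishing_uminus[OF v]])
    show "radial_system M 0 f (\<lambda>\<rho>. - g \<rho>)" using radial_system_uminus[OF sys] conjunct1[OF True] by simp
  qed
  ultimately have "f 0 = 0" "g 0 = 0" using True by (auto simp: lower1_def)
  then show ?thesis using radial_system_zero[OF sys _ _ _ r] M by simp
next
  case False
  have "(\<omega> - 1 / 2)\<^sup>2 < M\<^sup>2"
    using False w M by (intro power2_strict_mono) auto
  moreover have "0 \<le> (LINT \<rho>:rho_interval|lborel. (lower1 M \<omega> f g \<rho>)\<^sup>2 + (lower2 M \<omega> f g \<rho>)\<^sup>2)"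
    unfolding set_lebesgue_integral_def by (intro Bochner_Integration.integral_nonneg) simp
  ultimately have "(LINT \<rho>:rho_interval|lborel. (f \<rho>)\<^sup>2 + (g \<rho>)\<^sup>2) \<le> 0"
    unfolding lower_norm[OF sys v] by (auto simp: zero_le_mult_iff)
  then show ?thesis
    using sum_squares_integral_zero[OF radial_system_continuous[OF sys] v _ r] by blast
qed

text \<open>Induction on the number of unit steps down to the strip below \<open>M + 1 / 2\<close>.
  As \<open>M \<ge> 1 / 2\<close>, a frequency above the strip exceeds \<open>1\<close>, so lowering
  keeps it non-negative, and being off the spectrum is preserved as well.\<close>

lemma vanishing_off_spectrum_nonneg:
  assumes "radial_system M \<omega> f g" and "vanishing f g" and M: "M \<ge> 1 / 2"
    and "0 \<le> \<omega>" "\<And>n. \<omega> \<noteq> omega M n" and r: "\<rho> \<in> rho_interval"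
  shows "f \<rho> = 0 \<and> g \<rho> = 0"
proof -
  obtain N :: nat where "\<omega> < M + 1 / 2 + real N"
    using reals_Archimedean2[of "\<omega> - M - 1 / 2"] by (auto simp: algebra_simps)
  then show ?thesis using assms(1,2,4,5)
  proof (induction N arbitrary: \<omega> f g)
    case 0
    then show ?case using vanishing_below_spectrum[OF 0(2,3) M _ _ r] by simp
  next
    case (Suc N)
    show ?case
    proof (cases "\<omega> < M + 1 / 2")
      case True
      then show ?thesis using vanishing_below_spectrum[OF Suc(3,4) M _ _ r] Suc by simp
    next
      case False
      have "\<omega> \<noteq> omega M 0" by (rule Suc)
      then have w: "\<omega> > M + 1 / 2" using False by (simp add: omega_def)
      have "\<omega> - 1 \<noteq> omega M n" for n using Suc.prems(5)[of "Suc n"] by (simp add: omega_def)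
      then have z: "lower1 M \<omega> f g \<rho> = 0 \<and> lower2 M \<omega> f g \<rho> = 0"
        using Suc.prems(1) w M
        by (intro Suc.IH[OF _ radial_system_lower[OF Suc(3)] vanishing_lower[OF Suc(4)]]) auto
      define k where "k = \<omega> - 1 / 2"
      have sc: "(sin \<rho>)\<^sup>2 + (cos \<rho>)\<^sup>2 = 1" by simp
      \<comment> \<open>The lowering matrix is inverted by its adjugate: a vanishing image forces a
        vanishing solution wherever the determinant is non-zero.\<close>
      have "(k\<^sup>2 - M\<^sup>2) * f \<rho> = 0" "(k\<^sup>2 - M\<^sup>2) * g \<rho> = 0"
        using z sc unfolding lower1_def lower2_def k_def[symmetric] by algebra+
      moreover have "M\<^sup>2 < k\<^sup>2" using w M by (intro power_strict_mono) (auto simp: k_def)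
      ultimately show ?thesis by auto
    qed
  qed
qed

lemma vanishing_off_spectrum:
  assumes sys: "radial_system M \<omega> f g" and v: "vanishing f g" and M: "M \<ge> 1 / 2"
    and w: "\<And>n. \<omega> \<noteq> omega M n" "\<And>n. \<omega> \<noteq> - omega M n" and r: "\<rho> \<in> rho_interval"
  shows "f \<rho> = 0 \<and> g \<rho> = 0"
proof (cases "\<omega> \<ge> 0")
  case True
  then show ?thesis using vanishing_off_spectrum_nonneg[OF sys v M _ w(1) r] by simp
next
  case False
  have "- \<omega> \<noteq> omega M n" for n using w(2)[of n] by auto
  then show ?thesis
    using vanishing_off_spectrum_nonneg[OF radial_system_uminus[OF sys] vanishing_uminus[OF v] M _ _ r] False
    by simp
qed

lemma vanishing_unique:
  assumes sys: "radial_system M \<omega> f g" "radial_system M \<omega> u v"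
    and van: "vanishing f g" "vanishing u v" and M: "M \<ge> 0" and nz: "u 0 \<noteq> 0 \<or> v 0 \<noteq> 0"
  obtains c where "\<And>\<rho>. \<rho> \<in> rho_interval \<Longrightarrow> f \<rho> = c * u \<rho>" "\<And>\<rho>. \<rho> \<in> rho_interval \<Longrightarrow> g \<rho> = c * v \<rho>"
proof -
  \<comment> \<open>the Wronskian is constant because the coefficient matrix of the system has trace \<open>0\<close>\<close>
  define W where "W = (\<lambda>\<rho>. f \<rho> * v \<rho> - g \<rho> * u \<rho>)"
  have W': "(W has_real_derivative 0) (at \<rho>)" if r: "\<rho> \<in> rho_interval" for \<rho>
  proof -
    have d: "(f has_real_derivative (\<omega> * g \<rho> - M / cos \<rho> * f \<rho>)) (at \<rho>)"
       "(g has_real_derivative (M / cos \<rho> * g \<rho> - \<omega> * f \<rho>)) (at \<rho>)"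
       "(u has_real_derivative (\<omega> * v \<rho> - M / cos \<rho> * u \<rho>)) (at \<rho>)"
       "(v has_real_derivative (M / cos \<rho> * v \<rho> - \<omega> * u \<rho>)) (at \<rho>)"
      using sys r unfolding radial_system_def by blast+
    show ?thesis unfolding W_def
      by (rule DERIV_cong, (rule derivative_intros d)+) (simp add: algebra_simps)
  qed
  have "W constant_on rho_interval"
    by (rule has_field_derivative_0_imp_constant_on) (use W' in \<open>auto simp: rho_interval_def\<close>)
  then have W0: "W \<rho> = W 0" if "\<rho> \<in> rho_interval" for \<rho> using that by (metis constant_on_def zero_in_rho)
  have "(W \<longlongrightarrow> 0) (at_left (pi / 2))"
    using tendsto_diff[OF tendsto_mult[OF vanishingD(1)[OF van(1)] vanishingD(2)[OF van(2)]]
        tendsto_mult[OF vanishingD(2)[OF van(1)] vanishingD(1)[OF van(2)]]] by (simp add: W_def)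
  moreover have "(W \<longlongrightarrow> W 0) (at_left (pi / 2))"
    by (rule Lim_transform_eventually[OF tendsto_const], use eventually_in_rho_left in eventually_elim)
      (rule W0[symmetric])
  ultimately have "W 0 = 0" using tendsto_unique trivial_limit_at_left_real by blast
  then have fv: "f 0 * v 0 = g 0 * u 0" by (simp add: W_def)
  define n where "n = (u 0)\<^sup>2 + (v 0)\<^sup>2"
  \<comment> \<open>The projection coefficient of \<open>(f 0, g 0)\<close> on
    \<open>(u 0, v 0)\<close>; it covers both possibilities for the non-zero component. Subtracting
    \<open>c\<close> times the second solution leaves one with initial value
    \<open>0\<close>.\<close>
  define c where "c = (f 0 * u 0 + g 0 * v 0) / n"
  have n: "n \<noteq> 0" using nz by (simp add: n_def sum_power2_eq_zero_iff)
  have "n * f 0 = (f 0 * u 0 + g 0 * v 0) * u 0" "n * g 0 = (f 0 * u 0 + g 0 * v 0) * v 0"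
    using fv unfolding n_def by algebra+
  then have c: "f 0 = c * u 0" "g 0 = c * v 0" using n by (simp_all add: c_def field_simps)
  have s: "radial_system M \<omega> (\<lambda>\<rho>. 1 * f \<rho> + (- c) * u \<rho>) (\<lambda>\<rho>. 1 * g \<rho> + (- c) * v \<rho>)"
    by (rule radial_system_lincomb[OF sys])
  show ?thesis
    by (rule that[of c]; use radial_system_zero[OF s M] c in force)
qed


section \<open>Jacobi polynomials and the modes\<close>

lemma gbinomial_Suc_mult: "real (Suc k) * (a gchoose Suc k) = (a - real k) * (a gchoose k)"
  using gbinomial_mult_1[of a k] by (simp add: algebra_simps)

text \<open>Comparison of coefficients at \<open>(x - 1) ^ (n - j) * (x + 1) ^ j\<close> in the
  relation below; the term with \<open>j - 1\<close> comes from differentiating the power of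
  \<open>x - 1\<close> one index lower. It rests on absorption and Pascal's rule for the upper
  arguments \<open>X = n + \<beta>\<close> and \<open>X - 1\<close>.\<close>

lemma jacobi_poly_coeff_relation:
  fixes \<beta> :: real
  assumes "j \<le> n"
  shows "(real j + \<beta>) * (((real n + (\<beta> - 1)) gchoose j) * ((real n + \<beta>) gchoose (n - j))) +
      (if j = 0 then 0 else ((real n + (\<beta> - 1)) gchoose (j - 1)) *
        ((real n + \<beta>) gchoose (n - (j - 1))) * real (n - (j - 1)))
    = (real n + \<beta>) * (((real n + \<beta>) gchoose j) * ((real n + (\<beta> - 1)) gchoose (n - j)))"
proof -
  define X where "X = real n + \<beta>"
  have X1: "real n + (\<beta> - 1) = X - 1" by (simp add: X_def)
  have Xm: "X - real (n - j) = real j + \<beta>" using assms by (simp add: X_def of_nat_diff)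
  have r: "X * ((X - 1) gchoose (n - j)) = (real j + \<beta>) * (X gchoose (n - j))"
    using gbinomial_absorb_comp[of X "n - j"] unfolding Xm by simp
  show ?thesis
  proof (cases j)
    case 0
    then show ?thesis using r unfolding X1 X_def[symmetric] by simp
  next
    case (Suc i)
    have nd: "n - i = Suc (n - j)" using assms Suc by simp
    have u: "(X gchoose (n - i)) * real (n - i) = (real j + \<beta>) * (X gchoose (n - j))"
      using gbinomial_Suc_mult[of "n - j" X] unfolding Xm nd by (simp add: mult.commute)
    have p: "X gchoose j = ((X - 1) gchoose i) + ((X - 1) gchoose j)"
      using gbinomial_Suc_Suc[of "X - 1" i] Suc by simp
    have "X * ((X gchoose j) * ((X - 1) gchoose (n - j))) = (X gchoose j) * ((real j + \<beta>) * (X gchoose (n - j)))"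
      unfolding r[symmetric] by simp
    also have "\<dots> = (real j + \<beta>) * (((X - 1) gchoose j) * (X gchoose (n - j))) +
        ((X - 1) gchoose i) * ((real j + \<beta>) * (X gchoose (n - j)))"
      unfolding p by (simp only: ring_distribs mult_ac)
    finally show ?thesis unfolding u[symmetric] X1 X_def[symmetric] using Suc by simp
  qed
qed

text \<open>One half of the Dirac equation for the modes, stripped of weights and square roots:
  differentiation couples the parameters \<open>(\<beta> - 1, \<beta>)\<close> to
  \<open>(\<beta>, \<beta> - 1)\<close> at the same degree.\<close>

lemma jacobi_poly_deriv_left:
  fixes \<beta> x :: real
  obtains P' where "(jacobi_poly n (\<beta> - 1) \<beta> has_real_derivative P') (at x)"
    "(1 + x) * P' + \<beta> * jacobi_poly n (\<beta> - 1) \<beta> x = (real n + \<beta>) * jacobi_poly n \<beta> (\<beta> - 1) x"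
proof -
  define a where "a k = ((real n + (\<beta> - 1)) gchoose k) * ((real n + \<beta>) gchoose (n - k))" for k
  define q where "q k = ((real n + \<beta>) gchoose k) * ((real n + (\<beta> - 1)) gchoose (n - k))" for k
  define t where "t k = (x - 1) ^ (n - k) * (x + 1) ^ k" for k
  define D where "D k = real (n - k) * (x - 1) ^ (n - k - 1) * (x + 1) ^ k +
      (x - 1) ^ (n - k) * (real k * (x + 1) ^ (k - 1))" for k
  have "((\<lambda>x. (\<Sum>k\<le>n. a k * ((x - 1) ^ (n - k) * (x + 1) ^ k)) / 2 ^ n) has_real_derivative
      (\<Sum>k\<le>n. a k * D k) / 2 ^ n) (at x)"
    by (intro DERIV_cdivide DERIV_sum DERIV_cmult) (auto simp: D_def intro!: derivative_eq_intros)
  then have d: "(jacobi_poly n (\<beta> - 1) \<beta> has_real_derivative (\<Sum>k\<le>n. a k * D k) / 2 ^ n) (at x)"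
    by (simp add: jacobi_poly_def[abs_def] a_def mult.assoc)
  \<comment> \<open>Multiplying the derivative of a summand by \<open>1 + x\<close> raises the power
    of \<open>x + 1\<close> in one of its two terms; \<open>b\<close> collects these terms after the
    index shift. The top summand contributes nothing because of its factor \<open>n - k\<close>, so
    the range does not grow.\<close>
  define b where "b j = (if j = 0 then 0 else a (j - 1) * real (n - (j - 1)))" for j
  have D: "(1 + x) * D k = real (n - k) * t (Suc k) + real k * t k" if "k \<le> n" for k
  proof -
    have e: "(x + 1) * ((x - 1) ^ (n - k) * (real k * (x + 1) ^ (k - 1))) =
        (x - 1) ^ (n - k) * (real k * (x + 1) ^ k)" by (cases k) simp_all
    have "(1 + x) * D k = real (n - k) * ((x - 1) ^ (n - k - 1) * ((x + 1) ^ k * (x + 1))) +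
        (x + 1) * ((x - 1) ^ (n - k) * (real k * (x + 1) ^ (k - 1)))"
      by (simp only: D_def ring_distribs mult_ac add_ac)
    then show ?thesis unfolding e by (simp add: t_def mult_ac)
  qed
  have "(1 + x) * (\<Sum>k\<le>n. a k * D k) = (\<Sum>k\<le>n. a k * ((1 + x) * D k))"
    by (simp add: sum_distrib_left mult_ac)
  also have "\<dots> = (\<Sum>k\<le>n. a k * (real (n - k) * t (Suc k) + real k * t k))"
    by (intro sum.cong) (simp_all add: D)
  also have "\<dots> = (\<Sum>k\<le>n. a k * real (n - k) * t (Suc k)) + (\<Sum>k\<le>n. real k * a k * t k)"
    by (simp only: distrib_left sum.distrib mult_ac)
  also have "(\<Sum>k\<le>n. a k * real (n - k) * t (Suc k)) = (\<Sum>k<n. a k * real (n - k) * t (Suc k))"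
    by (simp flip: lessThan_Suc_atMost)
  also have "\<dots> = (\<Sum>j\<le>n. b j * t j)"
    by (simp add: sum.atMost_shift b_def)
  finally have "(1 + x) * (\<Sum>k\<le>n. a k * D k) + \<beta> * (\<Sum>k\<le>n. a k * t k) =
      (\<Sum>j\<le>n. ((real j + \<beta>) * a j + b j) * t j)"
    by (simp add: sum_distrib_left sum.distrib algebra_simps)
  also have "\<dots> = (\<Sum>j\<le>n. (real n + \<beta>) * q j * t j)"
  proof (rule sum.cong[OF refl])
    fix j assume "j \<in> {..n}"
    then have "j \<le> n" by simp
    then have "(real j + \<beta>) * a j + b j = (real n + \<beta>) * q j"
      unfolding a_def b_def q_def by (rule jacobi_poly_coeff_relation)
    then show "((real j + \<beta>) * a j + b j) * t j = (real n + \<beta>) * q j * t j" by simp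
  qed
  also have "\<dots> = (real n + \<beta>) * (\<Sum>j\<le>n. q j * t j)" by (simp add: sum_distrib_left mult_ac)
  finally have main: "(1 + x) * (\<Sum>k\<le>n. a k * D k) + \<beta> * (\<Sum>k\<le>n. a k * t k) =
      (real n + \<beta>) * (\<Sum>j\<le>n. q j * t j)" .
  have P: "jacobi_poly n (\<beta> - 1) \<beta> x = (\<Sum>k\<le>n. a k * t k) / 2 ^ n"
    by (simp add: jacobi_poly_def a_def t_def mult.assoc)
  have Q: "jacobi_poly n \<beta> (\<beta> - 1) x = (\<Sum>k\<le>n. q k * t k) / 2 ^ n"
    by (simp add: jacobi_poly_def q_def t_def mult.assoc)
  show ?thesis
  proof (rule that[OF d])
    show "(1 + x) * ((\<Sum>k\<le>n. a k * D k) / 2 ^ n) + \<beta> * jacobi_poly n (\<beta> - 1) \<beta> x =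
        (real n + \<beta>) * jacobi_poly n \<beta> (\<beta> - 1) x"
      unfolding P Q times_divide_eq_right main[symmetric] add_divide_distrib ..
  qed
qed

text \<open>Reversing the order of summation exchanges the two binomial factors and the two
  powers.\<close>

lemma jacobi_poly_minus: "jacobi_poly n a b (- x) = (- 1) ^ n * jacobi_poly n b a x"
proof -
  have "(\<Sum>k\<le>n. ((real n + a) gchoose k) * ((real n + b) gchoose (n - k)) * (- x - 1) ^ (n - k) * (- x + 1) ^ k)
      = (\<Sum>k\<le>n. ((real n + a) gchoose (n - k)) * ((real n + b) gchoose (n - (n - k))) *
          (- x - 1) ^ (n - (n - k)) * (- x + 1) ^ (n - k))"
    by (rule sum.nat_diff_reindex[of _ "Suc n", simplified lessThan_Suc_atMost, simplified, symmetric])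
  also have "\<dots> = (\<Sum>k\<le>n. (- 1) ^ n * (((real n + b) gchoose k) * ((real n + a) gchoose (n - k)) *
          (x - 1) ^ (n - k) * (x + 1) ^ k))"
  proof (rule sum.cong[OF refl])
    fix k assume "k \<in> {..n}"
    then have k: "k \<le> n" by simp
    have "(- x - 1) ^ k = (- 1) ^ k * (x + 1) ^ k" "(- x + 1) ^ (n - k) = (- 1) ^ (n - k) * (x - 1) ^ (n - k)"
      by (simp_all flip: power_mult_distrib)
    moreover have "(- 1 :: real) ^ n = (- 1) ^ k * (- 1) ^ (n - k)" using k by (simp flip: power_add)
    ultimately show "((real n + a) gchoose (n - k)) * ((real n + b) gchoose (n - (n - k))) *
          (- x - 1) ^ (n - (n - k)) * (- x + 1) ^ (n - k) =
        (- 1) ^ n * (((real n + b) gchoose k) * ((real n + a) gchoose (n - k)) * (x - 1) ^ (n - k) * (x + 1) ^ k)"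
      using k by simp
  qed
  finally show ?thesis by (simp add: jacobi_poly_def sum_distrib_left)
qed

text \<open>The previous relation at \<open>- x\<close>, carried over by the reflection symmetry;
  the derivative changes sign through the chain rule.\<close>

lemma jacobi_poly_deriv_right:
  fixes \<beta> x :: real
  obtains Q' where "(jacobi_poly n \<beta> (\<beta> - 1) has_real_derivative Q') (at x)"
    "\<beta> * jacobi_poly n \<beta> (\<beta> - 1) x - (1 - x) * Q' = (real n + \<beta>) * jacobi_poly n (\<beta> - 1) \<beta> x"
proof -
  obtain P' where d: "(jacobi_poly n (\<beta> - 1) \<beta> has_real_derivative P') (at (- x))"
    and e: "(1 + - x) * P' + \<beta> * jacobi_poly n (\<beta> - 1) \<beta> (- x) = (real n + \<beta>) * jacobi_poly n \<beta> (\<beta> - 1) (- x)"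
    by (rule jacobi_poly_deriv_left)
  have s: "(- 1 :: real) ^ n * (- 1) ^ n = 1" by (simp flip: power_mult_distrib)
  have eq: "jacobi_poly n \<beta> (\<beta> - 1) = (\<lambda>x. (- 1) ^ n * jacobi_poly n (\<beta> - 1) \<beta> (- x))"
    using s by (simp add: jacobi_poly_minus fun_eq_iff)
  have "((\<lambda>x. (- 1) ^ n * jacobi_poly n (\<beta> - 1) \<beta> (- x)) has_real_derivative (- 1) ^ n * (P' * - 1)) (at x)"
    by (intro DERIV_cmult DERIV_chain2[where g = uminus, OF d] DERIV_minus DERIV_ident)
  then have d': "(jacobi_poly n \<beta> (\<beta> - 1) has_real_derivative (- 1) ^ n * (P' * - 1)) (at x)"
    unfolding eq .
  have "(- 1) ^ n * ((1 + - x) * P' + \<beta> * ((- 1) ^ n * jacobi_poly n \<beta> (\<beta> - 1) x)) =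
      (- 1) ^ n * ((real n + \<beta>) * ((- 1) ^ n * jacobi_poly n (\<beta> - 1) \<beta> x))"
    using e unfolding jacobi_poly_minus by simp
  then have "(1 - x) * ((- 1) ^ n * P') + \<beta> * (((- 1) ^ n * (- 1) ^ n) * jacobi_poly n \<beta> (\<beta> - 1) x) =
      (real n + \<beta>) * (((- 1) ^ n * (- 1) ^ n) * jacobi_poly n (\<beta> - 1) \<beta> x)"
    by (simp add: algebra_simps)
  then show ?thesis unfolding s by (intro that[OF d']) simp
qed

lemma jacobi_poly_1: "jacobi_poly n a b 1 = (real n + a) gchoose n"
proof -
  have "(\<Sum>k\<le>n. ((real n + a) gchoose k) * ((real n + b) gchoose (n - k)) * (1 - 1) ^ (n - k) * (1 + 1) ^ k)
      = (\<Sum>k\<le>n. if k = n then ((real n + a) gchoose n) * 2 ^ n else 0)"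
    by (intro sum.cong) (auto simp: power_0_left)
  then show ?thesis by (simp add: jacobi_poly_def)
qed

lemma isCont_jacobi_poly: "isCont (jacobi_poly n a b) x"
  unfolding jacobi_poly_def[abs_def] by (intro continuous_intros) auto

text \<open>Spatial components without the normalising constant. In this scaling the multiple
  produced by lowering is simply \<open>omega M n\<close>.\<close>

definition mode1 :: "real \<Rightarrow> nat \<Rightarrow> real \<Rightarrow> real" where
  "mode1 M n \<rho> = cos \<rho> powr M * (sqrt (1 + sin \<rho>) * jacobi_poly n (- 1 / 2 + M) (1 / 2 + M) (sin \<rho>))"

definition mode2 :: "real \<Rightarrow> nat \<Rightarrow> real \<Rightarrow> real" where
  "mode2 M n \<rho> = cos \<rho> powr M * (sqrt (1 - sin \<rho>) * jacobi_poly n (1 / 2 + M) (- 1 / 2 + M) (sin \<rho>))"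

section \<open>The modes solve the radial system and decay\<close>

lemma sqrt_sin_facts:
  assumes "\<rho> \<in> rho_interval"
  shows "sqrt (1 + sin \<rho>) * sqrt (1 - sin \<rho>) = cos \<rho>"
    "sqrt (1 + sin \<rho>) * sqrt (1 + sin \<rho>) = 1 + sin \<rho>" "sqrt (1 - sin \<rho>) * sqrt (1 - sin \<rho>) = 1 - sin \<rho>"
    "sqrt (1 + sin \<rho>) > 0" "sqrt (1 - sin \<rho>) > 0"
proof -
  have c: "cos \<rho> > 0" and s: "1 - sin \<rho> > 0" "1 + sin \<rho> > 0"
    using cos_pos_rho[OF assms] abs_sin_less_1[OF assms] by auto
  have "(1 + sin \<rho>) * (1 - sin \<rho>) = (cos \<rho>)\<^sup>2"
    by (simp add: cos_squared_eq power2_eq_square algebra_simps)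
  then show "sqrt (1 + sin \<rho>) * sqrt (1 - sin \<rho>) = cos \<rho>"
    using c by (simp flip: real_sqrt_mult)
qed (use abs_sin_less_1[OF assms] in auto)

lemma cos_powr_deriv:
  assumes "\<rho> \<in> rho_interval"
  shows "((\<lambda>\<rho>. cos \<rho> powr M) has_real_derivative - (M / cos \<rho> * sin \<rho> * cos \<rho> powr M)) (at \<rho>)"
  using cos_pos_rho[OF assms] by (auto intro!: derivative_eq_intros simp: powr_diff)

lemma sqrt_sin_deriv:
  assumes "\<rho> \<in> rho_interval"
  shows "((\<lambda>\<rho>. sqrt (1 + sin \<rho>)) has_real_derivative sqrt (1 - sin \<rho>) / 2) (at \<rho>)"
    "((\<lambda>\<rho>. sqrt (1 - sin \<rho>)) has_real_derivative - (sqrt (1 + sin \<rho>) / 2)) (at \<rho>)"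
proof -
  have p: "0 < 1 + sin \<rho>" "0 < 1 - sin \<rho>" using abs_sin_less_1[OF assms] by auto
  note f = sqrt_sin_facts[OF assms]
  have "inverse (sqrt (1 + sin \<rho>)) / 2 * cos \<rho> = sqrt (1 - sin \<rho>) / 2"
    "inverse (sqrt (1 - sin \<rho>)) / 2 * - cos \<rho> = - (sqrt (1 + sin \<rho>) / 2)"
    using f(4,5) by (simp_all add: field_simps flip: f(1))
  moreover have "((\<lambda>\<rho>. sqrt (1 + sin \<rho>)) has_real_derivative inverse (sqrt (1 + sin \<rho>)) / 2 * cos \<rho>) (at \<rho>)"
    by (rule DERIV_chain2[where g = "\<lambda>\<rho>. 1 + sin \<rho>", OF DERIV_real_sqrt[OF p(1)]]) (auto intro!: derivative_eq_intros)
  moreover have "((\<lambda>\<rho>. sqrt (1 - sin \<rho>)) has_real_derivative inverse (sqrt (1 - sin \<rho>)) / 2 * - cos \<rho>) (at \<rho>)"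
    by (rule DERIV_chain2[where g = "\<lambda>\<rho>. 1 - sin \<rho>", OF DERIV_real_sqrt[OF p(2)]]) (auto intro!: derivative_eq_intros)
  ultimately show "((\<lambda>\<rho>. sqrt (1 + sin \<rho>)) has_real_derivative sqrt (1 - sin \<rho>) / 2) (at \<rho>)"
    "((\<lambda>\<rho>. sqrt (1 - sin \<rho>)) has_real_derivative - (sqrt (1 + sin \<rho>) / 2)) (at \<rho>)" by simp_all
qed

lemma radial_system_mode: "radial_system M (omega M n) (mode1 M n) (mode2 M n)"
  unfolding radial_system_def
proof (intro ballI conjI)
  fix \<rho> assume r: "\<rho> \<in> rho_interval"
  define \<beta> where "\<beta> = 1 / 2 + M"
  have b: "- 1 / 2 + M = \<beta> - 1" "1 / 2 + M = \<beta>" by (simp_all add: \<beta>_def)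
  define A where "A = sqrt (1 + sin \<rho>)"
  define B where "B = sqrt (1 - sin \<rho>)"
  define w where "w = cos \<rho> powr M"
  define d where "d = M / cos \<rho>"
  have dc: "d * cos \<rho> = M" using cos_pos_rho[OF r] by (simp add: d_def)
  note AB = sqrt_sin_facts(1-3)[OF r, folded A_def B_def]
  note dw = cos_powr_deriv[OF r, of M, folded w_def d_def]
  note dA = sqrt_sin_deriv(1)[OF r, folded A_def B_def]
  note dB = sqrt_sin_deriv(2)[OF r, folded A_def B_def]
  define P where "P = jacobi_poly n (\<beta> - 1) \<beta> (sin \<rho>)"
  define Q where "Q = jacobi_poly n \<beta> (\<beta> - 1) (sin \<rho>)"
  have om: "omega M n = real n + \<beta>" by (simp add: omega_def \<beta>_def)
  obtain P' where P': "(jacobi_poly n (\<beta> - 1) \<beta> has_real_derivative P') (at (sin \<rho>))"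
    "(1 + sin \<rho>) * P' + \<beta> * P = (real n + \<beta>) * Q"
    unfolding P_def Q_def by (rule jacobi_poly_deriv_left)
  obtain Q' where Q': "(jacobi_poly n \<beta> (\<beta> - 1) has_real_derivative Q') (at (sin \<rho>))"
    "\<beta> * Q - (1 - sin \<rho>) * Q' = (real n + \<beta>) * P"
    unfolding P_def Q_def by (rule jacobi_poly_deriv_right)
  have m: "mode1 M n \<rho> = w * (A * P)" "mode2 M n \<rho> = w * (B * Q)"
    unfolding mode1_def mode2_def b A_def B_def w_def P_def Q_def by (rule refl)+
  \<comment> \<open>The summand \<open>d * (A * B)\<close>, equal to \<open>M\<close>, accounts for
    the derivative of the weight and for the potential; the summand \<open>1 / 2\<close> accounts
    for the derivatives of the square roots, \<open>B / 2\<close> and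
    \<open>- A / 2\<close>.\<close>
  have M\<beta>: "\<beta> = d * (A * B) + 1 / 2" unfolding AB dc by (simp add: \<beta>_def)
  show "(mode1 M n has_real_derivative omega M n * mode2 M n \<rho> - M / cos \<rho> * mode1 M n \<rho>) (at \<rho>)"
  proof -
    have "(mode1 M n has_real_derivative - (d * sin \<rho> * w) * (A * P) + (B / 2 * P + P' * cos \<rho> * A) * w) (at \<rho>)"
      unfolding mode1_def[abs_def] b
      by (rule DERIV_mult[OF dw DERIV_mult[OF dA DERIV_chain2[OF P'(1) DERIV_sin]],
            folded A_def w_def P_def])
    \<comment> \<open>The polynomial relation is multiplied by \<open>B\<close> because the
      right-hand side contains \<open>mode2\<close>, which carries \<open>B\<close>;
      \<open>A * A * B = A * cos \<rho>\<close> then restores the factor \<open>A\<close> of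
      \<open>mode1\<close>.\<close>
    moreover have "B * ((1 + sin \<rho>) * P' + \<beta> * P) = B * ((real n + \<beta>) * Q)" using P'(2) by simp
    then have "B * (A * A * P') + B * (d * (A * B) + 1 / 2) * P = B * ((real n + \<beta>) * Q)"
      unfolding AB(2) M\<beta>[symmetric] by (simp add: algebra_simps)
    then have "B * (A * A * P') + (B * B) * (d * A * P) + B * P / 2 = (real n + \<beta>) * B * Q"
      by (simp add: algebra_simps)
    then have "A * cos \<rho> * P' + (1 - sin \<rho>) * (d * A * P) + B * P / 2 = (real n + \<beta>) * B * Q"
      unfolding AB(3) by (simp add: algebra_simps flip: AB(1))
    then have "(A * cos \<rho> * P' + (1 - sin \<rho>) * (d * A * P) + B * P / 2) * w = ((real n + \<beta>) * B * Q) * w"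
      by simp
    then have "- (d * sin \<rho> * w) * (A * P) + (B / 2 * P + P' * cos \<rho> * A) * w =
        omega M n * mode2 M n \<rho> - d * mode1 M n \<rho>"
      unfolding m om by (simp add: algebra_simps)
    ultimately show ?thesis unfolding d_def by simp
  qed
  show "(mode2 M n has_real_derivative M / cos \<rho> * mode2 M n \<rho> - omega M n * mode1 M n \<rho>) (at \<rho>)"
  proof -
    have "(mode2 M n has_real_derivative - (d * sin \<rho> * w) * (B * Q) + (- (A / 2) * Q + Q' * cos \<rho> * B) * w) (at \<rho>)"
      unfolding mode2_def[abs_def] b
      by (rule DERIV_mult[OF dw DERIV_mult[OF dB DERIV_chain2[OF Q'(1) DERIV_sin]],
            folded B_def w_def Q_def])
    moreover have "A * (\<beta> * Q - (1 - sin \<rho>) * Q') = A * ((real n + \<beta>) * P)" using Q'(2) by simp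
    then have "A * (d * (A * B) + 1 / 2) * Q - A * (B * B * Q') = A * ((real n + \<beta>) * P)"
      unfolding AB(3) M\<beta>[symmetric] by (simp add: algebra_simps)
    then have "(A * A) * (d * B * Q) + A * Q / 2 - B * (A * B) * Q' = (real n + \<beta>) * A * P"
      by (simp add: algebra_simps)
    then have "(1 + sin \<rho>) * (d * B * Q) + A * Q / 2 - B * cos \<rho> * Q' = (real n + \<beta>) * A * P"
      unfolding AB(1,2) .
    then have "((1 + sin \<rho>) * (d * B * Q) + A * Q / 2 - B * cos \<rho> * Q') * w = ((real n + \<beta>) * A * P) * w"
      by simp
    then have "- (d * sin \<rho> * w) * (B * Q) + (- (A / 2) * Q + Q' * cos \<rho> * B) * w =
        d * mode2 M n \<rho> - omega M n * mode1 M n \<rho>"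
      unfolding m om by (simp add: algebra_simps)
    ultimately show ?thesis unfolding d_def by simp
  qed
qed

lemma vanishing_mode:
  assumes "M > 0"
  shows "vanishing (mode1 M n) (mode2 M n)"
proof -
  have J: "((\<lambda>\<rho>. jacobi_poly n a b (sin \<rho>)) \<longlongrightarrow> jacobi_poly n a b (sin x)) (at x within S)" for a b x S
    by (intro isCont_tendsto_compose[OF isCont_jacobi_poly] tendsto_intros)
  have c: "((\<lambda>\<rho>. cos \<rho> powr M) \<longlongrightarrow> 0 powr M) (at_left (pi / 2))"
    by (rule tendsto_powr')
      (use assms eventually_in_rho_left in \<open>auto intro!: tendsto_eq_intros elim!: eventually_mono
        dest: cos_pos_rho\<close>)
  have c': "((\<lambda>\<rho>. cos \<rho> powr M) \<longlongrightarrow> 0 powr M) (at_right (- pi / 2))"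
    by (rule tendsto_powr')
      (use assms eventually_in_rho_right in \<open>auto intro!: tendsto_eq_intros elim!: eventually_mono
        dest: cos_pos_rho\<close>)
  have s: "((\<lambda>\<rho>. sqrt (1 + sin \<rho>) * jacobi_poly n a b (sin \<rho>)) \<longlongrightarrow>
      sqrt (1 + sin x) * jacobi_poly n a b (sin x)) (at x within S)"
    "((\<lambda>\<rho>. sqrt (1 - sin \<rho>) * jacobi_poly n a b (sin \<rho>)) \<longlongrightarrow>
      sqrt (1 - sin x) * jacobi_poly n a b (sin x)) (at x within S)" for x a b S
    by (intro tendsto_intros J)+
  show ?thesis
    unfolding mode1_def[abs_def] mode2_def[abs_def]
    by (rule vanishingI; rule tendsto_eq_rhs, (rule tendsto_mult, (rule c c'), rule s), simp)
qed


section \<open>Non-vanishing of the modes and the action of lowering on them\<close>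

lemma jacobi_poly_1_pos:
  assumes "a > - 1"
  shows "jacobi_poly n a b 1 > 0"
  using assms unfolding jacobi_poly_1 gbinomial_prod_rev
  by (intro divide_pos_pos prod_pos) auto

lemma sin_tendsto_1: "(sin \<longlongrightarrow> 1) (at_left (pi / 2))"
  by (auto intro!: tendsto_eq_intros)

lemma jacobi_poly_sin_tendsto:
  "((\<lambda>\<rho>. jacobi_poly n a b (sin \<rho>)) \<longlongrightarrow> jacobi_poly n a b 1) (at_left (pi / 2))"
  by (rule isCont_tendsto_compose[OF isCont_jacobi_poly sin_tendsto_1])

text \<open>Identities are available only on the open interval; this lets them be compared at the
  excluded end, where \<open>sin \<rho>\<close> becomes \<open>1\<close>.\<close>

lemma eq_on_rho_tendsto_eq:
  fixes F G :: "real \<Rightarrow> real"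
  assumes "\<And>\<rho>. \<rho> \<in> rho_interval \<Longrightarrow> F \<rho> = G \<rho>"
    and "(F \<longlongrightarrow> x) (at_left (pi / 2))" "(G \<longlongrightarrow> y) (at_left (pi / 2))"
  shows "x = y"
proof -
  have "(G \<longlongrightarrow> x) (at_left (pi / 2))"
    by (rule Lim_transform_eventually[OF assms(2)], use eventually_in_rho_left in eventually_elim)
      (rule assms(1))
  then show ?thesis using assms(3) tendsto_unique trivial_limit_at_left_real by blast
qed

text \<open>Stated at \<open>0\<close> because uniqueness works with initial values there. A zero
  initial value would make \<open>mode1\<close> vanish identically, hence its polynomial factor
  would vanish in the limit, against its positive value at \<open>1\<close>.\<close>

lemma mode_nonzero:
  assumes "M \<ge> 1 / 2"
  shows "mode1 M n 0 \<noteq> 0 \<or> mode2 M n 0 \<noteq> 0"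
proof (rule ccontr)
  assume "\<not> ?thesis"
  then have z: "mode1 M n \<rho> = 0" if "\<rho> \<in> rho_interval" for \<rho>
    using radial_system_zero(1)[OF radial_system_mode _ _ _ that] assms by simp
  have "jacobi_poly n (- 1 / 2 + M) (1 / 2 + M) 1 = 0"
  proof (rule eq_on_rho_tendsto_eq[OF _ jacobi_poly_sin_tendsto tendsto_const])
    fix \<rho> assume r: "\<rho> \<in> rho_interval"
    show "jacobi_poly n (- 1 / 2 + M) (1 / 2 + M) (sin \<rho>) = 0"
      using z[OF r] cos_pos_rho[OF r] sqrt_sin_facts(4)[OF r] by (simp add: mode1_def)
  qed
  then show False using jacobi_poly_1_pos[of "- 1 / 2 + M" n "1 / 2 + M"] assms by simp
qed

lemma vanishing_mode_unique:
  assumes "radial_system M (omega M n) f g" "vanishing f g" "M \<ge> 1 / 2"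
  obtains c where "\<And>\<rho>. \<rho> \<in> rho_interval \<Longrightarrow> f \<rho> = c * mode1 M n \<rho>"
    "\<And>\<rho>. \<rho> \<in> rho_interval \<Longrightarrow> g \<rho> = c * mode2 M n \<rho>"
  using vanishing_unique[OF assms(1) radial_system_mode assms(2) vanishing_mode _ mode_nonzero] assms(3)
  by (metis (no_types, lifting) less_le_trans less_imp_le zero_less_divide_1_iff zero_less_numeral)

text \<open>The lowered frequency is \<open>M - 1 / 2\<close>, which lies in the strip that carries
  no decaying solution.\<close>

lemma lower_mode_0:
  assumes M: "M \<ge> 1 / 2" and r: "\<rho> \<in> rho_interval"
  shows "lower1 M (omega M 0) (mode1 M 0) (mode2 M 0) \<rho> = 0 \<and> lower2 M (omega M 0) (mode1 M 0) (mode2 M 0) \<rho> = 0"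
proof (rule vanishing_below_spectrum[OF radial_system_lower[OF radial_system_mode] vanishing_lower[OF vanishing_mode] M _ _ r])
qed (use M in \<open>auto simp: omega_def\<close>)

text \<open>Uniqueness at frequency \<open>omega M n\<close> yields some multiple \<open>c\<close>
  without any contiguity relation for the polynomials; \<open>c\<close> is determined at the right
  end.\<close>

lemma lower_mode_Suc:
  assumes M: "M \<ge> 1 / 2" and r: "\<rho> \<in> rho_interval"
  shows "lower1 M (omega M (Suc n)) (mode1 M (Suc n)) (mode2 M (Suc n)) \<rho> = omega M n * mode1 M n \<rho>"
    "lower2 M (omega M (Suc n)) (mode1 M (Suc n)) (mode2 M (Suc n)) \<rho> = omega M n * mode2 M n \<rho>"
proof -
  let ?f = "mode1 M (Suc n)" and ?g = "mode2 M (Suc n)"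
  have om: "omega M (Suc n) - 1 = omega M n" by (simp add: omega_def)
  have sys: "radial_system M (omega M n) (lower1 M (omega M (Suc n)) ?f ?g) (lower2 M (omega M (Suc n)) ?f ?g)"
    using radial_system_lower[OF radial_system_mode[of M "Suc n"]] unfolding om .
  have "vanishing (lower1 M (omega M (Suc n)) ?f ?g) (lower2 M (omega M (Suc n)) ?f ?g)"
    using vanishing_lower[OF vanishing_mode] M by simp
  from vanishing_mode_unique[OF sys this M] obtain c where
    c: "\<And>\<rho>. \<rho> \<in> rho_interval \<Longrightarrow> lower1 M (omega M (Suc n)) ?f ?g \<rho> = c * mode1 M n \<rho>"
      "\<And>\<rho>. \<rho> \<in> rho_interval \<Longrightarrow> lower2 M (omega M (Suc n)) ?f ?g \<rho> = c * mode2 M n \<rho>" by blast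
  define k where "k = omega M (Suc n) - 1 / 2"
  have k: "k - M = real (Suc n)" by (simp add: k_def omega_def)
  define P where "P n = jacobi_poly n (- 1 / 2 + M) (1 / 2 + M)" for n
  define Q where "Q n = jacobi_poly n (1 / 2 + M) (- 1 / 2 + M)" for n
  \<comment> \<open>The first component of the relation, divided by the common factor
    \<open>w * A\<close>. The factor \<open>B\<close> of \<open>mode2\<close> combines with
    \<open>cos \<rho> = A * B\<close> to \<open>1 - sin \<rho>\<close>, so the second polynomial
    drops out in the limit.\<close>
  have "(k * 1 - M) * P (Suc n) 1 + k * (1 - 1) * Q (Suc n) 1 = c * P n 1"
  proof (rule eq_on_rho_tendsto_eq)
    show "((\<lambda>\<rho>. (k * sin \<rho> - M) * P (Suc n) (sin \<rho>) + k * (1 - sin \<rho>) * Q (Suc n) (sin \<rho>)) \<longlongrightarrow>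
        (k * 1 - M) * P (Suc n) 1 + k * (1 - 1) * Q (Suc n) 1) (at_left (pi / 2))"
      unfolding P_def Q_def by (intro tendsto_intros sin_tendsto_1 jacobi_poly_sin_tendsto)
    show "((\<lambda>\<rho>. c * P n (sin \<rho>)) \<longlongrightarrow> c * P n 1) (at_left (pi / 2))"
      unfolding P_def by (intro tendsto_intros jacobi_poly_sin_tendsto)
    fix \<rho> assume r: "\<rho> \<in> rho_interval"
    define A where "A = sqrt (1 + sin \<rho>)"
    define B where "B = sqrt (1 - sin \<rho>)"
    define w where "w = cos \<rho> powr M"
    note AB = sqrt_sin_facts(1-3)[OF r, folded A_def B_def]
    have pos: "w * A \<noteq> 0" using cos_pos_rho[OF r] sqrt_sin_facts(4)[OF r] by (simp add: w_def A_def)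
    have "(k * sin \<rho> - M) * (w * (A * P (Suc n) (sin \<rho>))) + k * (A * B) * (w * (B * Q (Suc n) (sin \<rho>)))
        = c * (w * (A * P n (sin \<rho>)))"
      using c(1)[OF r] unfolding lower1_def mode1_def mode2_def AB(1)
      by (simp only: k_def P_def Q_def A_def B_def w_def)
    then have "(w * A) * ((k * sin \<rho> - M) * P (Suc n) (sin \<rho>) + k * (B * B) * Q (Suc n) (sin \<rho>))
        = (w * A) * (c * P n (sin \<rho>))" by (simp only: ring_distribs mult_ac)
    then show "(k * sin \<rho> - M) * P (Suc n) (sin \<rho>) + k * (1 - sin \<rho>) * Q (Suc n) (sin \<rho>) = c * P n (sin \<rho>)"
      unfolding AB(3) using pos by simp
  qed
  then have "real (Suc n) * P (Suc n) 1 = c * P n 1" unfolding k[symmetric] by simp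
  \<comment> \<open>The values at \<open>1\<close> are the binomials \<open>omega M n\<close> over
    \<open>Suc n\<close> and \<open>omega M n - 1\<close> over \<open>n\<close>, related by
    absorption.\<close>
  moreover have "real (Suc n) * P (Suc n) 1 = omega M n * P n 1"
    using gbinomial_absorption[of n "omega M n"]
    by (simp add: P_def jacobi_poly_1 omega_def algebra_simps)
  moreover have "P n 1 > 0" unfolding P_def using M by (intro jacobi_poly_1_pos) simp
  ultimately have "c = omega M n" by simp
  then show "lower1 M (omega M (Suc n)) ?f ?g \<rho> = omega M n * mode1 M n \<rho>"
    "lower2 M (omega M (Suc n)) ?f ?g \<rho> = omega M n * mode2 M n \<rho>" using c r by simp_all
qed

section \<open>Normalisation and orthogonality\<close>

text \<open>The substitution \<open>t = (1 + sin \<rho>) / 2\<close> gives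
  \<open>t * (1 - t) = (cos \<rho> / 2)\<^sup>2\<close> with Jacobian \<open>cos \<rho> / 2\<close>.
  The Beta integrand becomes \<open>(cos \<rho> / 2) powr (2 * M)\<close>, whence the power of
  \<open>2\<close> in front.\<close>

lemma cos_powr_integral:
  assumes M: "M > - 1 / 2"
  shows "((\<lambda>\<rho>. cos \<rho> powr (2 * M)) has_integral
      2 powr (2 * M) * Gamma (M + 1 / 2)^2 / Gamma (2 * M + 1)) rho_interval"
proof -
  define f where "f = (\<lambda>t::real. t powr (M + 1 / 2 - 1) * (1 - t) powr (M + 1 / 2 - 1))"
  define g :: "real \<Rightarrow> real" where "g = (\<lambda>\<rho>. (1 + sin \<rho>) / 2)"
  have b: "(f has_integral Beta (M + 1 / 2) (M + 1 / 2)) {0<..<1}"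
    using has_integral_Beta_real[of "M + 1 / 2" "M + 1 / 2"] M
    unfolding f_def by (simp add: has_integral_Icc_iff_Ioo)
  have "f absolutely_integrable_on {0<..<1}"
    using b by (intro nonnegative_absolutely_integrable_1) (auto simp: f_def integrable_on_def)
  moreover have img: "g ` rho_interval = {0<..<1}"
  proof
    show "g ` rho_interval \<subseteq> {0<..<1}"
      using abs_sin_less_1 by (force simp: g_def)
    show "{0<..<1} \<subseteq> g ` rho_interval"
    proof
      fix t :: real assume t: "t \<in> {0<..<1}"
      then have "g (arcsin (2 * t - 1)) = t" by (simp add: g_def)
      moreover have "arcsin (2 * t - 1) \<in> rho_interval"
        using arcsin_lt_bounded[of "2 * t - 1"] t by (simp add: rho_interval_def)
      ultimately show "t \<in> g ` rho_interval" by (metis image_eqI)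
    qed
  qed
  moreover have inj: "inj_on g rho_interval"
    unfolding inj_on_def g_def rho_interval_def using sin_inj_pi by auto
  moreover have der: "(g has_real_derivative cos \<rho> / 2) (at \<rho> within rho_interval)" for \<rho>
    unfolding g_def by (auto intro!: derivative_eq_intros)
  moreover have "rho_interval \<in> sets lebesgue" by (simp add: rho_interval_def)
  ultimately have "(\<lambda>x. \<bar>cos x / 2\<bar> * f (g x)) absolutely_integrable_on rho_interval \<and>
      integral rho_interval (\<lambda>x. \<bar>cos x / 2\<bar> * f (g x)) = Beta (M + 1 / 2) (M + 1 / 2)"
    using has_absolute_integral_change_of_variables_1'[of rho_interval g "\<lambda>\<rho>. cos \<rho> / 2" f] b
    by (auto simp: integral_unique)
  then have "((\<lambda>x. \<bar>cos x / 2\<bar> * f (g x)) has_integral Beta (M + 1 / 2) (M + 1 / 2)) rho_interval"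
    by (metis has_integral_integral set_lebesgue_integral_eq_integral(1))
  then have "((\<lambda>x. 2 powr (2 * M) * (\<bar>cos x / 2\<bar> * f (g x))) has_integral
      2 powr (2 * M) * Beta (M + 1 / 2) (M + 1 / 2)) rho_interval"
    by (rule has_integral_mult_right)
  then have "((\<lambda>\<rho>. cos \<rho> powr (2 * M)) has_integral
      2 powr (2 * M) * Beta (M + 1 / 2) (M + 1 / 2)) rho_interval"
  proof (rule has_integral_eq[rotated])
    fix x assume that: "x \<in> rho_interval"
    show "2 powr (2 * M) * (\<bar>cos x / 2\<bar> * f (g x)) = cos x powr (2 * M)"
  proof -
    have c: "cos x > 0" and s: "1 + sin x > 0" "1 - sin x > 0"
      using cos_pos_rho[OF that] abs_sin_less_1[OF that] by auto
    have "f (g x) = (g x * (1 - g x)) powr (M + 1 / 2 - 1)"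
      unfolding f_def by (rule powr_mult[symmetric])
    also have "g x * (1 - g x) = (1 - (sin x)\<^sup>2) / 4"
      by (simp add: g_def power2_eq_square field_simps)
    also have "\<dots> = (cos x / 2) powr 2"
      using c by (simp add: power_divide flip: cos_squared_eq)
    also have "\<dots> powr (M + 1 / 2 - 1) = (cos x / 2) powr (2 * M - 1)"
      by (simp add: powr_powr algebra_simps)
    finally have "\<bar>cos x / 2\<bar> * f (g x) = (cos x / 2) powr 1 * (cos x / 2) powr (2 * M - 1)"
      using c by simp
    also have "\<dots> = (cos x / 2) powr (2 * M)" by (simp only: powr_add[symmetric]) simp
    finally show ?thesis using c by (simp flip: powr_mult)
  qed
  qed
  then show ?thesis by (simp add: Beta_def power2_eq_square algebra_simps)
qed

lemma norm_const_pos: "M \<ge> 1 / 2 \<Longrightarrow> norm_const M n > 0"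
  unfolding norm_const_def by (intro divide_pos_pos real_sqrt_gt_zero mult_pos_pos Gamma_real_pos) auto

lemma norm_const_squared:
  assumes "M \<ge> 1 / 2"
  shows "(norm_const M n)\<^sup>2 = fact n * Gamma (real n + 2 * M + 1) /
    (2 powr (2 * M + 1) * (Gamma (1 / 2 + M + real n))\<^sup>2)"
proof -
  have "(2 powr (M + 1 / 2))\<^sup>2 = (2::real) powr (2 * M + 1)"
    by (simp add: power2_eq_square algebra_simps flip: powr_add)
  then show ?thesis
    using assms unfolding norm_const_def by (simp add: power_divide power_mult_distrib Gamma_real_pos less_imp_le)
qed

text \<open>The functional equation of the Gamma function. The right-hand factor is
  \<open>k\<^sup>2 - M\<^sup>2\<close> with \<open>k = Suc n + M\<close>, that is, the norm factor
  for lowering the mode \<open>Suc n\<close>.\<close>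

lemma norm_const_Suc:
  assumes M: "M \<ge> 1 / 2"
  shows "(omega M n)\<^sup>2 * (norm_const M (Suc n))\<^sup>2 = real (Suc n) * (real (Suc n) + 2 * M) * (norm_const M n)\<^sup>2"
proof -
  have "Gamma ((real n + 2 * M + 1) + 1) = (real n + 2 * M + 1) * Gamma (real n + 2 * M + 1)"
    using M by (intro Gamma_plus1) (auto elim!: nonpos_Ints_cases)
  moreover have "Gamma ((1 / 2 + M + real n) + 1) = (1 / 2 + M + real n) * Gamma (1 / 2 + M + real n)"
    using M by (intro Gamma_plus1) (auto elim!: nonpos_Ints_cases)
  ultimately have G: "Gamma (real (Suc n) + 2 * M + 1) = (real n + 2 * M + 1) * Gamma (real n + 2 * M + 1)"
    "Gamma (1 / 2 + M + real (Suc n)) = omega M n * Gamma (1 / 2 + M + real n)"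
    by (simp_all add: omega_def algebra_simps)
  have "omega M n > 0" "Gamma (1 / 2 + M + real n) > 0" using M by (auto simp: omega_def intro!: Gamma_real_pos)
  then show ?thesis
    unfolding norm_const_squared[OF M] G by (simp add: field_simps power2_eq_square)
qed

text \<open>For \<open>n = 0\<close> both polynomials are \<open>1\<close> and the density collapses
  to \<open>2 * cos \<rho> powr (2 * M)\<close>. In the step, lowering the mode \<open>Suc n\<close>
  gives \<open>omega M n\<close> times the mode \<open>n\<close>, so the norm identity links
  consecutive integrals in the same ratio as the constants.\<close>

lemma mode_norm:
  assumes M: "M \<ge> 1 / 2"
  shows "(norm_const M n)\<^sup>2 * (LINT \<rho>:rho_interval|lborel. (mode1 M n \<rho>)\<^sup>2 + (mode2 M n \<rho>)\<^sup>2) = 1"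
proof (induction n)
  case 0
  have int: "set_integrable lborel rho_interval (\<lambda>\<rho>. (mode1 M 0 \<rho>)\<^sup>2 + (mode2 M 0 \<rho>)\<^sup>2)"
    using M by (intro set_integrable_sum_squares radial_system_continuous[OF radial_system_mode] vanishing_mode) auto
  have eq: "(mode1 M 0 \<rho>)\<^sup>2 + (mode2 M 0 \<rho>)\<^sup>2 = 2 * cos \<rho> powr (2 * M)" if r: "\<rho> \<in> rho_interval" for \<rho>
  proof -
    have "(cos \<rho> powr M)\<^sup>2 = cos \<rho> powr (2 * M)" by (simp add: power2_eq_square flip: powr_add)
    moreover have "(mode1 M 0 \<rho>)\<^sup>2 + (mode2 M 0 \<rho>)\<^sup>2 = (cos \<rho> powr M)\<^sup>2 * ((1 + sin \<rho>) + (1 - sin \<rho>))"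
      using sqrt_sin_facts(2,3)[OF r]
      by (simp only: mode1_def mode2_def power_mult_distrib ring_distribs)
        (simp add: jacobi_poly_def power2_eq_square algebra_simps)
    ultimately show ?thesis by simp
  qed
  have "((\<lambda>\<rho>. 2 * cos \<rho> powr (2 * M)) has_integral
      2 * (2 powr (2 * M) * Gamma (M + 1 / 2)^2 / Gamma (2 * M + 1))) rho_interval"
    using M by (intro has_integral_mult_right cos_powr_integral) simp
  then have "((\<lambda>\<rho>. (mode1 M 0 \<rho>)\<^sup>2 + (mode2 M 0 \<rho>)\<^sup>2) has_integral
      2 * (2 powr (2 * M) * Gamma (M + 1 / 2)^2 / Gamma (2 * M + 1))) rho_interval"
    by (rule has_integral_eq[rotated]) (simp add: eq)
  then have I: "(LINT \<rho>:rho_interval|lborel. (mode1 M 0 \<rho>)\<^sup>2 + (mode2 M 0 \<rho>)\<^sup>2) =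
      2 powr (2 * M + 1) * Gamma (1 / 2 + M)^2 / Gamma (2 * M + 1)"
    using set_borel_integral_eq_integral(2)[OF int] by (simp add: integral_unique powr_add add.commute)
  have "Gamma (1 / 2 + M) > 0" "Gamma (2 * M + 1) > 0" using M by (auto intro!: Gamma_real_pos)
  then show ?case unfolding I norm_const_squared[OF M] by simp
next
  case (Suc n)
  let ?I = "\<lambda>n. LINT \<rho>:rho_interval|lborel. (mode1 M n \<rho>)\<^sup>2 + (mode2 M n \<rho>)\<^sup>2"
  have "(omega M n)\<^sup>2 * ?I n = (LINT \<rho>:rho_interval|lborel.
      (omega M n)\<^sup>2 * ((mode1 M n \<rho>)\<^sup>2 + (mode2 M n \<rho>)\<^sup>2))" by simp
  also have "\<dots> = (LINT \<rho>:rho_interval|lborel. (lower1 M (omega M (Suc n)) (mode1 M (Suc n)) (mode2 M (Suc n)) \<rho>)\<^sup>2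
      + (lower2 M (omega M (Suc n)) (mode1 M (Suc n)) (mode2 M (Suc n)) \<rho>)\<^sup>2)"
    by (rule set_lebesgue_integral_cong)
      (auto simp: lower_mode_Suc[OF M] power_mult_distrib distrib_left rho_interval_def)
  also have "\<dots> = ((omega M (Suc n) - 1 / 2)\<^sup>2 - M\<^sup>2) * ?I (Suc n)"
    using M by (intro lower_norm radial_system_mode vanishing_mode) simp
  also have "(omega M (Suc n) - 1 / 2)\<^sup>2 - M\<^sup>2 = real (Suc n) * (real (Suc n) + 2 * M)"
    by (simp add: omega_def power2_eq_square algebra_simps)
  finally have I: "(omega M n)\<^sup>2 * ?I n = real (Suc n) * (real (Suc n) + 2 * M) * ?I (Suc n)" .
  have o: "(omega M n)\<^sup>2 \<noteq> 0" "real (Suc n) * (real (Suc n) + 2 * M) \<noteq> 0"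
    using M by (auto simp: omega_def)
  define K where "K = real (Suc n) * (real (Suc n) + 2 * M)"
  have "(omega M n)\<^sup>2 * ((norm_const M (Suc n))\<^sup>2 * ?I (Suc n)) = (K * (norm_const M n)\<^sup>2) * ?I (Suc n)"
    using norm_const_Suc[OF M, of n] unfolding K_def by (simp only: mult.assoc[symmetric])
  also have "\<dots> = (norm_const M n)\<^sup>2 * (K * ?I (Suc n))" by (simp only: mult_ac)
  also have "\<dots> = (omega M n)\<^sup>2 * ((norm_const M n)\<^sup>2 * ?I n)" unfolding K_def I[symmetric] by (simp only: mult_ac)
  finally have "(omega M n)\<^sup>2 * ((norm_const M (Suc n))\<^sup>2 * ?I (Suc n)) = (omega M n)\<^sup>2 * 1" unfolding Suc.IH .
  then show ?case using o by simp
qed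

text \<open>The Wronskian of solutions with different frequencies has derivative \<open>(\<omega> -
  \<omega>') * (f \<rho> * u \<rho> + g \<rho> * v \<rho>)\<close> and decays at both ends.\<close>

lemma radial_orthogonal:
  assumes sys: "radial_system M \<omega> f g" "radial_system M \<omega>' u v"
    and van: "vanishing f g" "vanishing u v" and ne: "\<omega> \<noteq> \<omega>'"
  shows "(LINT \<rho>:rho_interval|lborel. f \<rho> * u \<rho> + g \<rho> * v \<rho>) = 0"
proof -
  define W where "W = (\<lambda>\<rho>. f \<rho> * v \<rho> - g \<rho> * u \<rho>)"
  note l = vanishingD[OF van(1)] vanishingD[OF van(2)]
  have "(LINT \<rho>:rho_interval|lborel. (\<omega> - \<omega>') * (f \<rho> * u \<rho> + g \<rho> * v \<rho>)) = 0"
  proof (rule integral_derivative_rho[where F = W])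
    show "(W \<longlongrightarrow> 0) (at_left (pi / 2))"
      using tendsto_diff[OF tendsto_mult[OF l(1) l(6)] tendsto_mult[OF l(2) l(5)]] by (simp add: W_def)
    show "(W \<longlongrightarrow> 0) (at_right (- pi / 2))"
      using tendsto_diff[OF tendsto_mult[OF l(3) l(8)] tendsto_mult[OF l(4) l(7)]] by (simp add: W_def)
    show "set_integrable lborel rho_interval (\<lambda>\<rho>. (\<omega> - \<omega>') * (f \<rho> * u \<rho> + g \<rho> * v \<rho>))"
      by (intro set_integrable_rho continuous_intros radial_system_continuous[OF sys(1)]
          radial_system_continuous[OF sys(2)] tendsto_mult_right_zero tendsto_add_zero tendsto_mult_zero l)
    fix \<rho> assume r: "\<rho> \<in> rho_interval"
    have d: "(f has_real_derivative (\<omega> * g \<rho> - M / cos \<rho> * f \<rho>)) (at \<rho>)"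
       "(g has_real_derivative (M / cos \<rho> * g \<rho> - \<omega> * f \<rho>)) (at \<rho>)"
       "(u has_real_derivative (\<omega>' * v \<rho> - M / cos \<rho> * u \<rho>)) (at \<rho>)"
       "(v has_real_derivative (M / cos \<rho> * v \<rho> - \<omega>' * u \<rho>)) (at \<rho>)"
      using sys r unfolding radial_system_def by blast+
    show "(W has_real_derivative (\<omega> - \<omega>') * (f \<rho> * u \<rho> + g \<rho> * v \<rho>)) (at \<rho>)" unfolding W_def
      by (rule DERIV_cong, (rule derivative_intros d)+) (simp add: algebra_simps)
  qed
  then show ?thesis using ne by simp
qed


section \<open>Discrete series from a ladder of modes\<close>

text \<open>Isolates the algebra so that one proof serves both signs of the frequency. Linearity and
  the rules for \<open>ip\<close> are restricted to \<open>V\<close>, since derivatives and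
  integrals of spinors obey them only for sufficiently regular arguments; positivity is derived from
  orthonormality. \<open>a_eq\<close> encodes skew-adjointness and \<open>b_norm\<close> carries the
  commutator and the Casimir value.\<close>

locale lowest_weight_ladder = complex_vector_space scale
  for scale :: "complex \<Rightarrow> 'b::ab_group_add \<Rightarrow> 'b" (infixr \<open>*c\<close> 75) +
  fixes \<psi> :: "nat \<Rightarrow> 'b" and V :: "'b set" and ip :: "'b \<Rightarrow> 'b \<Rightarrow> complex"
    and L0 Lp Lm :: "'b \<Rightarrow> 'b" and l :: real and a b :: "nat \<Rightarrow> complex"
  assumes V_def: "V = span (range \<psi>)"
    and l_pos: "l > 0"
    and linear: "linear_op_on V L0" "linear_op_on V Lp" "linear_op_on V Lm"
    and L0_\<psi>: "L0 (\<psi> n) = complex_of_real (l + real n) *c \<psi> n"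
    and Lp_\<psi>: "Lp (\<psi> n) = a n *c \<psi> (Suc n)"
    and Lm_\<psi>_0: "Lm (\<psi> 0) = 0"
    and Lm_\<psi>_Suc: "Lm (\<psi> (Suc n)) = b n *c \<psi> n"
    and a_eq: "a n = - cnj (b n)"
    and b_norm: "b n * cnj (b n) = complex_of_real (real (Suc n) * (real n + 2 * l))"
    and ip_add: "u \<in> V \<Longrightarrow> v \<in> V \<Longrightarrow> w \<in> V \<Longrightarrow> ip u (v + w) = ip u v + ip u w"
    and ip_scale: "u \<in> V \<Longrightarrow> v \<in> V \<Longrightarrow> ip u (c *c v) = c * ip u v"
    and ip_sym: "u \<in> V \<Longrightarrow> v \<in> V \<Longrightarrow> ip v u = cnj (ip u v)"
    and orthonormal: "ip (\<psi> m) (\<psi> n) = (if m = n then 1 else 0)"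
begin

lemma subspace_V: "subspace V"
  unfolding V_def by (rule subspace_span)

lemma \<psi>_in_V: "\<psi> n \<in> V"
  unfolding V_def by (rule span_base) simp

text \<open>Span induction that also supplies membership in \<open>V\<close> in each case, so that
  the relative linearity rules apply.\<close>

lemma mode_induct [consumes 1, case_names mode add scale]:
  assumes "v \<in> V" and mode: "\<And>n. P (\<psi> n)"
    and add: "\<And>u v. u \<in> V \<Longrightarrow> v \<in> V \<Longrightarrow> P u \<Longrightarrow> P v \<Longrightarrow> P (u + v)"
    and scale: "\<And>c u. u \<in> V \<Longrightarrow> P u \<Longrightarrow> P (c *c u)"
  shows "P v"
proof -
  have "subspace {v \<in> V. P v}"
    using scale[OF \<psi>_in_V mode, of 0 0] subspace_V add scale
    by (auto simp: subspace_def)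
  then have "span (range \<psi>) \<subseteq> {v \<in> V. P v}"
    using mode \<psi>_in_V by (intro span_minimal) auto
  then show ?thesis using assms(1) by (auto simp: V_def)
qed

lemma linear_op_intros:
  "linear_op_on V F \<Longrightarrow> linear_op_on V G \<Longrightarrow> linear_op_on V (\<lambda>v. F v + G v)"
  "linear_op_on V F \<Longrightarrow> linear_op_on V G \<Longrightarrow> linear_op_on V (\<lambda>v. F v - G v)"
  "linear_op_on V F \<Longrightarrow> linear_op_on V (\<lambda>v. - F v)"
  "linear_op_on V F \<Longrightarrow> linear_op_on V (\<lambda>v. c *c F v)"
  unfolding linear_op_on_def
  by (simp_all add: scale_right_distrib scale_right_diff_distrib mult.commute)

lemma linear_ops_agree:
  assumes F: "linear_op_on V F" and G: "linear_op_on V G" and eq: "\<And>n. F (\<psi> n) = G (\<psi> n)" and v: "v \<in> V"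
  shows "F v = G v"
  using v by (induction rule: mode_induct) (use eq F G in \<open>auto simp: linear_op_on_def\<close>)

lemma invariant_if_modes:
  assumes F: "linear_op_on V F" and eq: "\<And>n. F (\<psi> n) \<in> V"
  shows "invariant_under F V"
  unfolding invariant_under_def
proof
  fix v assume "v \<in> V"
  then show "F v \<in> V"
    by (induction rule: mode_induct) (use eq F subspace_V in \<open>auto simp: linear_op_on_def subspace_def\<close>)
qed

lemma invariant: "invariant_under L0 V" "invariant_under Lp V" "invariant_under Lm V"
proof -
  have "Lm (\<psi> n) \<in> V" for n
    by (cases n) (use subspace_V \<psi>_in_V in \<open>auto simp: Lm_\<psi>_0 Lm_\<psi>_Suc subspace_def\<close>)
  then show "invariant_under L0 V" "invariant_under Lp V" "invariant_under Lm V"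
    using subspace_V \<psi>_in_V
    by (auto intro!: invariant_if_modes linear simp: L0_\<psi> Lp_\<psi> subspace_def)
qed

lemma in_V [simp]: "v \<in> V \<Longrightarrow> L0 v \<in> V" "v \<in> V \<Longrightarrow> Lp v \<in> V" "v \<in> V \<Longrightarrow> Lm v \<in> V"
  using invariant by (auto simp: invariant_under_def)

lemma V_closed [simp]: "u \<in> V \<Longrightarrow> v \<in> V \<Longrightarrow> u + v \<in> V" "v \<in> V \<Longrightarrow> c *c v \<in> V" "0 \<in> V"
    "u \<in> V \<Longrightarrow> v \<in> V \<Longrightarrow> u - v \<in> V" "v \<in> V \<Longrightarrow> - v \<in> V"
  using subspace_V by (auto simp: subspace_def intro: subspace_diff subspace_neg)

lemma linear_op_simps [simp]:
  "u \<in> V \<Longrightarrow> v \<in> V \<Longrightarrow> L0 (u + v) = L0 u + L0 v" "v \<in> V \<Longrightarrow> L0 (c *c v) = c *c L0 v"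
  "u \<in> V \<Longrightarrow> v \<in> V \<Longrightarrow> Lp (u + v) = Lp u + Lp v" "v \<in> V \<Longrightarrow> Lp (c *c v) = c *c Lp v"
  "u \<in> V \<Longrightarrow> v \<in> V \<Longrightarrow> Lm (u + v) = Lm u + Lm v" "v \<in> V \<Longrightarrow> Lm (c *c v) = c *c Lm v"
  using linear by (auto simp: linear_op_on_def)

section \<open>Commutation relations and the Casimir operator\<close>

lemma linear_products:
  "linear_op_on V (\<lambda>v. L0 (L0 v))" "linear_op_on V (\<lambda>v. L0 (Lp v))" "linear_op_on V (\<lambda>v. L0 (Lm v))"
  "linear_op_on V (\<lambda>v. Lp (L0 v))" "linear_op_on V (\<lambda>v. Lm (L0 v))"
  "linear_op_on V (\<lambda>v. Lp (Lm v))" "linear_op_on V (\<lambda>v. Lm (Lp v))" "linear_op_on V (\<lambda>v. v)"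
  by (simp_all add: linear_op_on_def)

lemma ladder_product:
  "a n * b n = - complex_of_real (real (Suc n) * (real n + 2 * l))"
  using b_norm[of n] by (simp add: a_eq mult.commute)

lemma LpLm_\<psi>: "Lp (Lm (\<psi> n)) = - complex_of_real (real n * (real n - 1 + 2 * l)) *c \<psi> n"
proof (cases n)
  case 0
  have "Lp 0 = 0" using linear_op_simps(4)[of 0 0] by simp
  then show ?thesis using 0 by (simp add: Lm_\<psi>_0)
next
  case (Suc m)
  have "Lp (Lm (\<psi> n)) = (a m * b m) *c \<psi> n"
    using Suc \<psi>_in_V by (simp add: Lm_\<psi>_Suc Lp_\<psi> mult.commute)
  then show ?thesis using Suc by (simp add: ladder_product)
qed

lemma LmLp_\<psi>: "Lm (Lp (\<psi> n)) = - complex_of_real (real (Suc n) * (real n + 2 * l)) *c \<psi> n"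
proof -
  have "Lm (Lp (\<psi> n)) = (a n * b n) *c \<psi> n" using \<psi>_in_V by (simp add: Lm_\<psi>_Suc Lp_\<psi>)
  then show ?thesis by (simp only: ladder_product)
qed

text \<open>All relations are linear in the vector, so they are checked on modes. For the last one,
  consecutive values of \<open>n * (n - 1 + 2 * l)\<close> differ by
  \<open>2 * (l + n)\<close>.\<close>

lemma sl2: "sl2_rep V L0 Lp Lm"
  unfolding sl2_rep_def
proof (intro conjI)
  show "subspace V" by (rule subspace_V)
  show "\<forall>T\<in>{L0, Lp, Lm}. invariant_under T V \<and> linear_op_on V T" using invariant linear by auto
  show "\<forall>v\<in>V. L0 (Lp v) - Lp (L0 v) = Lp v"
  proof
    fix v assume "v \<in> V"
    then show "L0 (Lp v) - Lp (L0 v) = Lp v"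
    proof (rule linear_ops_agree[where F = "\<lambda>v. L0 (Lp v) - Lp (L0 v)" and G = Lp, rotated 3])
      show "linear_op_on V (\<lambda>v. L0 (Lp v) - Lp (L0 v))" "linear_op_on V Lp"
        by (intro linear_op_intros linear_products linear)+
      fix n
      have "L0 (Lp (\<psi> n)) - Lp (L0 (\<psi> n)) =
          (a n * complex_of_real (l + real (Suc n)) - complex_of_real (l + real n) * a n) *c \<psi> (Suc n)"
        using \<psi>_in_V by (simp add: L0_\<psi> Lp_\<psi> scale_left_diff_distrib)
      also have "a n * complex_of_real (l + real (Suc n)) - complex_of_real (l + real n) * a n = a n"
        by (simp add: algebra_simps)
      finally show "L0 (Lp (\<psi> n)) - Lp (L0 (\<psi> n)) = Lp (\<psi> n)" by (simp add: Lp_\<psi>)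
    qed
  qed
  show "\<forall>v\<in>V. L0 (Lm v) - Lm (L0 v) = - Lm v"
  proof
    fix v assume v: "v \<in> V"
    have eq: "L0 (Lm (\<psi> n)) - Lm (L0 (\<psi> n)) = - Lm (\<psi> n)" for n
    proof (cases n)
      case 0
      have "L0 0 = 0" using linear_op_simps(2)[of 0 0] by simp
      then show ?thesis using 0 \<psi>_in_V by (simp add: L0_\<psi> Lm_\<psi>_0)
    next
      case (Suc m)
      have "L0 (Lm (\<psi> n)) - Lm (L0 (\<psi> n)) =
          (b m * complex_of_real (l + real m) - complex_of_real (l + real (Suc m)) * b m) *c \<psi> m"
        using Suc \<psi>_in_V by (simp add: L0_\<psi> Lm_\<psi>_Suc scale_left_diff_distrib)
      also have "b m * complex_of_real (l + real m) - complex_of_real (l + real (Suc m)) * b m = - b m"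
        by (simp add: algebra_simps)
      finally show ?thesis using Suc by (simp add: Lm_\<psi>_Suc)
    qed
    show "L0 (Lm v) - Lm (L0 v) = - Lm v"
      by (rule linear_ops_agree[of "\<lambda>v. L0 (Lm v) - Lm (L0 v)" "\<lambda>v. - Lm v", OF _ _ eq v])
        (intro linear_op_intros linear_products linear)+
  qed
  show "\<forall>v\<in>V. Lp (Lm v) - Lm (Lp v) = 2 *c L0 v"
  proof
    fix v assume v: "v \<in> V"
    have eq: "Lp (Lm (\<psi> n)) - Lm (Lp (\<psi> n)) = 2 *c L0 (\<psi> n)" for n
    proof -
      have "Lp (Lm (\<psi> n)) - Lm (Lp (\<psi> n)) = complex_of_real
          (- (real n * (real n - 1 + 2 * l)) - - (real (Suc n) * (real n + 2 * l))) *c \<psi> n"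
        unfolding LpLm_\<psi> LmLp_\<psi> scale_left_diff_distrib[symmetric] by simp
      also have "- (real n * (real n - 1 + 2 * l)) - - (real (Suc n) * (real n + 2 * l)) = 2 * (l + real n)"
        by (simp add: algebra_simps)
      finally show ?thesis by (simp add: L0_\<psi>)
    qed
    show "Lp (Lm v) - Lm (Lp v) = 2 *c L0 v"
      by (rule linear_ops_agree[of "\<lambda>v. Lp (Lm v) - Lm (Lp v)" "\<lambda>v. 2 *c L0 v", OF _ _ eq v])
        (intro linear_op_intros linear_products linear)+
  qed
qed

lemma casimir_V:
  assumes "v \<in> V"
  shows "casimir L0 Lp Lm v = complex_of_real (l * (l - 1)) *c v"
proof -
  have "casimir L0 Lp Lm (\<psi> n) = complex_of_real (l * (l - 1)) *c \<psi> n" for n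
  proof -
    have "casimir L0 Lp Lm (\<psi> n) = complex_of_real ((l + real n) * (l + real n) +
        1 / 2 * (- (real n * (real n - 1 + 2 * l)) + - (real (Suc n) * (real n + 2 * l)))) *c \<psi> n"
      unfolding casimir_def LpLm_\<psi> LmLp_\<psi> scale_left_distrib[symmetric] scale_scale
      using \<psi>_in_V by (simp add: L0_\<psi> scale_left_distrib[symmetric] del: scale_left_distrib)
    also have "(l + real n) * (l + real n) +
        1 / 2 * (- (real n * (real n - 1 + 2 * l)) + - (real (Suc n) * (real n + 2 * l))) = l * (l - 1)"
      by (simp add: algebra_simps)
    finally show ?thesis .
  qed
  moreover have "linear_op_on V (casimir L0 Lp Lm)"
    unfolding casimir_def[abs_def] by (intro linear_op_intros linear_products)
  moreover have "linear_op_on V (\<lambda>v. complex_of_real (l * (l - 1)) *c v)"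
    by (intro linear_op_intros linear_products)
  ultimately show ?thesis using assms linear_ops_agree by blast
qed

section \<open>Coefficients, positivity and adjoints\<close>

lemma ip_zero_right: "u \<in> V \<Longrightarrow> ip u 0 = 0"
  using ip_scale[of u 0 0] by simp

lemma ip_add_left: "u \<in> V \<Longrightarrow> v \<in> V \<Longrightarrow> w \<in> V \<Longrightarrow> ip (u + v) w = ip u w + ip v w"
  using ip_sym[of w "u + v"] ip_sym[of w u] ip_sym[of w v] ip_add[of w u v] by simp

lemma ip_scale_left: "u \<in> V \<Longrightarrow> v \<in> V \<Longrightarrow> ip (c *c u) v = cnj c * ip u v"
  using ip_sym[of v "c *c u"] ip_sym[of v u] ip_scale[of v u c] by simp

lemma ip_minus [simp]: "u \<in> V \<Longrightarrow> v \<in> V \<Longrightarrow> ip (- u) v = - ip u v"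
  "u \<in> V \<Longrightarrow> v \<in> V \<Longrightarrow> ip u (- v) = - ip u v"
  using ip_scale_left[of u v "-1"] ip_scale[of u v "-1"] by simp_all

lemma ip_sum_right: "u \<in> V \<Longrightarrow> ip u (\<Sum>n<N. c n *c \<psi> n) = (\<Sum>n<N. c n * ip u (\<psi> n))"
proof (induction N)
  case (Suc N)
  have "(\<Sum>n<N. c n *c \<psi> n) \<in> V" using subspace_V \<psi>_in_V by (intro subspace_sum) auto
  then show ?case using Suc \<psi>_in_V by (simp add: ip_add ip_scale)
qed (simp add: ip_zero_right)

lemma sum_modes_in_V [simp]: "(\<Sum>n<N. c n *c \<psi> n) \<in> V"
  using subspace_V \<psi>_in_V by (intro subspace_sum) auto

text \<open>Valid for every sufficiently large cut-off, so that two expansions can be brought to a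
  common length when vectors are added.\<close>

lemma expansion:
  assumes "v \<in> V"
  obtains N where "\<And>K. K \<ge> N \<Longrightarrow> v = (\<Sum>n<K. ip (\<psi> n) v *c \<psi> n)"
proof -
  have "\<exists>N. \<forall>K\<ge>N. v = (\<Sum>n<K. ip (\<psi> n) v *c \<psi> n)" using assms
  proof (induction rule: mode_induct)
    case (mode m)
    have "\<psi> m = (\<Sum>n<K. ip (\<psi> n) (\<psi> m) *c \<psi> n)" if "K \<ge> Suc m" for K
    proof -
      have "(\<Sum>n<K. ip (\<psi> n) (\<psi> m) *c \<psi> n) = (\<Sum>n<K. if n = m then \<psi> m else 0)"
        by (intro sum.cong) (auto simp: orthonormal)
      then show ?thesis using that by (simp add: sum.delta)
    qed
    then show ?case by blast
  next
    case (add u v)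
    then obtain N1 N2 where N: "\<forall>K\<ge>N1. u = (\<Sum>n<K. ip (\<psi> n) u *c \<psi> n)"
      "\<forall>K\<ge>N2. v = (\<Sum>n<K. ip (\<psi> n) v *c \<psi> n)" by blast
    have "u + v = (\<Sum>n<K. ip (\<psi> n) (u + v) *c \<psi> n)" if "K \<ge> max N1 N2" for K
    proof -
      have "(\<Sum>n<K. ip (\<psi> n) (u + v) *c \<psi> n) = (\<Sum>n<K. ip (\<psi> n) u *c \<psi> n) + (\<Sum>n<K. ip (\<psi> n) v *c \<psi> n)"
        using add \<psi>_in_V by (simp add: ip_add scale_left_distrib sum.distrib)
      also have "\<dots> = u + v" using N that by (metis max.bounded_iff)
      finally show ?thesis by simp
    qed
    then show ?case by blast
  next
    case (scale c u)
    then obtain N where N: "\<forall>K\<ge>N. u = (\<Sum>n<K. ip (\<psi> n) u *c \<psi> n)" by blast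
    have "c *c u = (\<Sum>n<K. ip (\<psi> n) (c *c u) *c \<psi> n)" if "K \<ge> N" for K
    proof -
      have "(\<Sum>n<K. ip (\<psi> n) (c *c u) *c \<psi> n) = c *c (\<Sum>n<K. ip (\<psi> n) u *c \<psi> n)"
        using scale \<psi>_in_V by (simp add: ip_scale scale_sum_right)
      also have "\<dots> = c *c u" using N that by metis
      finally show ?thesis by simp
    qed
    then show ?case by blast
  qed
  then show ?thesis using that by blast
qed

lemma zero_if_coeffs_zero:
  assumes "v \<in> V" "\<And>n. ip (\<psi> n) v = 0"
  shows "v = 0"
  using expansion[OF assms(1)] assms(2) by (metis (no_types, lifting) order_refl scale_zero_left sum.neutral)

text \<open>Positivity is a finite Parseval identity: \<open>ip v v\<close> is the sum of the
  squared moduli of the coefficients of \<open>v\<close>.\<close>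

lemma inner_product: "inner_product_on V ip"
  unfolding inner_product_on_def
proof (intro conjI ballI allI impI)
  fix v assume v: "v \<in> V" "v \<noteq> 0"
  obtain N where N: "\<And>K. K \<ge> N \<Longrightarrow> v = (\<Sum>n<K. ip (\<psi> n) v *c \<psi> n)" using expansion[OF v(1)] by blast
  obtain m where m: "ip (\<psi> m) v \<noteq> 0" using zero_if_coeffs_zero v by blast
  \<comment> \<open>Large enough both for the expansion to hold and for the non-zero coefficient
    \<open>m\<close> to occur in it.\<close>
  define K where "K = max N (Suc m)"
  have "ip v v = ip v (\<Sum>n<K. ip (\<psi> n) v *c \<psi> n)" using N[of K] by (simp add: K_def)
  also have "\<dots> = (\<Sum>n<K. ip (\<psi> n) v * cnj (ip (\<psi> n) v))"
    unfolding ip_sum_right[OF v(1)] using ip_sym[OF \<psi>_in_V v(1)] by simp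
  also have "\<dots> = complex_of_real (\<Sum>n<K. (cmod (ip (\<psi> n) v))\<^sup>2)"
    by (simp add: complex_norm_square[symmetric])
  finally have e: "ip v v = complex_of_real (\<Sum>n<K. (cmod (ip (\<psi> n) v))\<^sup>2)" .
  have "(\<Sum>n<K. (cmod (ip (\<psi> n) v))\<^sup>2) > 0"
    by (rule sum_pos2[of _ m]) (use m in \<open>auto simp: K_def\<close>)
  then show "Im (ip v v) = 0" "Re (ip v v) > 0" unfolding e by simp_all
next
  fix u v assume "u \<in> V" "v \<in> V"
  then show "ip v u = cnj (ip u v)" by (rule ip_sym)
qed (simp_all add: ip_add ip_scale)

lemma adjoint:
  assumes u: "u \<in> V" and v: "v \<in> V"
  shows "ip (Lp u) v = ip u (- Lm v)"
proof -
  have 1: "ip (Lp (\<psi> m)) (\<psi> n) = - ip (\<psi> m) (Lm (\<psi> n))" for m n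
  proof (cases n)
    case 0
    then show ?thesis using \<psi>_in_V by (simp add: Lp_\<psi> Lm_\<psi>_0 ip_scale_left orthonormal ip_zero_right)
  next
    case (Suc k)
    then show ?thesis using \<psi>_in_V
      by (simp add: Lp_\<psi> Lm_\<psi>_Suc ip_scale_left ip_scale orthonormal a_eq)
  qed
  have 2: "ip (Lp (\<psi> m)) v = - ip (\<psi> m) (Lm v)" for m
    using v by (induction rule: mode_induct) (use 1 \<psi>_in_V in \<open>simp_all add: ip_add ip_scale\<close>)
  have "ip (Lp u) v = - ip u (Lm v)"
    using u by (induction rule: mode_induct) (use 2 v in \<open>simp_all add: ip_add_left ip_scale_left\<close>)
  then show ?thesis using u v by simp
qed

lemma adjoint':
  assumes u: "u \<in> V" and v: "v \<in> V"
  shows "ip (Lm u) v = ip u (- Lp v)"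
proof -
  have "ip (Lm u) v = cnj (ip v (Lm u))" using u v by (intro ip_sym) auto
  also have "ip v (Lm u) = - ip v (- Lm u)" using ip_scale[of v "- Lm u" "-1"] u v by simp
  also have "ip v (- Lm u) = ip (Lp v) u" using adjoint u v by simp
  also have "cnj (- ip (Lp v) u) = - ip u (Lp v)" using ip_sym[of u "Lp v"] u v by simp
  also have "\<dots> = ip u (- Lp v)" using ip_scale[of u "Lp v" "-1"] u v by simp
  finally show ?thesis .
qed

lemma inj_\<psi>: "inj \<psi>"
  by (rule injI) (metis orthonormal zero_neq_one)

lemma \<psi>_nonzero: "\<psi> n \<noteq> 0"
proof
  assume "\<psi> n = 0"
  then show False using orthonormal[of n n] ip_zero_right[OF \<psi>_in_V[of n]] by simp
qed

text \<open>The span of the other modes lies in the kernel of the \<open>m\<close>-th coefficient,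
  on which \<open>\<psi> m\<close> itself takes the value \<open>1\<close>.\<close>

lemma independent_\<psi>: "independent (range \<psi>)"
proof
  assume "dependent (range \<psi>)"
  then obtain x where x: "x \<in> range \<psi>" "x \<in> span (range \<psi> - {x})" unfolding dependent_def by blast
  then obtain m where m: "x = \<psi> m" by blast
  have "span (range \<psi> - {x}) \<subseteq> {v \<in> V. ip (\<psi> m) v = 0}"
  proof (rule span_minimal)
    show "range \<psi> - {x} \<subseteq> {v \<in> V. ip (\<psi> m) v = 0}" using m \<psi>_in_V by (auto simp: orthonormal)
    show "subspace {v \<in> V. ip (\<psi> m) v = 0}"
      using \<psi>_in_V by (auto simp: subspace_def ip_add ip_scale ip_zero_right)
  qed
  then show False using x m orthonormal[of m m] by auto
qed

lemma unitary: "unitary_sl2_rep ip V L0 Lp Lm"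
  unfolding unitary_sl2_rep_def
proof (intro conjI)
  show "\<exists>B. independent B \<and> span B = V \<and> (\<forall>b\<in>B. \<exists>\<mu>. L0 b = \<mu> *c b) \<and>
      (\<forall>b\<in>B. \<forall>b'\<in>B. ip b b' = (if b = b' then 1 else 0))"
    by (rule exI[of _ "range \<psi>"]) (use independent_\<psi> inj_\<psi> in \<open>auto simp: V_def L0_\<psi> orthonormal inj_eq\<close>)
qed (use sl2 inner_product adjoint adjoint' in auto)

section \<open>Irreducibility and the eigenspaces of \<open>L0\<close>\<close>

lemma b_nonzero: "b n \<noteq> 0"
  using b_norm[of n] l_pos by (auto simp flip: of_real_add of_real_mult)

text \<open>No ladder coefficient vanishes. Lowering a non-zero vector as often as its top index
  leaves a non-zero multiple of \<open>\<psi> 0\<close>, and raising recovers every mode from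
  it.\<close>

lemma irreducible: "irreducible_sl2_rep V L0 Lp Lm"
  unfolding irreducible_sl2_rep_def
proof (intro conjI allI impI)
  show "V \<noteq> {0}" using \<psi>_in_V[of 0] \<psi>_nonzero[of 0] by auto
  fix W assume W: "subspace W \<and> W \<subseteq> V \<and> (\<forall>T\<in>{L0, Lp, Lm}. invariant_under T W)"
  show "W = {0} \<or> W = V"
  proof (cases "W = {0}")
    case False
    then obtain w where w: "w \<in> W" "w \<noteq> 0" using W subspace_0 by blast
    \<comment> \<open>The coefficients are arbitrary because each application of \<open>Lm\<close>
      shifts them and multiplies them by the \<open>b n\<close>; only the non-vanishing of the top
      one persists.\<close>
    have lower: "\<psi> 0 \<in> W" if "(\<Sum>n\<le>N. c n *c \<psi> n) \<in> W" "c N \<noteq> 0" for c N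
      using that
    proof (induction N arbitrary: c)
      case 0
      then have "inverse (c 0) *c c 0 *c \<psi> 0 \<in> W" using W by (intro subspace_scale[of W "_ *c _"]) auto
      then show ?case using 0 by simp
    next
      case (Suc N)
      have Lms: "Lm (\<Sum>n<K. c n *c \<psi> n) = (\<Sum>n<K. c n *c Lm (\<psi> n))" for K
      proof (induction K)
        case 0
        show ?case using linear_op_simps(6)[of 0 0] by simp
      qed (use \<psi>_in_V in simp)
      have "Lm (\<Sum>n\<le>Suc N. c n *c \<psi> n) = (\<Sum>n\<le>Suc N. c n *c Lm (\<psi> n))"
        using Lms[of "Suc (Suc N)"] by (simp only: lessThan_Suc_atMost)
      also have "\<dots> = (\<Sum>n\<le>N. (c (Suc n) * b n) *c \<psi> n)"
        by (simp add: sum.atMost_Suc_shift Lm_\<psi>_0 Lm_\<psi>_Suc del: sum.atMost_Suc)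
      finally have "(\<Sum>n\<le>N. (c (Suc n) * b n) *c \<psi> n) \<in> W"
        using W Suc.prems(1) by (metis insertCI invariant_under_def)
      then show ?case using Suc.IH[of "\<lambda>n. c (Suc n) * b n"] Suc.prems(2) b_nonzero by simp
    qed
    have "w \<in> V" using w W by blast
    then obtain N0 where N0: "\<And>K. K \<ge> N0 \<Longrightarrow> w = (\<Sum>n<K. ip (\<psi> n) w *c \<psi> n)" using expansion by blast
    \<comment> \<open>The shortest expansion of \<open>w\<close> is chosen, so that its last
      coefficient is non-zero.\<close>
    have "\<exists>N. w = (\<Sum>n<N. ip (\<psi> n) w *c \<psi> n)" using N0 by blast
    then obtain N where N: "w = (\<Sum>n<N. ip (\<psi> n) w *c \<psi> n)"
      and least: "\<And>K. K < N \<Longrightarrow> w \<noteq> (\<Sum>n<K. ip (\<psi> n) w *c \<psi> n)"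
      using exists_least_iff[of "\<lambda>N. w = (\<Sum>n<N. ip (\<psi> n) w *c \<psi> n)"] by blast
    have "N \<noteq> 0"
    proof
      assume "N = 0"
      with N have "w = 0" by simp
      then show False using w by simp
    qed
    then obtain N' where N': "N = Suc N'" by (cases N) auto
    have top: "ip (\<psi> N') w \<noteq> 0"
    proof
      assume "ip (\<psi> N') w = 0"
      then have "(\<Sum>n<N. ip (\<psi> n) w *c \<psi> n) = (\<Sum>n<N'. ip (\<psi> n) w *c \<psi> n)" unfolding N' by simp
      with N least[of N'] show False unfolding N' by simp
    qed
    have "(\<Sum>n\<le>N'. ip (\<psi> n) w *c \<psi> n) = w" using N unfolding N' lessThan_Suc_atMost by simp
    then have "(\<Sum>n\<le>N'. ip (\<psi> n) w *c \<psi> n) \<in> W" using w by simp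
    then have \<psi>0: "\<psi> 0 \<in> W" by (rule lower[where c = "\<lambda>n. ip (\<psi> n) w", OF _ top])
    have "\<psi> n \<in> W" for n
    proof (induction n)
      case (Suc n)
      have "a n *c \<psi> (Suc n) \<in> W" using W Suc by (metis Lp_\<psi> insertCI invariant_under_def)
      then have "inverse (a n) *c a n *c \<psi> (Suc n) \<in> W" using W by (intro subspace_scale[of W "_ *c _"]) auto
      then show ?case using b_nonzero[of n] by (simp add: a_eq)
    qed (rule \<psi>0)
    then have "V \<subseteq> W" unfolding V_def using W by (intro span_minimal) auto
    then show ?thesis using W by blast
  qed simp
qed (rule sl2)

lemma ip_L0: "v \<in> V \<Longrightarrow> ip (\<psi> n) (L0 v) = complex_of_real (l + real n) * ip (\<psi> n) v"
  by (induction rule: mode_induct)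
    (use \<psi>_in_V in \<open>auto simp: L0_\<psi> ip_scale ip_add orthonormal algebra_simps\<close>)

text \<open>\<open>L0\<close> multiplies the \<open>n\<close>-th coefficient by
  \<open>l + real n\<close>, so each non-zero coefficient of an eigenvector determines the
  eigenvalue. Both the spectrum and the multiplicities follow from this.\<close>

lemma eigenvector_coeff:
  assumes "v \<in> eigenspace_in V L0 \<mu>"
  shows "\<mu> = complex_of_real (l + real n) \<or> ip (\<psi> n) v = 0"
proof -
  have "v \<in> V" "L0 v = \<mu> *c v" using assms by (auto simp: eigenspace_in_def)
  then have "complex_of_real (l + real n) * ip (\<psi> n) v = \<mu> * ip (\<psi> n) v"
    using ip_L0[of v n] ip_scale[OF \<psi>_in_V[of n], of v \<mu>] by (simp only:)
  then show ?thesis by (metis mult_cancel_right)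
qed

lemma eigenspace: "eigenspace_in V L0 (complex_of_real (l + real n)) = span {\<psi> n}"
proof (intro equalityI subsetI)
  fix v assume v: "v \<in> eigenspace_in V L0 (complex_of_real (l + real n))"
  then have vV: "v \<in> V" by (simp add: eigenspace_in_def)
  have "v - ip (\<psi> n) v *c \<psi> n = 0"
  proof (rule zero_if_coeffs_zero)
    show "v - ip (\<psi> n) v *c \<psi> n \<in> V" using vV \<psi>_in_V by simp
    fix m
    have "ip (\<psi> m) (v + (- ip (\<psi> n) v) *c \<psi> n) = ip (\<psi> m) v + (- ip (\<psi> n) v) * ip (\<psi> m) (\<psi> n)"
      using vV \<psi>_in_V by (subst ip_add; simp add: ip_scale del: scale_minus_left)
    also have "\<dots> = 0"
      using eigenvector_coeff[OF v, of m] by (cases "m = n") (auto simp: orthonormal simp flip: of_real_add)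
    finally show "ip (\<psi> m) (v - ip (\<psi> n) v *c \<psi> n) = 0" by simp
  qed
  then show "v \<in> span {\<psi> n}" unfolding span_singleton by (metis eq_iff_diff_eq_0 rangeI)
next
  fix v assume "v \<in> span {\<psi> n}"
  then show "v \<in> eigenspace_in V L0 (complex_of_real (l + real n))"
    using \<psi>_in_V by (auto simp: span_singleton eigenspace_in_def L0_\<psi> mult.commute)
qed

lemma discrete_series: "discrete_series_plus l ip V L0 Lp Lm"
  unfolding discrete_series_plus_def
proof (intro conjI)
  show "{\<mu>. eigenspace_in V L0 \<mu> \<noteq> {0}} = {complex_of_real (l + real n) | n. True}"
  proof (intro equalityI subsetI)
    fix \<mu> assume "\<mu> \<in> {\<mu>. eigenspace_in V L0 \<mu> \<noteq> {0}}"
    moreover have "0 \<in> eigenspace_in V L0 \<mu>"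
      using linear_op_simps(2)[of 0 0] by (simp add: eigenspace_in_def)
    ultimately obtain v where v: "v \<in> eigenspace_in V L0 \<mu>" "v \<noteq> 0" by blast
    then obtain n where "ip (\<psi> n) v \<noteq> 0" using zero_if_coeffs_zero by (auto simp: eigenspace_in_def)
    then show "\<mu> \<in> {complex_of_real (l + real n) | n. True}" using eigenvector_coeff[OF v(1), of n] by auto
  next
    fix \<mu> assume "\<mu> \<in> {complex_of_real (l + real n) | n. True}"
    then obtain n where "\<mu> = complex_of_real (l + real n)" by blast
    then have "\<psi> n \<in> eigenspace_in V L0 \<mu>" using eigenspace[of n] by (auto intro: span_base)
    then show "\<mu> \<in> {\<mu>. eigenspace_in V L0 \<mu> \<noteq> {0}}" using \<psi>_nonzero[of n] by auto
  qed
  show "\<forall>n. dim (eigenspace_in V L0 (complex_of_real (l + real n))) = 1"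
    unfolding eigenspace using \<psi>_nonzero by (simp add: dim_eq_card_independent dependent_single)
  show "\<forall>v\<in>eigenspace_in V L0 (complex_of_real l). Lm v = 0"
    using eigenspace[of 0] \<psi>_in_V by (auto simp: span_singleton Lm_\<psi>_0)
qed (use l_pos unitary irreducible casimir_V in auto)

end

text \<open>The automorphism \<open>L\<^sub>0 \<mapsto> -L\<^sub>0\<close>, \<open>L\<^sub>\<plusminus> \<mapsto> L\<^sub>\<mp>\<close> exchanges the two series.\<close>

lemma (in complex_vector_space) discrete_series_minus_if_plus:
  assumes "discrete_series_plus l ip V (\<lambda>v. - L0 v) Lm Lp"
  shows "discrete_series_minus l ip V L0 Lp Lm"
proof -
  note d = assms[unfolded discrete_series_plus_def]
  have unit: "unitary_sl2_rep ip V (\<lambda>v. - L0 v) Lm Lp" using d by blast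
  have rep: "sl2_rep V (\<lambda>v. - L0 v) Lm Lp" using unit by (simp add: unitary_sl2_rep_def)
  have sub: "subspace V" using rep by (simp add: sl2_rep_def)
  have inv_iff: "invariant_under (\<lambda>v. - L0 v) W \<longleftrightarrow> invariant_under L0 W" if "subspace W" for W
    using subspace_neg[OF that] unfolding invariant_under_def by (metis minus_minus)
  have lin0: "linear_op_on V (\<lambda>v. - L0 v)" using rep by (simp add: sl2_rep_def)
  have lin: "linear_op_on V L0"
    unfolding linear_op_on_def
  proof (intro conjI ballI allI)
    fix u v assume "u \<in> V" "v \<in> V"
    then have "- L0 (u + v) = - L0 u + - L0 v" using lin0 unfolding linear_op_on_def by blast
    then have "- (- L0 (u + v)) = - (- L0 u + - L0 v)" by (rule arg_cong)
    then show "L0 (u + v) = L0 u + L0 v" by (simp add: add.commute)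
  next
    fix c v assume "v \<in> V"
    then have "- L0 (c *c v) = c *c (- L0 v)" using lin0 unfolding linear_op_on_def by blast
    then show "L0 (c *c v) = c *c L0 v" by simp
  qed
  have inV: "Lp v \<in> V" "Lm v \<in> V" "L0 v \<in> V" if "v \<in> V" for v
    using rep that inv_iff[OF sub] by (auto simp: sl2_rep_def invariant_under_def)
  have neg: "Lp (- v) = - Lp v" "Lm (- v) = - Lm v" if "v \<in> V" for v
  proof -
    have "linear_op_on V Lp" "linear_op_on V Lm" using rep by (auto simp: sl2_rep_def)
    then have "Lp ((- 1) *c v) = (- 1) *c Lp v" "Lm ((- 1) *c v) = (- 1) *c Lm v"
      using that unfolding linear_op_on_def by blast+
    then show "Lp (- v) = - Lp v" "Lm (- v) = - Lm v" by simp_all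
  qed
  have rep': "sl2_rep V L0 Lp Lm"
    unfolding sl2_rep_def
  proof (intro conjI ballI)
    show "subspace V" by (rule sub)
    show "invariant_under T V" "linear_op_on V T" if "T \<in> {L0, Lp, Lm}" for T
      using that rep inv_iff[OF sub] lin by (auto simp: sl2_rep_def)
    fix v assume v: "v \<in> V"
    have "- L0 (Lm v) - Lm (- L0 v) = Lm v" "- L0 (Lp v) - Lp (- L0 v) = - Lp v"
      "Lm (Lp v) - Lp (Lm v) = 2 *c (- L0 v)"
      using rep v unfolding sl2_rep_def by blast+
    then have "Lm (L0 v) - L0 (Lm v) = Lm v" "Lp (L0 v) - L0 (Lp v) = - Lp v"
      "Lm (Lp v) - Lp (Lm v) = - (2 *c L0 v)"
      using neg[OF inV(3)[OF v]] by simp_all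
    then show "L0 (Lp v) - Lp (L0 v) = Lp v" "L0 (Lm v) - Lm (L0 v) = - Lm v"
      "Lp (Lm v) - Lm (Lp v) = 2 *c L0 v" by (metis minus_diff_eq minus_minus)+
  qed
  have eig: "eigenspace_in V (\<lambda>v. - L0 v) \<mu> = eigenspace_in V L0 (- \<mu>)" for \<mu>
    unfolding eigenspace_in_def by (metis minus_minus scale_minus_left)
  have cas: "casimir L0 Lp Lm v = casimir (\<lambda>v. - L0 v) Lm Lp v" if "v \<in> V" for v
  proof -
    have "L0 ((- 1) *c L0 v) = (- 1) *c L0 (L0 v)" using lin inV(3)[OF that] unfolding linear_op_on_def by blast
    then show ?thesis by (simp add: casimir_def add.commute)
  qed
  show ?thesis
    unfolding discrete_series_minus_def
  proof (intro conjI)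
    show "unitary_sl2_rep ip V L0 Lp Lm"
      unfolding unitary_sl2_rep_def
    proof (intro conjI)
      obtain B where B: "independent B" "span B = V" "\<forall>b\<in>B. \<exists>\<mu>. - L0 b = \<mu> *c b"
          "\<forall>b\<in>B. \<forall>b'\<in>B. ip b b' = (if b = b' then 1 else 0)"
        using unit unfolding unitary_sl2_rep_def by blast
      have "\<exists>\<mu>. L0 b = \<mu> *c b" if "b \<in> B" for b
        using B(3) that by (metis minus_minus scale_minus_left)
      then show "\<exists>B. independent B \<and> span B = V \<and> (\<forall>b\<in>B. \<exists>\<mu>. L0 b = \<mu> *c b) \<and>
        (\<forall>b\<in>B. \<forall>b'\<in>B. ip b b' = (if b = b' then 1 else 0))" using B by blast
    qed (use unit rep' in \<open>auto simp: unitary_sl2_rep_def\<close>)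
    show "irreducible_sl2_rep V L0 Lp Lm"
      unfolding irreducible_sl2_rep_def
    proof (intro conjI allI impI)
      have irr: "irreducible_sl2_rep V (\<lambda>v. - L0 v) Lm Lp" using d by blast
      then show "V \<noteq> {0}" by (simp add: irreducible_sl2_rep_def)
      fix W assume W: "subspace W \<and> W \<subseteq> V \<and> (\<forall>T\<in>{L0, Lp, Lm}. invariant_under T W)"
      then have "subspace W \<and> W \<subseteq> V \<and> (\<forall>T\<in>{\<lambda>v. - L0 v, Lm, Lp}. invariant_under T W)"
        using inv_iff by auto
      then show "W = {0} \<or> W = V" using irr unfolding irreducible_sl2_rep_def by blast
    qed (rule rep')
    have e: "{\<mu>. eigenspace_in V L0 (- \<mu>) \<noteq> {0}} = {complex_of_real (l + real n) | n. True}"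
      using d unfolding eig by blast
    show "{\<mu>. eigenspace_in V L0 \<mu> \<noteq> {0}} = {complex_of_real (- (l + real n)) | n. True}"
    proof (rule set_eqI)
      fix \<mu>
      have "\<mu> \<in> {\<mu>. eigenspace_in V L0 \<mu> \<noteq> {0}} \<longleftrightarrow> - \<mu> \<in> {\<mu>. eigenspace_in V L0 (- \<mu>) \<noteq> {0}}" by simp
      also have "\<dots> \<longleftrightarrow> (\<exists>n. - \<mu> = complex_of_real (l + real n))" unfolding e by simp
      also have "\<dots> \<longleftrightarrow> (\<exists>n. \<mu> = complex_of_real (- (l + real n)))"
        unfolding of_real_minus by (metis minus_equation_iff)
      finally show "\<mu> \<in> {\<mu>. eigenspace_in V L0 \<mu> \<noteq> {0}} \<longleftrightarrow>
          \<mu> \<in> {complex_of_real (- (l + real n)) | n. True}" by simp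
    qed
    show "\<forall>n. dim (eigenspace_in V L0 (complex_of_real (- (l + real n)))) = 1"
      using d unfolding eig of_real_minus by blast
    show "\<forall>v\<in>V. casimir L0 Lp Lm v = complex_of_real (l * (l - 1)) *c v" using d cas by auto
    show "\<forall>v\<in>eigenspace_in V L0 (complex_of_real (- l)). Lp v = 0"
      using d unfolding eig of_real_minus by blast
  qed (use d in blast)
qed


section \<open>Spinors\<close>

lemma has_vector_derivative_vec_iff:
  fixes F :: "real \<Rightarrow> 'a::real_normed_vector ^ 'n"
  shows "(F has_vector_derivative D) (at x) \<longleftrightarrow> (\<forall>i. ((\<lambda>r. F r $ i) has_vector_derivative D $ i) (at x))"
proof
  assume "(F has_vector_derivative D) (at x)"
  then show "\<forall>i. ((\<lambda>r. F r $ i) has_vector_derivative D $ i) (at x)"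
    using bounded_linear.has_vector_derivative[OF bounded_linear_vec_nth] by blast
next
  assume "\<forall>i. ((\<lambda>r. F r $ i) has_vector_derivative D $ i) (at x)"
  then show "(F has_vector_derivative D) (at x)"
    by (simp add: has_vector_derivative_def has_derivative_def bounded_linear_scaleR_left vec_tendstoI)
qed

text \<open>The coefficients of the operator and the frequency are real, so real and imaginary parts
  decouple. Differentiability accompanies the equation because \<open>vector_derivative\<close> is a
  total function and is the derivative only where one exists.\<close>

lemma dirac_solution_iff_radial:
  "dirac_solution M \<omega> \<Phi> \<longleftrightarrow>
     radial_system M \<omega> (\<lambda>\<rho>. Re (\<Phi> \<rho> $ 1)) (\<lambda>\<rho>. Re (\<Phi> \<rho> $ 2)) \<and>
     radial_system M \<omega> (\<lambda>\<rho>. Im (\<Phi> \<rho> $ 1)) (\<lambda>\<rho>. Im (\<Phi> \<rho> $ 2))"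
proof -
  have "\<Phi> differentiable (at \<rho>) \<and> dirac_op M \<Phi> \<rho> = complex_of_real \<omega> *s \<Phi> \<rho> \<longleftrightarrow>
      ((\<lambda>r. \<Phi> r $ 1) has_vector_derivative
        complex_of_real \<omega> * \<Phi> \<rho> $ 2 - complex_of_real (M / cos \<rho>) * \<Phi> \<rho> $ 1) (at \<rho>) \<and>
      ((\<lambda>r. \<Phi> r $ 2) has_vector_derivative
        complex_of_real (M / cos \<rho>) * \<Phi> \<rho> $ 2 - complex_of_real \<omega> * \<Phi> \<rho> $ 1) (at \<rho>)"
    (is "?A \<longleftrightarrow> ?B1 \<and> ?B2") for \<rho>
  proof
    assume A: ?A
    then obtain D where D: "(\<Phi> has_vector_derivative D) (at \<rho>)"
      using vector_derivative_works by blast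
    then have c: "((\<lambda>r. \<Phi> r $ i) has_vector_derivative D $ i) (at \<rho>)" for i
      using has_vector_derivative_vec_iff by blast
    have "dirac_op M \<Phi> \<rho> $ 1 = complex_of_real \<omega> * \<Phi> \<rho> $ 1" "dirac_op M \<Phi> \<rho> $ 2 = complex_of_real \<omega> * \<Phi> \<rho> $ 2"
      using A by auto
    then have "- D $ 2 + complex_of_real (M / cos \<rho>) * \<Phi> \<rho> $ 2 = complex_of_real \<omega> * \<Phi> \<rho> $ 1"
      "D $ 1 + complex_of_real (M / cos \<rho>) * \<Phi> \<rho> $ 1 = complex_of_real \<omega> * \<Phi> \<rho> $ 2"
      unfolding dirac_op_def vector_derivative_at[OF c] by simp_all
    then have "D $ 2 = complex_of_real (M / cos \<rho>) * \<Phi> \<rho> $ 2 - complex_of_real \<omega> * \<Phi> \<rho> $ 1"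
      "D $ 1 = complex_of_real \<omega> * \<Phi> \<rho> $ 2 - complex_of_real (M / cos \<rho>) * \<Phi> \<rho> $ 1"
      by (metis add.commute add_diff_cancel diff_minus_eq_add minus_diff_eq)+
    then show "?B1 \<and> ?B2" using c[of 1] c[of 2] by simp
  next
    assume B: "?B1 \<and> ?B2"
    then have "(\<Phi> has_vector_derivative vector
        [complex_of_real \<omega> * \<Phi> \<rho> $ 2 - complex_of_real (M / cos \<rho>) * \<Phi> \<rho> $ 1,
         complex_of_real (M / cos \<rho>) * \<Phi> \<rho> $ 2 - complex_of_real \<omega> * \<Phi> \<rho> $ 1]) (at \<rho>)"
      unfolding has_vector_derivative_vec_iff forall_2 vector_2 .
    moreover have "dirac_op M \<Phi> \<rho> = complex_of_real \<omega> *s \<Phi> \<rho>"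
      unfolding dirac_op_def vec_eq_iff forall_2 vector_2
        vector_derivative_at[OF conjunct1[OF B]] vector_derivative_at[OF conjunct2[OF B]] by simp
    ultimately show ?A by (auto intro: differentiableI_vector)
  qed
  then show ?thesis
    unfolding dirac_solution_def radial_system_def has_vector_derivative_complex_iff
    by (auto simp del: of_real_divide)
qed

lemma norm_vec2_squared:
  "(norm (x :: complex^2))\<^sup>2 = ((Re (x $ 1))\<^sup>2 + (Re (x $ 2))\<^sup>2) + ((Im (x $ 1))\<^sup>2 + (Im (x $ 2))\<^sup>2)"
  by (simp add: norm_vec_def L2_set_def sum_2 cmod_power2)

text \<open>The squared norm splits into the non-negative densities of the real and the imaginary
  part; each is dominated by the sum, so integrability can be tested separately. Measurability is
  automatic for differentiable functions.\<close>

lemma square_integrable_iff_vanishing: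
  assumes sol: "dirac_solution M \<omega> \<Phi>" and M: "M \<ge> 1 / 2"
  shows "square_integrable \<Phi> \<longleftrightarrow>
     vanishing (\<lambda>\<rho>. Re (\<Phi> \<rho> $ 1)) (\<lambda>\<rho>. Re (\<Phi> \<rho> $ 2)) \<and>
     vanishing (\<lambda>\<rho>. Im (\<Phi> \<rho> $ 1)) (\<lambda>\<rho>. Im (\<Phi> \<rho> $ 2))"
proof -
  have sys: "radial_system M \<omega> (\<lambda>\<rho>. Re (\<Phi> \<rho> $ 1)) (\<lambda>\<rho>. Re (\<Phi> \<rho> $ 2))"
    "radial_system M \<omega> (\<lambda>\<rho>. Im (\<Phi> \<rho> $ 1)) (\<lambda>\<rho>. Im (\<Phi> \<rho> $ 2))"
    using sol by (simp_all add: dirac_solution_iff_radial)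
  define ER where "ER = (\<lambda>\<rho>. (Re (\<Phi> \<rho> $ 1))\<^sup>2 + (Re (\<Phi> \<rho> $ 2))\<^sup>2)"
  define EI where "EI = (\<lambda>\<rho>. (Im (\<Phi> \<rho> $ 1))\<^sup>2 + (Im (\<Phi> \<rho> $ 2))\<^sup>2)"
  have "\<Phi> differentiable (at \<rho>)" if "\<rho> \<in> rho_interval" for \<rho>
    using sol that by (auto simp: dirac_solution_def)
  then have "continuous_on rho_interval \<Phi>"
    by (meson continuous_at_imp_continuous_on differentiable_imp_continuous_within)
  then have meas: "set_borel_measurable lborel rho_interval \<Phi>"
    using borel_measurable_continuous_on_indicator[of rho_interval \<Phi>]
    by (simp add: set_borel_measurable_def rho_interval_def)
  have "continuous_on rho_interval ER" "continuous_on rho_interval EI"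
    unfolding ER_def EI_def
    by (intro continuous_intros radial_system_continuous[OF sys(1)] radial_system_continuous[OF sys(2)])+
  then have measE: "set_borel_measurable lborel rho_interval ER" "set_borel_measurable lborel rho_interval EI"
    using borel_measurable_continuous_on_indicator[of rho_interval ER]
      borel_measurable_continuous_on_indicator[of rho_interval EI]
    by (simp_all add: set_borel_measurable_def rho_interval_def)
  have nonneg: "ER \<rho> \<ge> 0" "EI \<rho> \<ge> 0" for \<rho> by (simp_all add: ER_def EI_def)
  have norm: "(norm (\<Phi> \<rho>))\<^sup>2 = ER \<rho> + EI \<rho>" for \<rho> by (simp add: norm_vec2_squared ER_def EI_def)
  have "set_integrable lborel rho_interval (\<lambda>\<rho>. ER \<rho> + EI \<rho>) \<longleftrightarrow>
      set_integrable lborel rho_interval ER \<and> set_integrable lborel rho_interval EI"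
  proof
    assume i: "set_integrable lborel rho_interval (\<lambda>\<rho>. ER \<rho> + EI \<rho>)"
    show "set_integrable lborel rho_interval ER \<and> set_integrable lborel rho_interval EI"
      by (intro conjI set_integrable_bound[OF i] measE) (use nonneg in auto)
  qed auto
  then show ?thesis
    unfolding square_integrable_def norm using meas
      radial_integrable_iff_vanishing[OF sys(1) M] radial_integrable_iff_vanishing[OF sys(2) M]
    by (simp add: ER_def EI_def)
qed

lemma dirichlet_I_iff_vanishing:
  assumes sol: "dirac_solution M \<omega> \<Phi>" and M: "M > 0"
  shows "dirichlet_I M \<Phi> \<longleftrightarrow>
     vanishing (\<lambda>\<rho>. Re (\<Phi> \<rho> $ 1)) (\<lambda>\<rho>. Re (\<Phi> \<rho> $ 2)) \<and>
     vanishing (\<lambda>\<rho>. Im (\<Phi> \<rho> $ 1)) (\<lambda>\<rho>. Im (\<Phi> \<rho> $ 2))"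
proof -
  have sys: "radial_system M \<omega> (\<lambda>\<rho>. Re (\<Phi> \<rho> $ 1)) (\<lambda>\<rho>. Re (\<Phi> \<rho> $ 2))"
    "radial_system M \<omega> (\<lambda>\<rho>. Im (\<Phi> \<rho> $ 1)) (\<lambda>\<rho>. Im (\<Phi> \<rho> $ 2))"
    using sol by (simp_all add: dirac_solution_iff_radial)
  show ?thesis
    unfolding dirichlet_I_def tilde1_def[abs_def] tilde2_def[abs_def] tendsto_complex_iff
      radial_dirichlet_iff_vanishing[OF sys(1) M, symmetric] radial_dirichlet_iff_vanishing[OF sys(2) M, symmetric]
    by auto
qed

section \<open>Stationary spinors with real profiles and the action of the operators on them\<close>

definition stationary :: "real \<Rightarrow> (real \<Rightarrow> real) \<Rightarrow> (real \<Rightarrow> real) \<Rightarrow> spinor" where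
  "stationary \<omega> f g = with_time \<omega> (\<lambda>\<rho>. vector [complex_of_real (f \<rho>), complex_of_real (g \<rho>)])"

lemma with_time_cong: "(\<And>\<rho>. \<rho> \<in> rho_interval \<Longrightarrow> \<Phi> \<rho> = \<Phi>' \<rho>) \<Longrightarrow> with_time \<omega> \<Phi> = with_time \<omega> \<Phi>'"
  by (auto simp: with_time_def on_strip_def fun_eq_iff)

lemma with_time_scale: "with_time \<omega> (\<lambda>\<rho>. c *s \<Phi> \<rho>) = spinor_scale c (with_time \<omega> \<Phi>)"
  by (auto simp: with_time_def on_strip_def spinor_scale_def fun_eq_iff vec_eq_iff)

lemma stationary_cong:
  assumes "\<And>\<rho>. \<rho> \<in> rho_interval \<Longrightarrow> f \<rho> = f' \<rho>" "\<And>\<rho>. \<rho> \<in> rho_interval \<Longrightarrow> g \<rho> = g' \<rho>"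
  shows "stationary \<omega> f g = stationary \<omega> f' g'"
  unfolding stationary_def by (rule with_time_cong) (simp add: assms)

lemma stationary_scale:
  "stationary \<omega> (\<lambda>\<rho>. c * f \<rho>) (\<lambda>\<rho>. c * g \<rho>) = spinor_scale (complex_of_real c) (stationary \<omega> f g)"
  unfolding stationary_def with_time_scale[symmetric]
  by (rule with_time_cong) (simp add: vec_eq_iff forall_2)

lemma stationary_component:
  assumes "\<rho> \<in> rho_interval"
  shows "stationary \<omega> f g t \<rho> $ 1 = exp (- \<i> * complex_of_real (\<omega> * t)) * complex_of_real (f \<rho>)"
    "stationary \<omega> f g t \<rho> $ 2 = exp (- \<i> * complex_of_real (\<omega> * t)) * complex_of_real (g \<rho>)"
  using assms by (simp_all add: stationary_def with_time_def on_strip_def)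

lemma Psi_eq_stationary:
  "Psi s M n = spinor_scale (complex_of_real (norm_const M n))
     (stationary (s * omega M n) (mode1 M n) (\<lambda>\<rho>. s * mode2 M n \<rho>))"
  unfolding Psi_def stationary_def with_time_scale[symmetric]
  by (rule with_time_cong) (simp add: vec_eq_iff forall_2 mode1_def mode2_def)

lemma stationary_d_t:
  assumes r: "\<rho> \<in> rho_interval"
  shows "((\<lambda>u. stationary \<omega> f g u \<rho>) has_vector_derivative
      (- \<i> * complex_of_real \<omega>) *s stationary \<omega> f g t \<rho>) (at t)"
proof -
  have "((\<lambda>u. exp (- \<i> * complex_of_real (\<omega> * u)) * c) has_vector_derivative
      (- \<i> * complex_of_real \<omega>) * (exp (- \<i> * complex_of_real (\<omega> * t)) * c)) (at t)" for c
  proof -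
    have "((\<lambda>z. exp (- \<i> * (complex_of_real \<omega> * z)) * c) has_field_derivative
       (- \<i> * complex_of_real \<omega>) * (exp (- \<i> * (complex_of_real \<omega> * complex_of_real t)) * c)) (at (complex_of_real t))"
      by (auto intro!: derivative_eq_intros)
    from has_vector_derivative_real_field[OF this] show ?thesis by simp
  qed
  then show ?thesis
    unfolding has_vector_derivative_vec_iff forall_2
    by (simp add: stationary_component[OF r])
qed

lemma stationary_d_rho:
  assumes r: "\<rho> \<in> rho_interval" and f: "(f has_real_derivative f') (at \<rho>)" and g: "(g has_real_derivative g') (at \<rho>)"
  shows "((\<lambda>r. stationary \<omega> f g t r) has_vector_derivative
      exp (- \<i> * complex_of_real (\<omega> * t)) *s vector [complex_of_real f', complex_of_real g']) (at \<rho>)"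
proof -
  have "((\<lambda>r. exp (- \<i> * complex_of_real (\<omega> * t)) * complex_of_real (h r)) has_vector_derivative
      exp (- \<i> * complex_of_real (\<omega> * t)) * complex_of_real h') (at \<rho>)"
    if "(h has_real_derivative h') (at \<rho>)" for h h'
    using that by (intro has_vector_derivative_mult_right has_vector_derivative_of_real)
      (simp add: has_real_derivative_iff_has_vector_derivative)
  note d = this[OF f] this[OF g]
  have "((\<lambda>r. stationary \<omega> f g t r $ 1) has_vector_derivative
      exp (- \<i> * complex_of_real (\<omega> * t)) * complex_of_real f') (at \<rho>)"
    by (rule has_vector_derivative_transform_within_open[OF d(1) rho_interval_open r])
      (simp add: stationary_component)
  moreover have "((\<lambda>r. stationary \<omega> f g t r $ 2) has_vector_derivative
      exp (- \<i> * complex_of_real (\<omega> * t)) * complex_of_real g') (at \<rho>)"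
    by (rule has_vector_derivative_transform_within_open[OF d(2) rho_interval_open r])
      (simp add: stationary_component)
  ultimately show ?thesis
    unfolding has_vector_derivative_vec_iff forall_2 by simp
qed

lemma Sigma01_mult:
  "(Sigma01 *v x) $ 1 = \<i> / 2 * x $ 2" "(Sigma01 *v x) $ 2 = - \<i> / 2 * x $ 1"
  by (simp_all add: Sigma01_def matrix_vector_mult_def sum_2 scaleR_conv_of_real[where 'a = complex])

lemma L_zero_stationary: "L_zero (stationary \<omega> f g) = spinor_scale (complex_of_real \<omega>) (stationary \<omega> f g)"
proof (intro ext)
  fix t \<rho>
  show "L_zero (stationary \<omega> f g) t \<rho> = spinor_scale (complex_of_real \<omega>) (stationary \<omega> f g) t \<rho>"
  proof (cases "\<rho> \<in> rho_interval")
    case True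
    then show ?thesis
      using vector_derivative_at[OF stationary_d_t[OF True, of \<omega> f g t]]
      by (simp add: L_zero_def on_strip_def d_t_def spinor_scale_def vec_eq_iff mult.assoc complex_i_mult_minus)
  qed (simp add: L_zero_def on_strip_def spinor_scale_def stationary_def with_time_def vec_eq_iff)
qed

text \<open>The spatial part of \<open>-\<i> L\<^sub>+\<close>, again with the derivatives eliminated.\<close>

definition raise1 :: "real \<Rightarrow> real \<Rightarrow> (real \<Rightarrow> real) \<Rightarrow> (real \<Rightarrow> real) \<Rightarrow> real \<Rightarrow> real" where
  "raise1 M \<omega> f g \<rho> = - ((\<omega> + 1 / 2) * sin \<rho> + M) * f \<rho> + (\<omega> + 1 / 2) * cos \<rho> * g \<rho>"

definition raise2 :: "real \<Rightarrow> real \<Rightarrow> (real \<Rightarrow> real) \<Rightarrow> (real \<Rightarrow> real) \<Rightarrow> real \<Rightarrow> real" where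
  "raise2 M \<omega> f g \<rho> = (M - (\<omega> + 1 / 2) * sin \<rho>) * g \<rho> - (\<omega> + 1 / 2) * cos \<rho> * f \<rho>"

lemma exp_shift:
  "exp (\<i> * complex_of_real t) * exp (- \<i> * complex_of_real (\<omega> * t)) = exp (- \<i> * complex_of_real ((\<omega> - 1) * t))"
  "exp (- \<i> * complex_of_real t) * exp (- \<i> * complex_of_real (\<omega> * t)) = exp (- \<i> * complex_of_real ((\<omega> + 1) * t))"
  by (simp_all add: algebra_simps flip: exp_add)

text \<open>The derivative in \<open>t\<close> contributes \<open>\<omega>\<close>, and the terms
  \<open>\<i> / 2 * sin \<rho>\<close> and \<open>Sigma01\<close> shift it by \<open>1 / 2\<close>
  in the sine and the cosine coefficients respectively. The time factor of the operator moves the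
  frequency by one.\<close>

lemma
  assumes sys: "radial_system M \<omega> f g"
  shows L_minus_stationary: "L_minus (stationary \<omega> f g) =
      spinor_scale (- \<i>) (stationary (\<omega> - 1) (lower1 M \<omega> f g) (lower2 M \<omega> f g))"
    and L_plus_stationary: "L_plus (stationary \<omega> f g) =
      spinor_scale \<i> (stationary (\<omega> + 1) (raise1 M \<omega> f g) (raise2 M \<omega> f g))"
proof -
  have "L_minus (stationary \<omega> f g) t \<rho> =
      spinor_scale (- \<i>) (stationary (\<omega> - 1) (lower1 M \<omega> f g) (lower2 M \<omega> f g)) t \<rho> \<and>
    L_plus (stationary \<omega> f g) t \<rho> =
      spinor_scale \<i> (stationary (\<omega> + 1) (raise1 M \<omega> f g) (raise2 M \<omega> f g)) t \<rho>" for t \<rho>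
  proof (cases "\<rho> \<in> rho_interval")
    case r: True
    \<comment> \<open>The singular terms of the eliminated derivatives are met by the factor
      \<open>cos \<rho>\<close> in front of \<open>d_rho\<close>, which turns them into
      \<open>M\<close>.\<close>
    define d where "d = M / cos \<rho>"
    have dc: "d * cos \<rho> = M" using cos_pos_rho[OF r] by (simp add: d_def)
    have d: "(f has_real_derivative (\<omega> * g \<rho> - d * f \<rho>)) (at \<rho>)"
       "(g has_real_derivative (d * g \<rho> - \<omega> * f \<rho>)) (at \<rho>)"
      using sys r unfolding radial_system_def d_def by blast+
    define E where "E = exp (- \<i> * complex_of_real (\<omega> * t))"
    have dt: "d_t (stationary \<omega> f g) t \<rho> = (- \<i> * complex_of_real \<omega>) *s stationary \<omega> f g t \<rho>"
      unfolding d_t_def by (rule vector_derivative_at[OF stationary_d_t[OF r]])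
    have dr: "d_rho (stationary \<omega> f g) t \<rho> = E *s vector
        [complex_of_real (\<omega> * g \<rho> - d * f \<rho>), complex_of_real (d * g \<rho> - \<omega> * f \<rho>)]"
      unfolding d_rho_def E_def by (rule vector_derivative_at[OF stationary_d_rho[OF r d]])
    define S where "S = exp (\<i> * complex_of_real t)"
    define S' where "S' = exp (- \<i> * complex_of_real t)"
    note sh = exp_shift[of t \<omega>, folded S_def S'_def E_def, symmetric]
    note st = stationary_component[OF r, of \<omega> f g t, folded E_def]
    show ?thesis
      unfolding L_minus_def L_plus_def on_strip_def spinor_scale_def vec_eq_iff forall_2 if_P[OF r] dt dr
        vector_smult_component vector_add_component vector_minus_component vector_uminus_component
        stationary_component[OF r] sh E_def[symmetric] S_def[symmetric] S'_def[symmetric]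
        Sigma01_mult vector_2 lower1_def lower2_def raise1_def raise2_def
      by (simp add: algebra_simps flip: dc)
  qed (simp add: L_minus_def L_plus_def on_strip_def spinor_scale_def stationary_def with_time_def vec_eq_iff)
  then show "L_minus (stationary \<omega> f g) =
      spinor_scale (- \<i>) (stationary (\<omega> - 1) (lower1 M \<omega> f g) (lower2 M \<omega> f g))"
    "L_plus (stationary \<omega> f g) =
      spinor_scale \<i> (stationary (\<omega> + 1) (raise1 M \<omega> f g) (raise2 M \<omega> f g))" by blast+
qed

text \<open>A common domain for the analysis: differentiability in each variable makes the total
  functions \<open>d_t\<close> and \<open>d_rho\<close> linear, and decay makes the inner products
  integrable. It is a subspace, hence contains the spans of the modes.\<close>

definition regular_spinor :: "spinor \<Rightarrow> bool" where
  "regular_spinor \<Psi> \<longleftrightarrow> (\<forall>t.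
     (\<forall>\<rho>\<in>rho_interval. (\<lambda>u. \<Psi> u \<rho>) differentiable (at t) \<and> (\<lambda>r. \<Psi> t r) differentiable (at \<rho>)) \<and>
     (\<forall>i. ((\<lambda>\<rho>. \<Psi> t \<rho> $ i) \<longlongrightarrow> 0) (at_left (pi / 2)) \<and> ((\<lambda>\<rho>. \<Psi> t \<rho> $ i) \<longlongrightarrow> 0) (at_right (- pi / 2))))"

lemma spinor_scale_apply: "spinor_scale c \<Psi> t \<rho> = c *s \<Psi> t \<rho>"
  by (simp add: spinor_scale_def)

lemma has_vector_derivative_smult:
  assumes "(F has_vector_derivative D) (at x)"
  shows "((\<lambda>r. (c :: complex) *s F r) has_vector_derivative c *s D) (at x)"
  using assms unfolding has_vector_derivative_vec_iff by (auto intro!: has_vector_derivative_mult_right)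

lemma differentiable_smult:
  "F differentiable (at x) \<Longrightarrow> (\<lambda>r::real. (c :: complex) *s F r) differentiable (at x)"
  using has_vector_derivative_smult by (metis differentiableI_vector vector_derivative_works)

lemma subspace_regular: "spinors.subspace {\<Psi>. regular_spinor \<Psi>}"
proof (rule spinors.subspaceI)
  show "0 \<in> {\<Psi>. regular_spinor \<Psi>}" by (simp add: regular_spinor_def zero_fun_def)
  show "u + v \<in> {\<Psi>. regular_spinor \<Psi>}" if "u \<in> {\<Psi>. regular_spinor \<Psi>}" "v \<in> {\<Psi>. regular_spinor \<Psi>}" for u v
    using that by (auto simp: regular_spinor_def plus_fun_def intro!: derivative_intros tendsto_add_zero)
  show "spinor_scale c u \<in> {\<Psi>. regular_spinor \<Psi>}" if "u \<in> {\<Psi>. regular_spinor \<Psi>}" for u c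
    using that by (auto simp: regular_spinor_def spinor_scale_def intro!: differentiable_smult tendsto_mult_right_zero)
qed

lemma regular_stationary:
  assumes sys: "radial_system M \<omega> f g" and van: "vanishing f g"
  shows "regular_spinor (stationary \<omega> f g)"
  unfolding regular_spinor_def forall_2
proof (intro allI conjI ballI)
  fix t \<rho> assume r: "\<rho> \<in> rho_interval"
  show "(\<lambda>u. stationary \<omega> f g u \<rho>) differentiable (at t)"
    by (rule differentiableI_vector[OF stationary_d_t[OF r]])
  show "(\<lambda>r. stationary \<omega> f g t r) differentiable (at \<rho>)"
    using sys r stationary_d_rho[OF r] unfolding radial_system_def by (meson differentiableI_vector)
next
  fix t
  have lim: "((\<lambda>\<rho>. exp (- \<i> * complex_of_real (\<omega> * t)) * complex_of_real (h \<rho>)) \<longlongrightarrow> 0) F"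
    if "(h \<longlongrightarrow> 0) F" for h F
    using tendsto_of_real[OF that] by (intro tendsto_mult_right_zero) simp
  show "((\<lambda>\<rho>. stationary \<omega> f g t \<rho> $ 1) \<longlongrightarrow> 0) (at_left (pi / 2))"
    by (rule Lim_transform_eventually[OF lim[OF vanishingD(1)[OF van]]], use eventually_in_rho_left in eventually_elim)
      (simp only: stationary_component)
  show "((\<lambda>\<rho>. stationary \<omega> f g t \<rho> $ 2) \<longlongrightarrow> 0) (at_left (pi / 2))"
    by (rule Lim_transform_eventually[OF lim[OF vanishingD(2)[OF van]]], use eventually_in_rho_left in eventually_elim)
      (simp only: stationary_component)
  show "((\<lambda>\<rho>. stationary \<omega> f g t \<rho> $ 1) \<longlongrightarrow> 0) (at_right (- pi / 2))"
    by (rule Lim_transform_eventually[OF lim[OF vanishingD(3)[OF van]]], use eventually_in_rho_right in eventually_elim)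
      (simp only: stationary_component)
  show "((\<lambda>\<rho>. stationary \<omega> f g t \<rho> $ 2) \<longlongrightarrow> 0) (at_right (- pi / 2))"
    by (rule Lim_transform_eventually[OF lim[OF vanishingD(4)[OF van]]], use eventually_in_rho_right in eventually_elim)
      (simp only: stationary_component)
qed

lemma
  assumes "regular_spinor u" "\<rho> \<in> rho_interval"
  shows d_t_scale: "d_t (spinor_scale c u) t \<rho> = c *s d_t u t \<rho>"
    and d_rho_scale: "d_rho (spinor_scale c u) t \<rho> = c *s d_rho u t \<rho>"
proof -
  have "((\<lambda>x. u x \<rho>) has_vector_derivative d_t u t \<rho>) (at t)"
    "((\<lambda>r. u t r) has_vector_derivative d_rho u t \<rho>) (at \<rho>)"
    using assms unfolding regular_spinor_def d_t_def d_rho_def vector_derivative_works[symmetric] by blast+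
  from this[THEN has_vector_derivative_smult, THEN vector_derivative_at]
  show "d_t (spinor_scale c u) t \<rho> = c *s d_t u t \<rho>" "d_rho (spinor_scale c u) t \<rho> = c *s d_rho u t \<rho>"
    unfolding spinor_scale_def d_t_def d_rho_def by blast+
qed

lemma
  assumes "regular_spinor u" "regular_spinor v" "\<rho> \<in> rho_interval"
  shows d_t_add: "d_t (u + v) t \<rho> = d_t u t \<rho> + d_t v t \<rho>"
    and d_rho_add: "d_rho (u + v) t \<rho> = d_rho u t \<rho> + d_rho v t \<rho>"
proof -
  have "(\<lambda>x. u x \<rho>) differentiable (at t)" "(\<lambda>r. u t r) differentiable (at \<rho>)"
    "(\<lambda>x. v x \<rho>) differentiable (at t)" "(\<lambda>r. v t r) differentiable (at \<rho>)"
    using assms unfolding regular_spinor_def by blast+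
  then show "d_t (u + v) t \<rho> = d_t u t \<rho> + d_t v t \<rho>" "d_rho (u + v) t \<rho> = d_rho u t \<rho> + d_rho v t \<rho>"
    unfolding d_t_def d_rho_def plus_fun_apply by (simp_all add: plus_fun_def)
qed

lemma linear_L:
  assumes V: "V \<subseteq> {\<Psi>. regular_spinor \<Psi>}" and T: "T \<in> {L_zero, L_plus, L_minus}"
  shows "spinors.linear_op_on V T"
  unfolding spinors.linear_op_on_def
proof (intro conjI ballI allI)
  fix u v assume "u \<in> V" "v \<in> V"
  then have reg: "regular_spinor u" "regular_spinor v" using V by auto
  show "T (u + v) = T u + T v"
  proof (intro ext)
    fix t \<rho>
    show "T (u + v) t \<rho> = (T u + T v) t \<rho>"
    proof (cases "\<rho> \<in> rho_interval")
      case r: True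
      then show ?thesis using T
        by (auto simp: L_zero_def L_plus_def L_minus_def on_strip_def d_t_add[OF reg r] d_rho_add[OF reg r]
            vec_eq_iff forall_2 Sigma01_mult algebra_simps)
    qed (use T in \<open>auto simp: L_zero_def L_plus_def L_minus_def on_strip_def\<close>)
  qed
next
  fix c u assume "u \<in> V"
  then have reg: "regular_spinor u" using V by auto
  show "T (spinor_scale c u) = spinor_scale c (T u)"
  proof (intro ext)
    fix t \<rho>
    show "T (spinor_scale c u) t \<rho> = spinor_scale c (T u) t \<rho>"
    proof (cases "\<rho> \<in> rho_interval")
      case r: True
      then show ?thesis using T d_t_scale[OF reg r, of c t] d_rho_scale[OF reg r, of c t]
        by (auto simp: L_zero_def L_plus_def L_minus_def on_strip_def spinor_scale_apply
            vec_eq_iff forall_2 Sigma01_mult algebra_simps)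
    qed (use T in \<open>auto simp: L_zero_def L_plus_def L_minus_def on_strip_def spinor_scale_apply vec_eq_iff\<close>)
  qed
qed

section \<open>The inner product on regular spinors\<close>

lemma spinor_inner_integrable:
  assumes "regular_spinor u" "regular_spinor v"
  shows "set_integrable lborel rho_interval (\<lambda>\<rho>. \<Sum>i\<in>UNIV. cnj (u t \<rho> $ i) * v t \<rho> $ i)"
proof (rule set_integrable_rho)
  have c: "continuous_on rho_interval (\<lambda>\<rho>. w t \<rho> $ i)" if "regular_spinor w" for w i
  proof -
    have "isCont (w t) \<rho>" if "\<rho> \<in> rho_interval" for \<rho>
      using \<open>regular_spinor w\<close> that unfolding regular_spinor_def
      by (meson differentiable_imp_continuous_within)
    then show ?thesis by (intro continuous_intros continuous_at_imp_continuous_on) auto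
  qed
  show "continuous_on rho_interval (\<lambda>\<rho>. \<Sum>i\<in>UNIV. cnj (u t \<rho> $ i) * v t \<rho> $ i)"
    by (intro continuous_intros c assms)
  have v: "((\<lambda>\<rho>. v t \<rho> $ i) \<longlongrightarrow> 0) (at_left (pi / 2))" "((\<lambda>\<rho>. v t \<rho> $ i) \<longlongrightarrow> 0) (at_right (- pi / 2))" for i
    using assms(2) unfolding regular_spinor_def by blast+
  have u: "((\<lambda>\<rho>. cnj (u t \<rho> $ i)) \<longlongrightarrow> 0) (at_left (pi / 2))" "((\<lambda>\<rho>. cnj (u t \<rho> $ i)) \<longlongrightarrow> 0) (at_right (- pi / 2))" for i
    using assms(1) tendsto_cnj[of "\<lambda>\<rho>. u t \<rho> $ i" 0] unfolding regular_spinor_def by simp_all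
  show "((\<lambda>\<rho>. \<Sum>i\<in>UNIV. cnj (u t \<rho> $ i) * v t \<rho> $ i) \<longlongrightarrow> 0) (at_left (pi / 2))"
    "((\<lambda>\<rho>. \<Sum>i\<in>UNIV. cnj (u t \<rho> $ i) * v t \<rho> $ i) \<longlongrightarrow> 0) (at_right (- pi / 2))"
    by (intro tendsto_null_sum tendsto_mult_zero u v)+
qed

lemma spinor_inner_add:
  assumes "regular_spinor u" "regular_spinor v" "regular_spinor w"
  shows "spinor_inner t u (v + w) = spinor_inner t u v + spinor_inner t u w"
  unfolding spinor_inner_def
  using set_integral_add(2)[OF spinor_inner_integrable[OF assms(1,2), of t] spinor_inner_integrable[OF assms(1,3), of t]]
  by (simp add: distrib_left sum.distrib)

lemma spinor_inner_scale: "spinor_inner t u (spinor_scale c v) = c * spinor_inner t u v"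
proof -
  have "(\<Sum>i\<in>UNIV. cnj (u t \<rho> $ i) * spinor_scale c v t \<rho> $ i) = c * (\<Sum>i\<in>UNIV. cnj (u t \<rho> $ i) * v t \<rho> $ i)" for \<rho>
    by (simp add: spinor_scale_def sum_distrib_left mult_ac)
  then show ?thesis unfolding spinor_inner_def by simp
qed

lemma spinor_inner_sym: "spinor_inner t v u = cnj (spinor_inner t u v)"
  unfolding spinor_inner_def set_lebesgue_integral_def Bochner_Integration.integral_cnj[symmetric]
  by (simp add: mult.commute cong: Bochner_Integration.integral_cong)

lemma spinor_inner_scale_left: "spinor_inner t (spinor_scale c u) v = cnj c * spinor_inner t u v"
  using spinor_inner_sym[of t "spinor_scale c u" v] spinor_inner_sym[of t u v] spinor_inner_scale[of t v c u]
  by simp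

text \<open>Time enters only through a phase, which is \<open>1\<close> for equal frequencies and
  multiplies a vanishing integral for distinct ones when the profiles are orthogonal.\<close>

lemma spinor_inner_stationary:
  "spinor_inner t (stationary \<omega> f g) (stationary \<omega>' u v) =
     exp (\<i> * complex_of_real ((\<omega> - \<omega>') * t)) * complex_of_real (LINT \<rho>:rho_interval|lborel. f \<rho> * u \<rho> + g \<rho> * v \<rho>)"
proof -
  have e: "cnj (exp (- \<i> * complex_of_real (\<omega> * t))) * exp (- \<i> * complex_of_real (\<omega>' * t)) =
      exp (\<i> * complex_of_real ((\<omega> - \<omega>') * t))"
    by (simp add: exp_cnj algebra_simps flip: exp_add)
  have "spinor_inner t (stationary \<omega> f g) (stationary \<omega>' u v) = (LINT \<rho>:rho_interval|lborel.
      exp (\<i> * complex_of_real ((\<omega> - \<omega>') * t)) * complex_of_real (f \<rho> * u \<rho> + g \<rho> * v \<rho>))"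
    unfolding spinor_inner_def
  proof (rule set_lebesgue_integral_cong)
    show "rho_interval \<in> sets lborel" by (simp add: rho_interval_def)
    show "\<forall>\<rho>. \<rho> \<in> rho_interval \<longrightarrow> (\<Sum>i\<in>UNIV. cnj (stationary \<omega> f g t \<rho> $ i) * stationary \<omega>' u v t \<rho> $ i) =
        exp (\<i> * complex_of_real ((\<omega> - \<omega>') * t)) * complex_of_real (f \<rho> * u \<rho> + g \<rho> * v \<rho>)"
      unfolding e[symmetric] by (simp add: sum_2 stationary_component algebra_simps)
  qed
  then show ?thesis by (simp only: set_integral_mult_right set_integral_complex_of_real)
qed


section \<open>The spectrum and the two representations\<close>

lemma radial_system_signed_mode:
  assumes "s \<in> {1, -1}"
  shows "radial_system M (s * omega M n) (mode1 M n) (\<lambda>\<rho>. s * mode2 M n \<rho>)"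
  using assms radial_system_mode[of M n] radial_system_uminus[OF radial_system_mode[of M n]] by auto

lemma vanishing_signed_mode:
  assumes "s \<in> {1, -1}" "M > 0"
  shows "vanishing (mode1 M n) (\<lambda>\<rho>. s * mode2 M n \<rho>)"
  using assms vanishing_mode[of M n] vanishing_uminus[OF vanishing_mode[of M n]] by auto

lemma vanishing_signed_mode_unique:
  assumes s: "s \<in> {1, -1}" and sys: "radial_system M (s * omega M n) f g" and van: "vanishing f g"
    and M: "M \<ge> 1 / 2"
  obtains c where "\<And>\<rho>. \<rho> \<in> rho_interval \<Longrightarrow> f \<rho> = c * mode1 M n \<rho>"
    "\<And>\<rho>. \<rho> \<in> rho_interval \<Longrightarrow> g \<rho> = c * (s * mode2 M n \<rho>)"
proof (rule vanishing_unique[OF sys radial_system_signed_mode[OF s] van vanishing_signed_mode[OF s]])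
  show "mode1 M n 0 \<noteq> 0 \<or> s * mode2 M n 0 \<noteq> 0" using mode_nonzero[OF M, of n] s by auto
qed (use M that in auto)

definition spatial_mode :: "real \<Rightarrow> real \<Rightarrow> nat \<Rightarrow> real \<Rightarrow> complex^2" where
  "spatial_mode s M n \<rho> = vector [complex_of_real (mode1 M n \<rho>), complex_of_real (s * mode2 M n \<rho>)]"

lemma spatial_mode_solution:
  assumes s: "s \<in> {1, -1}" and M: "M \<ge> 1 / 2"
  shows "dirac_solution M (s * omega M n) (\<lambda>\<rho>. c *s spatial_mode s M n \<rho>) \<and>
     square_integrable (\<lambda>\<rho>. c *s spatial_mode s M n \<rho>)"
proof -
  let ?\<Phi> = "\<lambda>\<rho>. c *s spatial_mode s M n \<rho>"
  note sys = radial_system_signed_mode[OF s, of M n]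
  have van: "vanishing (mode1 M n) (\<lambda>\<rho>. s * mode2 M n \<rho>)" using vanishing_signed_mode[OF s] M by simp
  \<comment> \<open>The summands with factor \<open>0\<close> give the components the shape of the
    linear-combination lemmas, which then apply with a real scalar.\<close>
  have comp: "(\<lambda>\<rho>. Re (?\<Phi> \<rho> $ 1)) = (\<lambda>\<rho>. Re c * mode1 M n \<rho> + 0 * mode1 M n \<rho>)"
    "(\<lambda>\<rho>. Re (?\<Phi> \<rho> $ 2)) = (\<lambda>\<rho>. Re c * (s * mode2 M n \<rho>) + 0 * (s * mode2 M n \<rho>))"
    "(\<lambda>\<rho>. Im (?\<Phi> \<rho> $ 1)) = (\<lambda>\<rho>. Im c * mode1 M n \<rho> + 0 * mode1 M n \<rho>)"
    "(\<lambda>\<rho>. Im (?\<Phi> \<rho> $ 2)) = (\<lambda>\<rho>. Im c * (s * mode2 M n \<rho>) + 0 * (s * mode2 M n \<rho>))"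
    by (simp_all add: spatial_mode_def)
  have sol: "dirac_solution M (s * omega M n) ?\<Phi>"
    unfolding dirac_solution_iff_radial comp by (intro conjI radial_system_lincomb sys)
  moreover have "square_integrable ?\<Phi>"
    unfolding square_integrable_iff_vanishing[OF sol M] comp by (intro conjI vanishing_lincomb van)
  ultimately show ?thesis ..
qed

lemma solution_is_spatial_mode:
  assumes s: "s \<in> {1, -1}" and M: "M \<ge> 1 / 2"
    and sol: "dirac_solution M (s * omega M n) \<Phi>" and sq: "square_integrable \<Phi>"
  obtains c where "\<And>\<rho>. \<rho> \<in> rho_interval \<Longrightarrow> \<Phi> \<rho> = c *s spatial_mode s M n \<rho>"
proof -
  note sys = sol[unfolded dirac_solution_iff_radial]
  note van = sq[unfolded square_integrable_iff_vanishing[OF sol M]]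
  obtain a where a: "\<And>\<rho>. \<rho> \<in> rho_interval \<Longrightarrow> Re (\<Phi> \<rho> $ 1) = a * mode1 M n \<rho>"
    "\<And>\<rho>. \<rho> \<in> rho_interval \<Longrightarrow> Re (\<Phi> \<rho> $ 2) = a * (s * mode2 M n \<rho>)"
    using vanishing_signed_mode_unique[OF s conjunct1[OF sys] conjunct1[OF van] M] by blast
  obtain b where b: "\<And>\<rho>. \<rho> \<in> rho_interval \<Longrightarrow> Im (\<Phi> \<rho> $ 1) = b * mode1 M n \<rho>"
    "\<And>\<rho>. \<rho> \<in> rho_interval \<Longrightarrow> Im (\<Phi> \<rho> $ 2) = b * (s * mode2 M n \<rho>)"
    using vanishing_signed_mode_unique[OF s conjunct2[OF sys] conjunct2[OF van] M] by blast
  show ?thesis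
    by (rule that[of "Complex a b"])
      (simp add: vec_eq_iff forall_2 complex_eq_iff spatial_mode_def a b)
qed

lemma Psi_eq_spatial_mode:
  "Psi s M n = with_time (s * omega M n) (\<lambda>\<rho>. complex_of_real (norm_const M n) *s spatial_mode s M n \<rho>)"
  unfolding Psi_eq_stationary stationary_def with_time_scale spatial_mode_def ..

lemma square_integrable_iff_dirichlet_I:
  assumes "dirac_solution M \<omega> \<Phi>" "M \<ge> 1 / 2"
  shows "square_integrable \<Phi> \<longleftrightarrow> dirichlet_I M \<Phi>"
  using square_integrable_iff_vanishing[OF assms] dirichlet_I_iff_vanishing[OF assms(1)] assms(2) by simp

lemma spectrum:
  assumes M: "M \<ge> 1 / 2"
  shows "(\<exists>\<Phi>. dirac_solution M \<omega> \<Phi> \<and> square_integrable \<Phi> \<and> (\<exists>\<rho>\<in>rho_interval. \<Phi> \<rho> \<noteq> 0))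
         \<longleftrightarrow> (\<exists>n. \<omega> = omega M n \<or> \<omega> = - omega M n)"
proof
  assume "\<exists>\<Phi>. dirac_solution M \<omega> \<Phi> \<and> square_integrable \<Phi> \<and> (\<exists>\<rho>\<in>rho_interval. \<Phi> \<rho> \<noteq> 0)"
  then obtain \<Phi> \<rho> where sol: "dirac_solution M \<omega> \<Phi>" and sq: "square_integrable \<Phi>"
    and r: "\<rho> \<in> rho_interval" and nz: "\<Phi> \<rho> \<noteq> 0" by blast
  note sys = sol[unfolded dirac_solution_iff_radial]
  note van = sq[unfolded square_integrable_iff_vanishing[OF sol M]]
  show "\<exists>n. \<omega> = omega M n \<or> \<omega> = - omega M n"
  proof (rule ccontr)
    assume "\<not> ?thesis"
    then have w: "\<omega> \<noteq> omega M n" "\<omega> \<noteq> - omega M n" for n by auto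
    have "\<Phi> \<rho> = 0"
      using vanishing_off_spectrum[OF conjunct1[OF sys] conjunct1[OF van] M w r]
        vanishing_off_spectrum[OF conjunct2[OF sys] conjunct2[OF van] M w r]
      by (simp add: vec_eq_iff forall_2 complex_eq_iff)
    with nz show False ..
  qed
next
  assume "\<exists>n. \<omega> = omega M n \<or> \<omega> = - omega M n"
  then obtain n s where s: "s \<in> {1, -1}" and w: "\<omega> = s * omega M n" by force
  have "1 *s spatial_mode s M n 0 \<noteq> 0"
    using mode_nonzero[OF M, of n] s by (auto simp: vec_eq_iff forall_2 spatial_mode_def)
  then show "\<exists>\<Phi>. dirac_solution M \<omega> \<Phi> \<and> square_integrable \<Phi> \<and> (\<exists>\<rho>\<in>rho_interval. \<Phi> \<rho> \<noteq> 0)"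
    using spatial_mode_solution[OF s M, of n 1] zero_in_rho unfolding w by blast
qed

text \<open>Solutions are unconstrained outside the open interval. Passing to
  \<open>with_time\<close> cuts them off there, so that equality with a one-dimensional span can
  hold.\<close>

lemma eigenspace_span:
  assumes s: "s \<in> {1, -1}" and M: "M \<ge> 1 / 2"
  shows "with_time (s * omega M n) ` {\<Phi>. dirac_solution M (s * omega M n) \<Phi> \<and> square_integrable \<Phi>}
         = spinors.span {Psi s M n}"
proof (intro equalityI subsetI)
  fix \<Psi> assume "\<Psi> \<in> with_time (s * omega M n) ` {\<Phi>. dirac_solution M (s * omega M n) \<Phi> \<and> square_integrable \<Phi>}"
  then obtain \<Phi> where \<Phi>: "\<Psi> = with_time (s * omega M n) \<Phi>"
    "dirac_solution M (s * omega M n) \<Phi>" "square_integrable \<Phi>" by blast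
  obtain c where c: "\<And>\<rho>. \<rho> \<in> rho_interval \<Longrightarrow> \<Phi> \<rho> = c *s spatial_mode s M n \<rho>"
    using solution_is_spatial_mode[OF s M \<Phi>(2,3)] by blast
  have N: "complex_of_real (norm_const M n) \<noteq> 0" using norm_const_pos[OF M, of n] by simp
  have "\<Psi> = with_time (s * omega M n) (\<lambda>\<rho>. c *s spatial_mode s M n \<rho>)"
    unfolding \<Phi>(1) by (rule with_time_cong) (rule c)
  also have "\<dots> = spinor_scale (c / complex_of_real (norm_const M n)) (Psi s M n)"
    unfolding Psi_eq_spatial_mode with_time_scale using N by (simp add: spinor_scale_def vec_eq_iff)
  finally show "\<Psi> \<in> spinors.span {Psi s M n}" unfolding spinors.span_singleton by (rule range_eqI)
next
  fix \<Psi> assume "\<Psi> \<in> spinors.span {Psi s M n}"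
  then obtain c where "\<Psi> = spinor_scale c (Psi s M n)" by (auto simp: spinors.span_singleton)
  also have "\<dots> = with_time (s * omega M n) (\<lambda>\<rho>. (c * complex_of_real (norm_const M n)) *s spatial_mode s M n \<rho>)"
    unfolding Psi_eq_spatial_mode with_time_scale by (simp add: spinor_scale_def vec_eq_iff mult.assoc)
  finally show "\<Psi> \<in> with_time (s * omega M n) ` {\<Phi>. dirac_solution M (s * omega M n) \<Phi> \<and> square_integrable \<Phi>}"
    using spatial_mode_solution[OF s M] by blast
qed

lemma Psi_orthonormal:
  assumes s: "s \<in> {1, -1}" and M: "M \<ge> 1 / 2"
  shows "spinor_inner t (Psi s M m) (Psi s M n) = (if m = n then 1 else 0)"
proof -
  let ?I = "LINT \<rho>:rho_interval|lborel. mode1 M m \<rho> * mode1 M n \<rho> + mode2 M m \<rho> * mode2 M n \<rho>"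
  have ss: "s * a * (s * b) = a * b" for a b using s by auto
  have "spinor_inner t (Psi s M m) (Psi s M n) =
      complex_of_real (norm_const M m) * complex_of_real (norm_const M n) *
      (exp (\<i> * complex_of_real ((s * omega M m - s * omega M n) * t)) * complex_of_real ?I)"
    unfolding Psi_eq_stationary spinor_inner_scale spinor_inner_scale_left spinor_inner_stationary ss by simp
  also have "\<dots> = (if m = n then 1 else 0)"
  proof (cases "m = n")
    case True
    have "norm_const M n * norm_const M n * ?I = 1"
      using mode_norm[OF M, of n] True by (simp add: power2_eq_square)
    then have "complex_of_real (norm_const M n * norm_const M n * ?I) = 1" by simp
    then show ?thesis using True by simp
  next
    case False
    then have "?I = 0"
      using M by (intro radial_orthogonal[OF radial_system_mode radial_system_mode vanishing_mode vanishing_mode])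
        (auto simp: omega_def)
    then show ?thesis using False by simp
  qed
  finally show ?thesis .
qed

text \<open>The raising matrix at \<open>omega M n\<close> is minus the adjugate of the lowering
  matrix at \<open>omega M (Suc n)\<close>. Applied to the lowered mode it therefore returns minus
  the determinant times the mode \<open>Suc n\<close>. Keeping the factor \<open>omega M n\<close>
  on the left allows the lowering relation to be substituted directly.\<close>

lemma raise_mode:
  assumes M: "M \<ge> 1 / 2" and r: "\<rho> \<in> rho_interval"
  shows "omega M n * raise1 M (omega M n) (mode1 M n) (mode2 M n) \<rho> =
      - (real (Suc n) * (real (Suc n) + 2 * M)) * mode1 M (Suc n) \<rho>"
    "omega M n * raise2 M (omega M n) (mode1 M n) (mode2 M n) \<rho> =
      - (real (Suc n) * (real (Suc n) + 2 * M)) * mode2 M (Suc n) \<rho>"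
proof -
  define k where "k = omega M n + 1 / 2"
  have k: "omega M (Suc n) - 1 / 2 = k" by (simp add: k_def omega_def)
  define f where "f = mode1 M (Suc n) \<rho>"
  define g where "g = mode2 M (Suc n) \<rho>"
  define S where "S = sin \<rho>"
  define C where "C = cos \<rho>"
  have sc: "C * C = 1 - S * S" using sin_cos_squared_add[of \<rho>] by (simp add: S_def C_def power2_eq_square)
  have l: "omega M n * mode1 M n \<rho> = (k * S - M) * f + k * C * g"
    "omega M n * mode2 M n \<rho> = (k * S + M) * g - k * C * f"
    using lower_mode_Suc[OF M r, of n]
    unfolding lower1_def lower2_def k f_def[symmetric] g_def[symmetric] S_def[symmetric] C_def[symmetric]
    by simp_all
  have K: "real (Suc n) * (real (Suc n) + 2 * M) = k * k - M * M"
    by (simp add: k_def omega_def algebra_simps)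
  have C2: "C * (C * x) = x - S * (S * x)" for x
    using arg_cong[OF sc, of "\<lambda>y. y * x"] by (simp add: algebra_simps)
  have "omega M n * raise1 M (omega M n) (mode1 M n) (mode2 M n) \<rho> =
      - (k * S + M) * (omega M n * mode1 M n \<rho>) + k * C * (omega M n * mode2 M n \<rho>)"
    by (simp add: raise1_def k_def S_def C_def algebra_simps)
  also have "\<dots> = - (k * k - M * M) * f"
    unfolding l by (simp add: algebra_simps C2)
  finally show "omega M n * raise1 M (omega M n) (mode1 M n) (mode2 M n) \<rho> =
      - (real (Suc n) * (real (Suc n) + 2 * M)) * mode1 M (Suc n) \<rho>" unfolding K f_def .
  have "omega M n * raise2 M (omega M n) (mode1 M n) (mode2 M n) \<rho> =
      (M - k * S) * (omega M n * mode2 M n \<rho>) - k * C * (omega M n * mode1 M n \<rho>)"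
    by (simp add: raise2_def k_def S_def C_def algebra_simps)
  also have "\<dots> = - (k * k - M * M) * g"
    unfolding l by (simp add: algebra_simps C2)
  finally show "omega M n * raise2 M (omega M n) (mode1 M n) (mode2 M n) \<rho> =
      - (real (Suc n) * (real (Suc n) + 2 * M)) * mode2 M (Suc n) \<rho>" unfolding K g_def .
qed

section \<open>Ladder relations between the normalised modes\<close>

definition ladder_coeff :: "real \<Rightarrow> nat \<Rightarrow> real" where
  "ladder_coeff M n = omega M n * norm_const M (Suc n) / norm_const M n"

text \<open>The recursion of the normalising constants read as a ladder relation. With
  \<open>l = 1 / 2 + M\<close> the value is \<open>Suc n * (n + 2 * l)\<close>, as the discrete
  series prescribes.\<close>

lemma ladder_coeff_squared:
  assumes M: "M \<ge> 1 / 2"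
  shows "ladder_coeff M n * ladder_coeff M n = real (Suc n) * (real (Suc n) + 2 * M)"
  using norm_const_Suc[OF M, of n] norm_const_pos[OF M, of n]
  by (simp add: ladder_coeff_def field_simps power2_eq_square)

lemma lower_raise_uminus:
  "lower1 M (- \<omega>) f (\<lambda>\<rho>. - g \<rho>) = raise1 M \<omega> f g" "lower2 M (- \<omega>) f (\<lambda>\<rho>. - g \<rho>) = (\<lambda>\<rho>. - raise2 M \<omega> f g \<rho>)"
  "raise1 M (- \<omega>) f (\<lambda>\<rho>. - g \<rho>) = lower1 M \<omega> f g" "raise2 M (- \<omega>) f (\<lambda>\<rho>. - g \<rho>) = (\<lambda>\<rho>. - lower2 M \<omega> f g \<rho>)"
  by (simp_all add: fun_eq_iff lower1_def lower2_def raise1_def raise2_def algebra_simps)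

text \<open>On the negative-frequency modes the two ladder operators exchange their roles.\<close>

definition lowering :: "real \<Rightarrow> spinor \<Rightarrow> spinor" where
  "lowering s = (if s = 1 then L_minus else L_plus)"

definition raising :: "real \<Rightarrow> spinor \<Rightarrow> spinor" where
  "raising s = (if s = 1 then L_plus else L_minus)"

lemma
  assumes s: "s \<in> {1, -1}" and sys: "radial_system M \<omega> f g"
  shows lowering_stationary: "lowering s (stationary (s * \<omega>) f (\<lambda>\<rho>. s * g \<rho>)) =
      spinor_scale (- \<i> * complex_of_real s)
        (stationary (s * (\<omega> - 1)) (lower1 M \<omega> f g) (\<lambda>\<rho>. s * lower2 M \<omega> f g \<rho>))"
    and raising_stationary: "raising s (stationary (s * \<omega>) f (\<lambda>\<rho>. s * g \<rho>)) =
      spinor_scale (\<i> * complex_of_real s)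
        (stationary (s * (\<omega> + 1)) (raise1 M \<omega> f g) (\<lambda>\<rho>. s * raise2 M \<omega> f g \<rho>))"
  using s L_minus_stationary[OF sys] L_plus_stationary[OF sys]
    L_minus_stationary[OF radial_system_uminus[OF sys]] L_plus_stationary[OF radial_system_uminus[OF sys]]
  by (auto simp: lowering_def raising_def lower_raise_uminus minus_diff_commute add.commute)

context
  fixes s M :: real
  assumes s: "s \<in> {1, -1}" and M: "M \<ge> 1 / 2"
begin

lemma regular_Psi: "regular_spinor (Psi s M n)"
proof -
  have "regular_spinor (stationary (s * omega M n) (mode1 M n) (\<lambda>\<rho>. s * mode2 M n \<rho>))"
    using M by (intro regular_stationary[OF radial_system_signed_mode[OF s]] vanishing_signed_mode[OF s]) simp
  then show ?thesis
    unfolding Psi_eq_stationary using spinors.subspace_scale[OF subspace_regular] by blast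
qed

lemma regular_span: "spinors.span (range (Psi s M)) \<subseteq> {\<Psi>. regular_spinor \<Psi>}"
  using regular_Psi by (intro spinors.span_minimal subspace_regular) auto

lemma scale_out:
  assumes "T \<in> {L_zero, lowering s, raising s}"
  shows "T (Psi s M n) = spinor_scale (complex_of_real (norm_const M n))
    (T (stationary (s * omega M n) (mode1 M n) (\<lambda>\<rho>. s * mode2 M n \<rho>)))"
proof -
  have "regular_spinor (stationary (s * omega M n) (mode1 M n) (\<lambda>\<rho>. s * mode2 M n \<rho>))"
    using M by (intro regular_stationary[OF radial_system_signed_mode[OF s]] vanishing_signed_mode[OF s]) simp
  moreover have "spinors.linear_op_on {\<Psi>. regular_spinor \<Psi>} T"
    using assms by (intro linear_L) (auto simp: lowering_def raising_def)
  ultimately show ?thesis unfolding Psi_eq_stationary spinors.linear_op_on_def by blast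
qed

lemma L_zero_Psi: "L_zero (Psi s M n) = spinor_scale (complex_of_real (s * omega M n)) (Psi s M n)"
proof -
  have "L_zero (Psi s M n) = spinor_scale (complex_of_real (norm_const M n))
    (spinor_scale (complex_of_real (s * omega M n)) (stationary (s * omega M n) (mode1 M n) (\<lambda>\<rho>. s * mode2 M n \<rho>)))"
    unfolding scale_out[of L_zero, simplified] L_zero_stationary ..
  then show ?thesis unfolding Psi_eq_stationary by (simp add: mult.commute)
qed

lemma stationary_multiple_of_Psi:
  assumes "\<And>\<rho>. \<rho> \<in> rho_interval \<Longrightarrow> f \<rho> = c * mode1 M n \<rho>" "\<And>\<rho>. \<rho> \<in> rho_interval \<Longrightarrow> g \<rho> = c * mode2 M n \<rho>"
  shows "stationary (s * omega M n) f (\<lambda>\<rho>. s * g \<rho>) = spinor_scale (complex_of_real (c / norm_const M n)) (Psi s M n)"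
proof -
  have "stationary (s * omega M n) f (\<lambda>\<rho>. s * g \<rho>) =
      stationary (s * omega M n) (\<lambda>\<rho>. c * mode1 M n \<rho>) (\<lambda>\<rho>. c * (s * mode2 M n \<rho>))"
    by (rule stationary_cong) (simp_all add: assms)
  then show ?thesis
    using norm_const_pos[OF M, of n] by (simp add: stationary_scale Psi_eq_stationary)
qed

lemma lowering_Psi_0: "lowering s (Psi s M 0) = 0"
proof -
  have "stationary (s * (omega M 0 - 1)) (lower1 M (omega M 0) (mode1 M 0) (mode2 M 0))
      (\<lambda>\<rho>. s * lower2 M (omega M 0) (mode1 M 0) (mode2 M 0) \<rho>) =
    stationary (s * (omega M 0 - 1)) (\<lambda>\<rho>. 0 * 0) (\<lambda>\<rho>. 0 * 0)"
    using lower_mode_0[OF M] by (intro stationary_cong) simp_all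
  also have "\<dots> = 0" unfolding stationary_scale by simp
  finally show ?thesis
    unfolding scale_out[of "lowering s", simplified] lowering_stationary[OF s radial_system_mode] by simp
qed

lemma lowering_Psi_Suc:
  "lowering s (Psi s M (Suc n)) = spinor_scale (- \<i> * complex_of_real (s * ladder_coeff M n)) (Psi s M n)"
proof -
  have om: "omega M (Suc n) - 1 = omega M n" by (simp add: omega_def)
  have "lowering s (Psi s M (Suc n)) = spinor_scale (complex_of_real (norm_const M (Suc n)))
      (spinor_scale (- \<i> * complex_of_real s)
        (spinor_scale (complex_of_real (omega M n / norm_const M n)) (Psi s M n)))"
    unfolding scale_out[of "lowering s", simplified] lowering_stationary[OF s radial_system_mode] om
    by (intro arg_cong2[where f = spinor_scale] refl stationary_multiple_of_Psi lower_mode_Suc[OF M])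
  then show ?thesis by (simp add: ladder_coeff_def mult_ac)
qed

lemma raising_Psi:
  "raising s (Psi s M n) = spinor_scale (- \<i> * complex_of_real (s * ladder_coeff M n)) (Psi s M (Suc n))"
proof -
  have om: "omega M n + 1 = omega M (Suc n)" by (simp add: omega_def)
  define K where "K = real (Suc n) * (real (Suc n) + 2 * M)"
  have w: "omega M n > 0" using M by (simp add: omega_def)
  have N: "norm_const M n > 0" "norm_const M (Suc n) > 0" using norm_const_pos[OF M] by auto
  have "raise1 M (omega M n) (mode1 M n) (mode2 M n) \<rho> = (- K / omega M n) * mode1 M (Suc n) \<rho>"
    "raise2 M (omega M n) (mode1 M n) (mode2 M n) \<rho> = (- K / omega M n) * mode2 M (Suc n) \<rho>"
    if "\<rho> \<in> rho_interval" for \<rho>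
    using raise_mode[OF M that, of n, folded K_def] w by (simp_all add: field_simps)
  then have m: "stationary (s * omega M (Suc n)) (raise1 M (omega M n) (mode1 M n) (mode2 M n))
      (\<lambda>\<rho>. s * raise2 M (omega M n) (mode1 M n) (mode2 M n) \<rho>) =
    spinor_scale (complex_of_real (- K / omega M n / norm_const M (Suc n))) (Psi s M (Suc n))"
    by (rule stationary_multiple_of_Psi)
  \<comment> \<open>The left-hand side is \<open>- K / ladder_coeff M n\<close>, and
    \<open>K\<close> is the square of \<open>ladder_coeff M n\<close>. Raising thus has the same
    coefficient as lowering between the same two modes.\<close>
  have "norm_const M n * (- K / omega M n / norm_const M (Suc n)) = - ladder_coeff M n"
    using ladder_coeff_squared[OF M, of n, folded K_def] w N
    by (simp add: ladder_coeff_def field_simps)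
  then have c: "complex_of_real (norm_const M n) * complex_of_real (- K / omega M n / norm_const M (Suc n)) =
      - complex_of_real (ladder_coeff M n)" by (metis of_real_minus of_real_mult)
  have "raising s (Psi s M n) = spinor_scale ((\<i> * complex_of_real s) *
      (complex_of_real (norm_const M n) * complex_of_real (- K / omega M n / norm_const M (Suc n)))) (Psi s M (Suc n))"
    unfolding scale_out[of "raising s", simplified] raising_stationary[OF s radial_system_mode] om m
    by (simp only: spinors.scale_scale mult_ac)
  then show ?thesis unfolding c by simp
qed

text \<open>Multiplying \<open>L_zero\<close> by \<open>s\<close> makes the weights
  \<open>l + n\<close> for either sign. The two coefficient sequences coincide and are purely
  imaginary, which is the required relation \<open>a n = - cnj (b n)\<close>.\<close>

lemma ladder:
  "lowest_weight_ladder spinor_scale (Psi s M) (spinors.span (range (Psi s M))) (spinor_inner t)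
     (\<lambda>v. spinor_scale (complex_of_real s) (L_zero v)) (raising s) (lowering s) (1 / 2 + M)
     (\<lambda>n. - \<i> * complex_of_real (s * ladder_coeff M n)) (\<lambda>n. - \<i> * complex_of_real (s * ladder_coeff M n))"
proof
  let ?V = "spinors.span (range (Psi s M))"
  have ss: "s * s = 1" using s by auto
  have L: "spinors.linear_op_on ?V L_zero" by (rule linear_L[OF regular_span]) simp
  show "0 < 1 / 2 + M" using M by simp
  show "spinors.linear_op_on ?V (\<lambda>v. spinor_scale (complex_of_real s) (L_zero v))"
    using L unfolding spinors.linear_op_on_def
    by (simp add: spinors.scale_right_distrib spinors.scale_left_commute)
  show "spinors.linear_op_on ?V (raising s)" "spinors.linear_op_on ?V (lowering s)"
    by (rule linear_L[OF regular_span], simp add: raising_def lowering_def)+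
  fix n
  show "spinor_scale (complex_of_real s) (L_zero (Psi s M n)) =
      spinor_scale (complex_of_real (1 / 2 + M + real n)) (Psi s M n)"
    unfolding L_zero_Psi spinors.scale_scale of_real_mult[symmetric] mult.assoc[symmetric] ss
    by (simp add: omega_def)
  show "- \<i> * complex_of_real (s * ladder_coeff M n) = - cnj (- \<i> * complex_of_real (s * ladder_coeff M n))"
    by simp
  have "(s * ladder_coeff M n) * (s * ladder_coeff M n) = (s * s) * (ladder_coeff M n * ladder_coeff M n)"
    by (simp only: mult_ac)
  also have "\<dots> = real (Suc n) * (real n + 2 * (1 / 2 + M))"
    unfolding ss ladder_coeff_squared[OF M] by (simp add: algebra_simps)
  finally have "complex_of_real ((s * ladder_coeff M n) * (s * ladder_coeff M n)) =
      complex_of_real (real (Suc n) * (real n + 2 * (1 / 2 + M)))" by (rule arg_cong)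
  moreover have "- \<i> * x * cnj (- \<i> * x) = x * x" if "cnj x = x" for x
  proof -
    have "- \<i> * x * cnj (- \<i> * x) = - \<i> * x * (\<i> * x)" using that by simp
    also have "\<dots> = - (\<i> * \<i>) * (x * x)" by (simp only: mult_minus_left mult_minus_right mult_ac)
    finally show ?thesis by simp
  qed
  ultimately show "- \<i> * complex_of_real (s * ladder_coeff M n) * cnj (- \<i> * complex_of_real (s * ladder_coeff M n)) =
      complex_of_real (real (Suc n) * (real n + 2 * (1 / 2 + M)))" by simp
next
  fix u v w assume "u \<in> spinors.span (range (Psi s M))" "v \<in> spinors.span (range (Psi s M))"
    "w \<in> spinors.span (range (Psi s M))"
  then show "spinor_inner t u (v + w) = spinor_inner t u v + spinor_inner t u w"
    using regular_span by (intro spinor_inner_add) auto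
qed (rule refl lowering_Psi_0 lowering_Psi_Suc raising_Psi Psi_orthonormal[OF s M] spinor_inner_sym
    spinor_inner_scale)+

text \<open>The modes are orthonormal at every time, and a sesquilinear form on their span is
  determined by its values on them.\<close>

lemma spinor_inner_time_independent:
  assumes u: "u \<in> spinors.span (range (Psi s M))" and v: "v \<in> spinors.span (range (Psi s M))"
  shows "spinor_inner t u v = spinor_inner t' u v"
proof -
  interpret A: lowest_weight_ladder spinor_scale "Psi s M" "spinors.span (range (Psi s M))" "spinor_inner t"
     "\<lambda>v. spinor_scale (complex_of_real s) (L_zero v)" "raising s" "lowering s" "1 / 2 + M"
     "\<lambda>n. - \<i> * complex_of_real (s * ladder_coeff M n)" "\<lambda>n. - \<i> * complex_of_real (s * ladder_coeff M n)"
    by (rule ladder)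
  interpret B: lowest_weight_ladder spinor_scale "Psi s M" "spinors.span (range (Psi s M))" "spinor_inner t'"
     "\<lambda>v. spinor_scale (complex_of_real s) (L_zero v)" "raising s" "lowering s" "1 / 2 + M"
     "\<lambda>n. - \<i> * complex_of_real (s * ladder_coeff M n)" "\<lambda>n. - \<i> * complex_of_real (s * ladder_coeff M n)"
    by (rule ladder)
  have "spinor_inner t (Psi s M m) v = spinor_inner t' (Psi s M m) v" for m
    using v
  proof (induction rule: A.mode_induct)
    case (mode n)
    show ?case by (simp only: A.orthonormal B.orthonormal)
  next
    case (add x y)
    then show ?case by (simp only: A.ip_add[OF A.\<psi>_in_V] B.ip_add[OF A.\<psi>_in_V])
  next
    case (scale c x)
    then show ?case by (simp only: spinor_inner_scale)
  qed
  note modes = this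
  show ?thesis using u
  proof (induction rule: A.mode_induct)
    case (mode n)
    show ?case by (rule modes)
  next
    case (add x y)
    then show ?case using v by (simp only: A.ip_add_left B.ip_add_left)
  next
    case (scale c x)
    then show ?case by (simp only: spinor_inner_scale_left)
  qed
qed

end

text \<open>For \<open>s = - 1\<close> the ladder yields a lowest-weight representation for
  \<open>- L_zero\<close> in which \<open>L_minus\<close> raises; the automorphism turns it into the
  highest-weight one.\<close>

lemma discrete_series_Psi:
  assumes M: "M \<ge> 1 / 2"
  shows "spinors.discrete_series_plus (1 / 2 + M) (spinor_inner t)
         (spinors.span (range (Psi 1 M))) L_zero L_plus L_minus"
    and "spinors.discrete_series_minus (1 / 2 + M) (spinor_inner t)
         (spinors.span (range (Psi (-1) M))) L_zero L_plus L_minus"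
proof -
  show "spinors.discrete_series_plus (1 / 2 + M) (spinor_inner t)
         (spinors.span (range (Psi 1 M))) L_zero L_plus L_minus"
    using lowest_weight_ladder.discrete_series[OF ladder[OF _ M, of 1 t]]
    by (simp add: raising_def lowering_def)
  have "spinors.discrete_series_plus (1 / 2 + M) (spinor_inner t)
         (spinors.span (range (Psi (-1) M))) (\<lambda>v. - L_zero v) L_minus L_plus"
    using lowest_weight_ladder.discrete_series[OF ladder[OF _ M, of "-1" t]]
    by (simp add: raising_def lowering_def)
  then show "spinors.discrete_series_minus (1 / 2 + M) (spinor_inner t)
         (spinors.span (range (Psi (-1) M))) L_zero L_plus L_minus"
    by (rule spinors.discrete_series_minus_if_plus)
qed

lemma span_Psi_invariant:
  assumes s: "s \<in> {1, -1}" and M: "M \<ge> 1 / 2" and T: "T \<in> {L_zero, L_plus, L_minus}"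
  shows "spinors.invariant_under T (spinors.span (range (Psi s M)))"
proof -
  have "spinors.sl2_rep (spinors.span (range (Psi s M))) L_zero L_plus L_minus"
    using s discrete_series_Psi[OF M, of 0]
    by (auto simp: spinors.discrete_series_plus_def spinors.discrete_series_minus_def
        spinors.unitary_sl2_rep_def)
  then show ?thesis using T unfolding spinors.sl2_rep_def by blast
qed

theorem mainTheorem4:
  fixes M :: real
  assumes "M \<ge> 1 / 2"
  shows
    "(\<comment> \<open>(a)\<close>
      \<forall>\<omega> \<Phi>. dirac_solution M \<omega> \<Phi> \<longrightarrow> (square_integrable \<Phi> \<longleftrightarrow> dirichlet_I M \<Phi>)) \<and>
     (\<comment> \<open>(b)\<close>
      (\<forall>\<omega>. (\<exists>\<Phi>. dirac_solution M \<omega> \<Phi> \<and> square_integrable \<Phi> \<and> (\<exists>\<rho>\<in>rho_interval. \<Phi> \<rho> \<noteq> 0))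
         \<longleftrightarrow> (\<exists>n. \<omega> = omega M n \<or> \<omega> = - omega M n)) \<and>
      (\<forall>s\<in>{1, -1}. \<forall>n.
         with_time (s * omega M n) `
           {\<Phi>. dirac_solution M (s * omega M n) \<Phi> \<and> square_integrable \<Phi>}
         = spinors.span {Psi s M n} \<and>
         (\<forall>t. spinor_inner t (Psi s M n) (Psi s M n) = 1))) \<and>
     (\<comment> \<open>(c)\<close>
      (\<forall>s\<in>{1, -1}. \<forall>T\<in>{L_zero, L_plus, L_minus}.
         spinors.invariant_under T (spinors.span (range (Psi s M)))) \<and>
      (\<forall>s\<in>{1, -1}. \<forall>u\<in>spinors.span (range (Psi s M)). \<forall>v\<in>spinors.span (range (Psi s M)).
         \<forall>t t'. spinor_inner t u v = spinor_inner t' u v) \<and>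
      (\<forall>t. spinors.discrete_series_plus (1 / 2 + M) (spinor_inner t)
         (spinors.span (range (Psi 1 M))) L_zero L_plus L_minus) \<and>
      (\<forall>t. spinors.discrete_series_minus (1 / 2 + M) (spinor_inner t)
         (spinors.span (range (Psi (-1) M))) L_zero L_plus L_minus))"
proof (intro conjI)
  show "\<forall>\<omega> \<Phi>. dirac_solution M \<omega> \<Phi> \<longrightarrow> (square_integrable \<Phi> \<longleftrightarrow> dirichlet_I M \<Phi>)"
    using square_integrable_iff_dirichlet_I assms by blast
  show "\<forall>\<omega>. (\<exists>\<Phi>. dirac_solution M \<omega> \<Phi> \<and> square_integrable \<Phi> \<and> (\<exists>\<rho>\<in>rho_interval. \<Phi> \<rho> \<noteq> 0))
         \<longleftrightarrow> (\<exists>n. \<omega> = omega M n \<or> \<omega> = - omega M n)"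
    using spectrum[OF assms] by blast
  show "\<forall>s\<in>{1, -1}. \<forall>n.
         with_time (s * omega M n) `
           {\<Phi>. dirac_solution M (s * omega M n) \<Phi> \<and> square_integrable \<Phi>}
         = spinors.span {Psi s M n} \<and>
         (\<forall>t. spinor_inner t (Psi s M n) (Psi s M n) = 1)"
    using eigenspace_span[OF _ assms] Psi_orthonormal[OF _ assms] by simp
  show "\<forall>s\<in>{1, -1}. \<forall>T\<in>{L_zero, L_plus, L_minus}.
         spinors.invariant_under T (spinors.span (range (Psi s M)))"
    using span_Psi_invariant[OF _ assms] by blast
  show "\<forall>s\<in>{1, -1}. \<forall>u\<in>spinors.span (range (Psi s M)). \<forall>v\<in>spinors.span (range (Psi s M)).
         \<forall>t t'. spinor_inner t u v = spinor_inner t' u v"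
    using spinor_inner_time_independent[OF _ assms] by blast
qed (use discrete_series_Psi[OF assms] in blast)+


end
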